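(* Suppose $\lambda_a<1$ and $\lambda_e\in\left(1-\frac{1}{|\lambda_{\max}(A)|^2},1\right)$. Fix a reference policy and $\epsilon_s>0$. Denote by $\tau^\star$ the optimal policy derived from the infinite-dimensional linear program (Problem 2) and by $\tau^c$ the optimal truncated policy derived from the finite-dimensional linear program with truncation horizon $N_t$ (Problem 3). Then $$J_e(\tau^c)\le J_e(\tau^\star)+\epsilon_g(N_t).$$ In addition, when $\tau^c$ is implemented, $$\|\omega_s-\rho_s\|_1\le\epsilon_s+\epsilon_\omega(N_t).$$ Here $\lim_{N_t\to\infty}\epsilon_g(N_t)=0$ and $\lim_{N_t\to\infty}\epsilon_\omega(N_t)=0$.
   Context: System: $x_{k+1}=Ax_k+w_k$, $y_k=Cx_k+v_k$, with $w_k,v_k$ mutually independent zero-mean (white) Gaussian noises with covariances $Q$ and $R$; $(C,A)$ observable, $(A,\sqrt Q)$ controllable. $\overline P$ is the steady-state posterior error covariance of the Kalman filter. $f(X)=AXA^\top+Q$, $f^n$ is the $n$-fold composition. $|\lambda_{\max}(A)|$ is the largest modulus of an eigenvalue of $A$. Channels: $\nu_k\in\mathbb{A}=\{0,1\}$ is the transmission command. If $\nu_k=1$, the packet is received by the legitimate estimator ($\gamma_k=1$) with probability $\lambda$ and by the adversary ($\gamma_k^e=1$) with probability $\lambda_e$, independently; if $\nu_k=0$ nothing is received. If $\nu_k\gamma_k=1$, an ACK reaches the sensor ($\gamma^a_k=1$) with probability $\lambda_a$; otherwise $\gamma_k^a=0$. Holding times: $\eta^s_k=0$ if $\gamma^a_k=1$,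 else $\eta^s_k=\eta^s_{k-1}+1$; $\eta^e_k=0$ if $\nu_k\gamma_k^e=1$, else $\eta^e_k=\eta^e_{k-1}+1$. Reference policy: $\mathbb{P}(\nu_{k+1}=1\mid\eta^s_k=i)=\tau_i\in[0,1]$, under which $\eta^s_k$ has a stationary distribution; $\omega_s(i,a)$ is the stationary probability of $(\eta_k^s=i,\nu_{k+1}=a)$ under it. Malicious policy $\tau$: $\mathbb{P}(\nu_{k+1}=1\mid\eta^s_k=i,\eta^e_k=j)=\tau_{ij}$; $\rho_s(i,a)$ is the stationary probability of $(\eta^s_k=i,\nu_{k+1}=a)$ under it, and $J_e(\tau)=\lim_{T\to\infty}\frac1T\sum_{k=1}^T\mathrm{tr}(\mathbb{E}(P_k^e))$ with $P_k^e=f^{\eta_k^e}(\overline P)$. MDP: states $(i,j)=(\eta^s_k,\eta^e_k)\in\mathbb{N}^2$, action $a=\nu_{k+1}$. From $(i,j)$: under $a=0$ the next state is $(i+1,j+1)$ with probability 1; under $a=1$ it is $(i+1,j+1)$, $(0,j+1)$, $(i+1,0)$, $(0,0)$ with probabilities $(1-\lambda\lambda_a)(1-\lambda_e)$, $\lambda\lambda_a(1-\lambda_e)$, $(1-\lambda\lambda_a)\lambda_e$, $\lambda\lambda_a\lambda_e$. Let $\mathcal{P}_{i',j',a,i,j}$ denote the transition probability from $(i',j')$ to $(i,j)$ under $a$. The truncated MDP with horizon $N_t$ has states $0\le i,j\le N_t$ and the same transitions with $i+1,j+1$ replaced by $\min(i+1,N_t),\min(j+1,N_t)$. $\Omega$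 (resp. $\Omega_{N_t}$) is the set of nonnegative $\rho(i,j,a)$ on $\mathbb{N}^2\times\mathbb{A}$ (resp. on $\{0,\dots,N_t\}^2\times\mathbb{A}$) summing to 1 with $\sum_a\rho(i,j,a)=\sum_{i',j',a}\rho(i',j',a)\mathcal{P}_{i',j',a,i,j}$ for all $(i,j)$, using the transition probabilities of the full (resp. truncated) MDP. Problem 2: minimize $J_e=\sum_{i,j,a}\rho(i,j,a)\mathrm{tr}(f^j(\overline P))$ over $\rho\in\Omega$ subject to $\sum_{i\in\mathbb{N},a\in\mathbb{A}}\left|\sum_{j\in\mathbb{N}}\rho(i,j,a)-\omega_s(i,a)\right|\le\epsilon_s$. From an optimal $\rho$, $\tau^\star_{ij}=\rho(i,j,1)/\sum_a\rho(i,j,a)$. Problem 3: minimize $J_e=\sum_{i\le N_t,\,j\le N_t-1,\,a}\rho_t(i,j,a)\mathrm{tr}(f^j(\overline P))+\sum_{i\le N_t}\rho_t(i,N_t,1)\sum_{j=N_t}^\infty\lambda_e(1-\lambda_e)^{j-N_t}\mathrm{tr}f^j(\overline P)$ over $\rho_t\in\Omega_{N_t}$ and $\epsilon_{i,a}$ subject to: $\rho_t(i,j,0)=0$ if $i=N_t$ or $j=N_t$; $|\sum_{j\le N_t}\rho_t(i,j,a)-\omega_s(i,a)|\le\epsilon_{i,a}$ for $0\le i<N_t$; $|\sum_{j\le N_t}\rho_t(N_t,j,a)-\sum_{i\ge N_t}\omega_s(i,a)|\le\epsilon_{N_t,a}$; $\sum_{0\le i\le N_t,a}\epsilon_{i,a}\le\epsilon_s$.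 From an optimal $\rho_t^c$, $\tau^c_{ij}=\rho^c_t(i,j,1)/\sum_a\rho_t^c(i,j,a)$ for $0\le i,j<N_t$, and $\tau^c_{ij}=1$ if $i\ge N_t$ or $j\ge N_t$. *)

theory Defs
  imports "HOL-Probability.Probability"
begin

subsection \<open>Linear system and Kalman filter\<close>

definition psd :: "real ^ 'n ^ 'n \<Rightarrow> bool" where
  "psd X \<longleftrightarrow> transpose X = X \<and> (\<forall>v. 0 \<le> v \<bullet> (X *v v))"

definition psd_sqrt :: "real ^ 'n ^ 'n \<Rightarrow> real ^ 'n ^ 'n" where
  "psd_sqrt X = (THE S. psd S \<and> S ** S = X)"

text \<open>Kalman rank conditions: the columns of \<open>B, A B, \<dots>, A\<^sup>n\<^sup>-\<^sup>1 B\<close> and the rows of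
  \<open>C, C A, \<dots>, C A\<^sup>n\<^sup>-\<^sup>1\<close>, respectively, span the state space.\<close>

definition controllable :: "real ^ 'n ^ 'n \<Rightarrow> real ^ 'k ^ 'n \<Rightarrow> bool" where
  "controllable A B \<longleftrightarrow>
     span (\<Union>k<CARD('n). columns (((\<lambda>X. A ** X) ^^ k) B)) = UNIV"

definition observable :: "real ^ 'n ^ 'm \<Rightarrow> real ^ 'n ^ 'n \<Rightarrow> bool" where
  "observable C A \<longleftrightarrow>
     span (\<Union>k<CARD('n). rows (((\<lambda>X. X ** A) ^^ k) C)) = UNIV"

definition max_eigenvalue_modulus :: "real ^ 'n ^ 'n \<Rightarrow> real" where
  "max_eigenvalue_modulus A =
     Max {cmod \<mu> |\<mu>. \<exists>v :: complex ^ 'n. v \<noteq> 0 \<and> map_matrix complex_of_real A *v v = \<mu> *s v}"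

definition prior_update :: "real ^ 'n ^ 'n \<Rightarrow> real ^ 'n ^ 'n \<Rightarrow> real ^ 'n ^ 'n \<Rightarrow> real ^ 'n ^ 'n" where
  "prior_update A Q X = A ** X ** transpose A + Q"

definition measurement_update ::
    "real ^ 'n ^ 'm \<Rightarrow> real ^ 'm ^ 'm \<Rightarrow> real ^ 'n ^ 'n \<Rightarrow> real ^ 'n ^ 'n" where
  "measurement_update C R X =
     X - X ** transpose C ** matrix_inv (C ** X ** transpose C + R) ** C ** X"

definition steady_state_posterior_cov ::
    "real ^ 'n ^ 'n \<Rightarrow> real ^ 'n ^ 'm \<Rightarrow> real ^ 'n ^ 'n \<Rightarrow> real ^ 'm ^ 'm \<Rightarrow> real ^ 'n ^ 'n \<Rightarrow> bool" where
  "steady_state_posterior_cov A C Q R P \<longleftrightarrow> psd P \<and>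
     (\<forall>P0. psd P0 \<longrightarrow>
        (\<lambda>k. ((\<lambda>X. measurement_update C R (prior_update A Q X)) ^^ k) P0) \<longlonglongrightarrow> P)"

text \<open>The error trace \<open>tr (f\<^sup>j P)\<close>. It is nonnegative for positive semidefinite \<open>P\<close> and \<open>Q\<close>, so
  the embedding into \<^typ>\<open>ennreal\<close> loses nothing, while costs may be infinite.\<close>

definition error_trace ::
    "real ^ 'n ^ 'n \<Rightarrow> real ^ 'n ^ 'n \<Rightarrow> real ^ 'n ^ 'n \<Rightarrow> nat \<Rightarrow> ennreal" where
  "error_trace A Q P j = ennreal (trace ((prior_update A Q ^^ j) P))"

subsection \<open>Holding times under a policy\<close>

text \<open>Parameters \<open>l\<close>, \<open>le\<close>, \<open>la\<close> are the success probabilities of the legitimate channel, of the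
  eavesdropping channel and of the ACK channel. Actions are Booleans, \<^term>\<open>True\<close> meaning
  that a packet is sent.\<close>

definition sensor_step :: "real \<Rightarrow> real \<Rightarrow> (nat \<Rightarrow> real) \<Rightarrow> nat \<Rightarrow> nat pmf" where
  "sensor_step l la \<tau> i = do {
     \<nu> \<leftarrow> bernoulli_pmf (\<tau> i);
     \<gamma> \<leftarrow> bernoulli_pmf l;
     ack \<leftarrow> bernoulli_pmf la;
     return_pmf (if \<nu> \<and> \<gamma> \<and> ack then 0 else i + 1)
   }"

definition joint_step ::
    "real \<Rightarrow> real \<Rightarrow> real \<Rightarrow> (nat \<Rightarrow> nat \<Rightarrow> real) \<Rightarrow> nat \<times> nat \<Rightarrow> (nat \<times> nat) pmf" where
  "joint_step l le la \<tau> = (\<lambda>(i, j). do {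
     \<nu> \<leftarrow> bernoulli_pmf (\<tau> i j);
     \<gamma> \<leftarrow> bernoulli_pmf l;
     \<gamma>e \<leftarrow> bernoulli_pmf le;
     ack \<leftarrow> bernoulli_pmf la;
     return_pmf (if \<nu> \<and> \<gamma> \<and> ack then 0 else i + 1, if \<nu> \<and> \<gamma>e then 0 else j + 1)
   })"

definition stationary :: "('s \<Rightarrow> 's pmf) \<Rightarrow> 's pmf \<Rightarrow> bool" where
  "stationary K \<pi> \<longleftrightarrow> bind_pmf \<pi> K = \<pi>"

text \<open>Law of the pair \<open>(\<eta>\<^sup>s\<^sub>k, \<nu>\<^sub>k\<^sub>+\<^sub>1)\<close> when the holding times have law \<open>\<pi>\<close>: for a
  reference policy, whose only state is \<open>\<eta>\<^sup>s\<close>, and for a policy that depends on both holding times.\<close>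

definition reference_law :: "(nat \<Rightarrow> real) \<Rightarrow> nat pmf \<Rightarrow> (nat \<times> bool) pmf" where
  "reference_law \<tau> \<pi> = do {
     i \<leftarrow> \<pi>;
     \<nu> \<leftarrow> bernoulli_pmf (\<tau> i);
     return_pmf (i, \<nu>)
   }"

definition sensor_law :: "(nat \<Rightarrow> nat \<Rightarrow> real) \<Rightarrow> (nat \<times> nat) pmf \<Rightarrow> (nat \<times> bool) pmf" where
  "sensor_law \<tau> \<pi> = do {
     (i, j) \<leftarrow> \<pi>;
     \<nu> \<leftarrow> bernoulli_pmf (\<tau> i j);
     return_pmf (i, \<nu>)
   }"

definition l1_dist :: "(nat \<times> bool) pmf \<Rightarrow> (nat \<times> bool) pmf \<Rightarrow> real" where
  "l1_dist p q = (\<Sum>\<^sub>\<infinity>x\<in>UNIV. \<bar>pmf p x - pmf q x\<bar>)"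

text \<open>Both holding times are zero at time 0.\<close>

definition state_law ::
    "real \<Rightarrow> real \<Rightarrow> real \<Rightarrow> (nat \<Rightarrow> nat \<Rightarrow> real) \<Rightarrow> nat \<Rightarrow> (nat \<times> nat) pmf" where
  "state_law l le la \<tau> k =
     ((\<lambda>\<mu>. bind_pmf \<mu> (joint_step l le la \<tau>)) ^^ k) (return_pmf (0, 0))"

definition average_cost ::
    "(nat \<Rightarrow> ennreal) \<Rightarrow> real \<Rightarrow> real \<Rightarrow> real \<Rightarrow> (nat \<Rightarrow> nat \<Rightarrow> real) \<Rightarrow> nat \<Rightarrow> ennreal" where
  "average_cost c l le la \<tau> T =
     (\<Sum>k=1..T. \<integral>\<^sup>+(i, j). c j \<partial>measure_pmf (state_law l le la \<tau> k)) / of_nat T"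

definition J_e ::
    "(nat \<Rightarrow> ennreal) \<Rightarrow> real \<Rightarrow> real \<Rightarrow> real \<Rightarrow> (nat \<Rightarrow> nat \<Rightarrow> real) \<Rightarrow> ennreal" where
  "J_e c l le la \<tau> = lim (average_cost c l le la \<tau>)"

subsection \<open>Occupation measures and linear programs\<close>

text \<open>Transition probabilities; \<open>cap\<close> is the identity for the full MDP and truncation at the horizon
  for the truncated one. As truncation may identify successors, the masses are added up.\<close>

definition mdp_trans ::
    "(nat \<Rightarrow> nat) \<Rightarrow> real \<Rightarrow> real \<Rightarrow> real \<Rightarrow> nat \<times> nat \<Rightarrow> bool \<Rightarrow> nat \<times> nat \<Rightarrow> real" where
  "mdp_trans cap l le la = (\<lambda>(i, j) a s.
     if a then
       (1 - l * la) * (1 - le) * of_bool (s = (cap (i + 1), cap (j + 1))) +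
       l * la * (1 - le) * of_bool (s = (0, cap (j + 1))) +
       (1 - l * la) * le * of_bool (s = (cap (i + 1), 0)) +
       l * la * le * of_bool (s = (0, 0))
     else of_bool (s = (cap (i + 1), cap (j + 1))))"

type_synonym occupation = "nat \<Rightarrow> nat \<Rightarrow> bool \<Rightarrow> real"

definition Omega :: "real \<Rightarrow> real \<Rightarrow> real \<Rightarrow> occupation set" where
  "Omega l le la = {\<rho>.
     (\<forall>i j a. 0 \<le> \<rho> i j a) \<and>
     ((\<lambda>(i, j, a). \<rho> i j a) has_sum 1) UNIV \<and>
     (\<forall>i j. ((\<lambda>(i', j', a). \<rho> i' j' a * mdp_trans id l le la (i', j') a (i, j))
              has_sum (\<Sum>a\<in>UNIV. \<rho> i j a)) UNIV)}"

text \<open>Only the values on \<open>{0..N}\<^sup>2\<close> matter for membership in the next set and for all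
  constraints and objectives of the truncated program.\<close>

definition Omega_trunc :: "nat \<Rightarrow> real \<Rightarrow> real \<Rightarrow> real \<Rightarrow> occupation set" where
  "Omega_trunc N l le la = {\<rho>.
     (\<forall>i\<le>N. \<forall>j\<le>N. \<forall>a. 0 \<le> \<rho> i j a) \<and>
     (\<Sum>i\<le>N. \<Sum>j\<le>N. \<Sum>a\<in>UNIV. \<rho> i j a) = 1 \<and>
     (\<forall>i\<le>N. \<forall>j\<le>N.
        (\<Sum>a\<in>UNIV. \<rho> i j a) =
        (\<Sum>i'\<le>N. \<Sum>j'\<le>N. \<Sum>a\<in>UNIV.
           \<rho> i' j' a * mdp_trans (\<lambda>n. min n N) l le la (i', j') a (i, j)))}"

definition lp_cost :: "(nat \<Rightarrow> ennreal) \<Rightarrow> occupation \<Rightarrow> ennreal" where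
  "lp_cost c \<rho> = (\<Sum>\<^sub>\<infinity>(i, j, a)\<in>UNIV. ennreal (\<rho> i j a) * c j)"

definition lp_feasible ::
    "real \<Rightarrow> real \<Rightarrow> real \<Rightarrow> (nat \<times> bool) pmf \<Rightarrow> real \<Rightarrow> occupation \<Rightarrow> bool" where
  "lp_feasible l le la \<omega> \<epsilon>s \<rho> \<longleftrightarrow>
     \<rho> \<in> Omega l le la \<and>
     (\<Sum>\<^sub>\<infinity>(i, a)\<in>UNIV. \<bar>(\<Sum>\<^sub>\<infinity>j\<in>UNIV. \<rho> i j a) - pmf \<omega> (i, a)\<bar>) \<le> \<epsilon>s"

definition lp_optimal ::
    "(nat \<Rightarrow> ennreal) \<Rightarrow> real \<Rightarrow> real \<Rightarrow> real \<Rightarrow> (nat \<times> bool) pmf \<Rightarrow> real \<Rightarrow> occupation \<Rightarrow> bool" where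
  "lp_optimal c l le la \<omega> \<epsilon>s \<rho> \<longleftrightarrow>
     lp_feasible l le la \<omega> \<epsilon>s \<rho> \<and>
     (\<forall>\<rho>'. lp_feasible l le la \<omega> \<epsilon>s \<rho>' \<longrightarrow> lp_cost c \<rho> \<le> lp_cost c \<rho>')"

definition trunc_lp_cost :: "(nat \<Rightarrow> ennreal) \<Rightarrow> real \<Rightarrow> nat \<Rightarrow> occupation \<Rightarrow> ennreal" where
  "trunc_lp_cost c le N \<rho> =
     (\<Sum>i\<le>N. \<Sum>j<N. \<Sum>a\<in>UNIV. ennreal (\<rho> i j a) * c j) +
     (\<Sum>i\<le>N. ennreal (\<rho> i N True) * (\<Sum>\<^sub>\<infinity>j\<in>{N..}. ennreal (le * (1 - le) ^ (j - N)) * c j))"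

definition trunc_lp_feasible ::
    "real \<Rightarrow> real \<Rightarrow> real \<Rightarrow> (nat \<times> bool) pmf \<Rightarrow> real \<Rightarrow> nat \<Rightarrow>
     occupation \<Rightarrow> (nat \<Rightarrow> bool \<Rightarrow> real) \<Rightarrow> bool" where
  "trunc_lp_feasible l le la \<omega> \<epsilon>s N \<rho> \<epsilon> \<longleftrightarrow>
     \<rho> \<in> Omega_trunc N l le la \<and>
     (\<forall>i\<le>N. \<forall>j\<le>N. i = N \<or> j = N \<longrightarrow> \<rho> i j False = 0) \<and>
     (\<forall>i<N. \<forall>a. \<bar>(\<Sum>j\<le>N. \<rho> i j a) - pmf \<omega> (i, a)\<bar> \<le> \<epsilon> i a) \<and>
     (\<forall>a. \<bar>(\<Sum>j\<le>N. \<rho> N j a) - (\<Sum>\<^sub>\<infinity>i\<in>{N..}. pmf \<omega> (i, a))\<bar> \<le> \<epsilon> N a) \<and>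
     (\<Sum>i\<le>N. \<Sum>a\<in>UNIV. \<epsilon> i a) \<le> \<epsilon>s"

definition trunc_lp_optimal ::
    "(nat \<Rightarrow> ennreal) \<Rightarrow> real \<Rightarrow> real \<Rightarrow> real \<Rightarrow> (nat \<times> bool) pmf \<Rightarrow> real \<Rightarrow> nat \<Rightarrow>
     occupation \<Rightarrow> (nat \<Rightarrow> bool \<Rightarrow> real) \<Rightarrow> bool" where
  "trunc_lp_optimal c l le la \<omega> \<epsilon>s N \<rho> \<epsilon> \<longleftrightarrow>
     trunc_lp_feasible l le la \<omega> \<epsilon>s N \<rho> \<epsilon> \<and>
     (\<forall>\<rho>' \<epsilon>'. trunc_lp_feasible l le la \<omega> \<epsilon>s N \<rho>' \<epsilon>' \<longrightarrow>
        trunc_lp_cost c le N \<rho> \<le> trunc_lp_cost c le N \<rho>')"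

text \<open>Policies derived from occupation measures. In states without mass the defining quotient is
  \<open>0 / 0\<close>, and any probability is admitted there.\<close>

definition policy_of :: "occupation \<Rightarrow> (nat \<Rightarrow> nat \<Rightarrow> real) \<Rightarrow> bool" where
  "policy_of \<rho> \<tau> \<longleftrightarrow>
     (\<forall>i j. \<tau> i j \<in> {0..1}) \<and>
     (\<forall>i j. (\<Sum>a\<in>UNIV. \<rho> i j a) \<noteq> 0 \<longrightarrow> \<tau> i j = \<rho> i j True / (\<Sum>a\<in>UNIV. \<rho> i j a))"

definition trunc_policy_of :: "nat \<Rightarrow> occupation \<Rightarrow> (nat \<Rightarrow> nat \<Rightarrow> real) \<Rightarrow> bool" where
  "trunc_policy_of N \<rho> \<tau> \<longleftrightarrow>
     (\<forall>i j. \<tau> i j \<in> {0..1}) \<and>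
     (\<forall>i<N. \<forall>j<N. (\<Sum>a\<in>UNIV. \<rho> i j a) \<noteq> 0 \<longrightarrow> \<tau> i j = \<rho> i j True / (\<Sum>a\<in>UNIV. \<rho> i j a)) \<and>
     (\<forall>i j. N \<le> i \<or> N \<le> j \<longrightarrow> \<tau> i j = 1)"

end

theory Submission
  imports Defs "Jordan_Normal_Form.Spectral_Radius" "HOL-Real_Asymp.Real_Asymp"
begin

text \<open>A cycle of the chain is the time between two visits to the state in which both holding times
  vanish. The expected numbers of visits during one cycle form, up to normalisation, the only
  possible stationary law: a remainder that never returns would have to be carried by idle states,
  where the chain is a pure shift, so it vanishes. Elementary renewal theory then identifies average
  costs with stationary costs, without any aperiodicity.

  Applied to the capped chain, uniqueness shows that a feasible point of the truncated program is
  exactly the capped occupation law of its policy. Beyond the horizon the sensor always sends,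
  so the eavesdropper's holding time has a geometric tail, the truncated objective is the true cost,
  and the distance to the reference law changes by at most twice the mass of the reference law
  beyond the horizon.

  It remains to see that the truncated optimum tends to the full one. Given an occupation law, follow
  its policy for \<open>N\<close> steps of each cycle and then send until the cycle ends; the normalised
  occupation law idles only inside the truncation square and converges in \<open>l1\<close>. Its cost converges
  because the cost of the sending phase is bounded by a multiple of the current cost
  (the error trace grows more slowly than \<open>(1 - le)\<^sup>-\<^sup>n\<close>) and these
  contributions are summable over \<open>N\<close>. To keep the constraint, the optimum is first mixed with
  a strictly feasible law of finite cost, itself a truncation of the reference policy.\<close>

subsection \<open>Growth of the estimation error\<close>

text \<open>The cost is unbounded, so closeness of occupation laws in \<open>l1\<close> says nothing
  about closeness of costs. The remedy is to work on one cycle: an occupation law is an excursion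
  measure, costs are nonnegative sums over the age of the excursion, and changing the policy only
  from age \<open>N\<close> on leaves all earlier terms untouched. Cutting by age rather than by
  position is what makes this exact. The condition on \<open>le\<close> says that
  \<open>\<mu>\<^sup>2 < 1 / (1 - le)\<close> for the largest eigenvalue modulus
  \<open>\<mu>\<close>. Hence the error trace is dominated by powers of some \<open>s\<close> with
  \<open>s * (1 - le) < 1\<close>, and sending forever has finite cost from every state. Positivity
  of \<open>l * la\<close> and of \<open>le\<close> is derived from the existence of stationary
  laws. The reference law meets the constraint with distance zero but may have infinite cost, so it
  cannot itself be the strictly feasible point. Both programs are rewritten as statements about
  probability mass functions with masses in \<open>ennreal\<close>, where every sum exists.\<close>

definition matpow :: "'a::semiring_1 ^ 'n ^ 'n \<Rightarrow> nat \<Rightarrow> 'a ^ 'n ^ 'n" where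
  "matpow A k = ((\<lambda>X. A ** X) ^^ k) (Finite_Cartesian_Product.mat 1)"

lemma matpow_0 [simp]: "matpow A 0 = Finite_Cartesian_Product.mat 1"
  and matpow_Suc [simp]: "matpow A (Suc k) = A ** matpow A k"
  by (simp_all add: matpow_def)

text \<open>Bridge to the matrix type on which the spectral radius bound is stated: an enumeration
  \<open>f\<close> of the index type turns \<open>B\<close> into a matrix with numeric indices, and
  powers must follow.\<close>

lemma matpow_component:
  fixes B :: "'a::comm_semiring_1 ^ 'n ^ 'n"
  assumes f: "bij_betw f {..<CARD('n)} (UNIV :: 'n set)"
  defines "M \<equiv> Matrix.mat CARD('n) CARD('n) (\<lambda>(i, j). vec_nth (vec_nth B (f i)) (f j))"
  shows "M ^\<^sub>m k = Matrix.mat CARD('n) CARD('n) (\<lambda>(i, j). vec_nth (vec_nth (matpow B k) (f i)) (f j))"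
proof -
  have inj: "f i = f j \<longleftrightarrow> i = j" if "i < CARD('n)" "j < CARD('n)" for i j
    using f that by (auto simp: bij_betw_def inj_on_def)
  have Mc: "M \<in> carrier_mat CARD('n) CARD('n)" by (simp add: M_def)
  \<comment> \<open>\<open>^\<^sub>m\<close> adds factors on the right, \<open>matpow\<close> on the
    left.\<close>
  have comm: "M ^\<^sub>m Suc k = M * M ^\<^sub>m k" for k
    by (induction k) (use Mc in \<open>auto simp: assoc_mult_mat[of _ "CARD('n)" "CARD('n)" _ "CARD('n)" _ "CARD('n)"]\<close>)
  show ?thesis
  proof (induction k)
    case 0
    show ?case using inj by (intro eq_matI) (auto simp: M_def Finite_Cartesian_Product.mat_def)
  next
    case (Suc k)
    have *: "(\<Sum>l<CARD('n). g (f l)) = (\<Sum>l\<in>UNIV. g l)" for g :: "'n \<Rightarrow> 'a"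
      using sum.reindex_bij_betw[OF f] .
    show ?case unfolding comm Suc
      by (intro eq_matI)
         (auto simp: M_def scalar_prod_def matrix_matrix_mult_def lessThan_atLeast0[symmetric] *[symmetric])
  qed
qed

text \<open>Second half of the bridge: coordinates of eigenvectors are renumbered along
  \<open>f\<close> and its inverse, so the spectral radius sees exactly the eigenvalues of
  \<open>B\<close>.\<close>

lemma eigenvalue_transfer:
  fixes B :: "'a::comm_ring_1 ^ 'n ^ 'n"
  assumes f: "bij_betw f {..<CARD('n)} (UNIV :: 'n set)"
  defines "M \<equiv> Matrix.mat CARD('n) CARD('n) (\<lambda>(i, j). vec_nth (vec_nth B (f i)) (f j))"
  shows "eigenvalue M k \<longleftrightarrow> (\<exists>v. v \<noteq> 0 \<and> B *v v = k *s v)"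
proof
  have *: "(\<Sum>l<CARD('n). g (f l)) = (\<Sum>l\<in>UNIV. g l)" for g :: "'n \<Rightarrow> 'a"
    using sum.reindex_bij_betw[OF f] .
  define h where "h = the_inv_into {..<CARD('n)} f"
  have hf: "h (f i) = i" if "i < CARD('n)" for i
    using f that by (simp add: h_def bij_betw_def the_inv_into_f_f)
  have fh: "f (h x) = x" "h x < CARD('n)" for x
    using f f_the_inv_into_f_bij_betw[OF f, of x] the_inv_into_into[of f "{..<CARD('n)}" x "{..<CARD('n)}"]
    by (auto simp: h_def bij_betw_def)
  {
    assume "eigenvalue M k"
    then obtain v where v: "v \<in> carrier_vec CARD('n)" "v \<noteq> 0\<^sub>v CARD('n)" "M *\<^sub>v v = k \<cdot>\<^sub>v v"
      by (auto simp: eigenvalue_def eigenvector_def M_def)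
    define w where "w = (\<chi> x. vec_index v (h x))"
    have "w \<noteq> 0"
    proof
      assume "w = 0"
      then have "vec_index v (h x) = 0" for x by (simp add: w_def Finite_Cartesian_Product.vec_eq_iff)
      then have "vec_index v i = 0" if "i < CARD('n)" for i using hf[OF that] by metis
      then show False using v(1,2) by (auto intro!: eq_vecI)
    qed
    moreover have "vec_nth (B *v w) x = vec_nth (k *s w) x" for x
    proof -
      have "vec_index (M *\<^sub>v v) (h x) = vec_index (k \<cdot>\<^sub>v v) (h x)" using v(3) by simp
      then show ?thesis using v(1) fh[of x] hf
        by (simp add: M_def scalar_prod_def w_def matrix_vector_mult_def lessThan_atLeast0[symmetric] *[symmetric])
    qed
    ultimately show "\<exists>v. v \<noteq> 0 \<and> B *v v = k *s v" by (auto simp: Finite_Cartesian_Product.vec_eq_iff)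
  }
  {
    assume "\<exists>v. v \<noteq> 0 \<and> B *v v = k *s v"
    then obtain w where w: "w \<noteq> 0" "B *v w = k *s w" by auto
    define v where "v = Matrix.vec CARD('n) (\<lambda>i. vec_nth w (f i))"
    from w obtain x where "vec_nth w x \<noteq> 0" by (auto simp: Finite_Cartesian_Product.vec_eq_iff)
    then have "vec_index v (h x) \<noteq> 0" using fh by (simp add: v_def)
    then have "v \<noteq> 0\<^sub>v CARD('n)" using fh(2)[of x] by auto
    moreover have "M *\<^sub>v v = k \<cdot>\<^sub>v v"
    proof (intro eq_vecI)
      fix i assume i: "i < dim_vec (k \<cdot>\<^sub>v v)"
      have "vec_nth (B *v w) (f i) = vec_nth (k *s w) (f i)" using w by simp
      then show "vec_index (M *\<^sub>v v) i = vec_index (k \<cdot>\<^sub>v v) i" using i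
        by (simp add: M_def scalar_prod_def v_def matrix_vector_mult_def lessThan_atLeast0[symmetric] *[symmetric])
    qed (simp add: M_def v_def)
    ultimately show "eigenvalue M k"
      by (auto simp: eigenvalue_def eigenvector_def M_def v_def intro!: exI[of _ v])
  }
qed

lemma ex_bij_card: "\<exists>f. bij_betw f {..<CARD('n)} (UNIV :: 'n::finite set)"
  using ex_bij_betw_nat_finite[of "UNIV :: 'n set"] by (simp add: lessThan_atLeast0)

lemma finite_eigenvalues:
  fixes B :: "complex ^ 'n ^ 'n"
  shows "finite {k. \<exists>v. v \<noteq> 0 \<and> B *v v = k *s v}"
proof -
  obtain f where f: "bij_betw f {..<CARD('n)} (UNIV :: 'n set)" using ex_bij_card by blast
  have "finite (spectrum (Matrix.mat CARD('n) CARD('n) (\<lambda>(i, j). vec_nth (vec_nth B (f i)) (f j))))"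
    by (rule card_finite_spectrum) (auto intro: mat_carrier)
  then show ?thesis
    unfolding spectrum_def eigenvalue_transfer[OF f, of B, symmetric] by simp
qed

lemma eigenvalue_modulus_le:
  fixes A :: "real ^ 'n ^ 'n" and v :: "complex ^ 'n"
  assumes "v \<noteq> 0" "map_matrix complex_of_real A *v v = k *s v"
  shows "cmod k \<le> max_eigenvalue_modulus A"
  unfolding max_eigenvalue_modulus_def
proof (rule Max_ge)
  show "finite {cmod \<mu> |\<mu>. \<exists>v :: complex ^ 'n. v \<noteq> 0 \<and> map_matrix complex_of_real A *v v = \<mu> *s v}"
    using finite_imageI[OF finite_eigenvalues[of "map_matrix complex_of_real A"], of cmod]
    by (simp add: setcompr_eq_image)
qed (use assms in blast)

text \<open>Strictness matters: a nontrivial Jordan block to an eigenvalue of modulus 1 already has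
  powers of polynomial growth.\<close>

lemma matpow_bound_spectral:
  fixes B :: "complex ^ 'n ^ 'n"
  assumes "\<And>k v. v \<noteq> 0 \<Longrightarrow> B *v v = k *s v \<Longrightarrow> cmod k < 1"
  shows "\<exists>c. \<forall>k i j. cmod (vec_nth (vec_nth (matpow B k) i) j) \<le> c"
proof -
  obtain f where f: "bij_betw f {..<CARD('n)} (UNIV :: 'n set)" using ex_bij_card by blast
  define M where "M = Matrix.mat CARD('n) CARD('n) (\<lambda>(i, j). vec_nth (vec_nth B (f i)) (f j))"
  have Mc: "M \<in> carrier_mat CARD('n) CARD('n)" by (simp add: M_def)
  have "spectral_radius M \<in> norm ` spectrum M"
    by (rule spectral_radius_mem_max[OF Mc]) simp
  then have "spectral_radius M < 1"
    using assms eigenvalue_transfer[OF f, of B] by (auto simp: spectrum_def M_def)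
  from spectral_radius_jnf_norm_bound_less_1_upper_triangular[OF Mc this]
  obtain c where c: "\<And>k. norm_bound (M ^\<^sub>m k) c" by blast
  have "cmod (vec_nth (vec_nth (matpow B k) i) j) \<le> c" for k i j
  proof -
    obtain a b where ab: "a < CARD('n)" "f a = i" "b < CARD('n)" "f b = j"
      using f unfolding bij_betw_def by (metis UNIV_I imageE lessThan_iff)
    have "norm ((M ^\<^sub>m k) $$ (a, b)) \<le> c"
      using c[of k] ab Mc by (auto simp: norm_bound_def)
    then show ?thesis using ab
      unfolding M_def matpow_component[OF f, of B k] by simp
  qed
  then show ?thesis by blast
qed

text \<open>Dividing \<open>A\<close> by any \<open>r\<close> beyond its spectral radius leaves a
  matrix with bounded powers; the excess of \<open>r\<close> absorbs the polynomial factors of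
  Jordan blocks.\<close>

lemma matpow_bound:
  fixes A :: "real ^ 'n ^ 'n"
  assumes r: "r > max_eigenvalue_modulus A" "r > 0"
  shows "\<exists>c. \<forall>k i j. \<bar>vec_nth (vec_nth (matpow A k) i) j\<bar> \<le> c * r ^ k"
proof -
  define B :: "complex ^ 'n ^ 'n" where "B = (\<chi> i j. complex_of_real (vec_nth (vec_nth A i) j) / r)"
  have pow: "vec_nth (vec_nth (matpow B k) i) j = complex_of_real (vec_nth (vec_nth (matpow A k) i) j) / r ^ k"
    for k i j
    by (induction k arbitrary: i j)
       (auto simp: matrix_matrix_mult_def B_def Finite_Cartesian_Product.mat_def sum_divide_distrib)
  have small: "cmod k < 1" if v: "v \<noteq> 0" "B *v v = k *s v" for k v
  proof -
    have "vec_nth (map_matrix complex_of_real A *v v) i = vec_nth ((r * k) *s v) i" for i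
    proof -
      have "vec_nth (B *v v) i = vec_nth (k *s v) i" using v by simp
      then have "(\<Sum>j\<in>UNIV. complex_of_real (vec_nth (vec_nth A i) j) * vec_nth v j) / r = k * vec_nth v i"
        by (simp add: B_def matrix_vector_mult_def sum_divide_distrib)
      then show ?thesis using r(2) by (simp add: matrix_vector_mult_def map_matrix_def field_simps)
    qed
    then have "map_matrix complex_of_real A *v v = (r * k) *s v" by (simp add: Finite_Cartesian_Product.vec_eq_iff)
    from eigenvalue_modulus_le[OF v(1) this] have "r * cmod k \<le> max_eigenvalue_modulus A"
      using r(2) by (simp add: norm_mult)
    also have "\<dots> < r * 1" using r(1) by simp
    finally show ?thesis using r(2) by (metis mult_less_cancel_left_pos)
  qed
  have "\<exists>c. \<forall>k i j. cmod (vec_nth (vec_nth (matpow B k) i) j) \<le> c"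
    by (rule matpow_bound_spectral) (rule small)
  then obtain c where
    c: "\<And>k i j. cmod (vec_nth (vec_nth (matpow B k) i) j) \<le> c" by blast
  have "\<bar>vec_nth (vec_nth (matpow A k) i) j\<bar> \<le> c * r ^ k" for k i j
    using c[of k i j] r(2) by (simp add: pow norm_divide norm_power field_simps)
  then show ?thesis by blast
qed

section \<open>Traces of iterated covariance updates\<close>

lemma psd_entry_le_trace:
  fixes X :: "real ^ 'n ^ 'n"
  assumes "psd X"
  shows "0 \<le> trace X" and "\<bar>vec_nth (vec_nth X i) j\<bar> \<le> trace X"
proof -
  have sym: "vec_nth (vec_nth X a) b = vec_nth (vec_nth X b) a" for a b
    using assms unfolding psd_def transpose_def by (metis vec_lambda_beta)
  have quad: "inner (axis a s + axis b t) (X *v (axis a s + axis b t))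
      = s * s * vec_nth (vec_nth X a) a + t * t * vec_nth (vec_nth X b) b
        + s * t * (vec_nth (vec_nth X a) b + vec_nth (vec_nth X b) a)" for a b s t
  proof -
    have "vec_nth (X *v axis e r) i = vec_nth (vec_nth X i) e * r" for e r i
      by (simp add: matrix_vector_mult_def axis_def if_distrib cong: if_cong)
    then show ?thesis
      by (simp add: matrix_vector_right_distrib inner_add_left inner_axis') (simp add: algebra_simps)
  qed
  have pos: "0 \<le> inner v (X *v v)" for v using assms by (simp add: psd_def)
  have diag: "0 \<le> vec_nth (vec_nth X a) a" for a
    using pos[of "axis a 1 + axis a 0"] by (subst (asm) quad) simp
  have le: "vec_nth (vec_nth X a) a \<le> trace X" for a
    unfolding trace_def by (rule member_le_sum) (use diag in auto)
  show "0 \<le> trace X" unfolding trace_def by (intro sum_nonneg diag)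
  \<comment> \<open>The test vectors \<open>e_i + e_j\<close> and \<open>e_i - e_j\<close> give
    \<open>2 * |X_ij| \<le> X_ii + X_jj\<close>.\<close>
  show "\<bar>vec_nth (vec_nth X i) j\<bar> \<le> trace X"
    using pos[of "axis i 1 + axis j 1"] pos[of "axis i 1 + axis j (-1)"] le[of i] le[of j]
    unfolding quad sym[of j i] by auto
qed

lemma psd_prior_update:
  assumes "psd Q" "psd X"
  shows "psd (prior_update A Q (X :: real ^ 'a ^ 'a))"
proof -
  have "inner v ((A ** X ** transpose A) *v v) = inner (transpose A *v v) (X *v (transpose A *v v))" for v
    by (metis (no_types, opaque_lifting) dot_lmul_matrix matrix_vector_mul_assoc transpose_matrix_vector)
  then have "0 \<le> inner v ((A ** X ** transpose A) *v v)" for v using assms by (simp add: psd_def)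
  moreover have "transpose (Y + Z) = transpose Y + transpose Z" for Y Z :: "real ^ 'a ^ 'a"
    by (simp add: transpose_def Finite_Cartesian_Product.vec_eq_iff)
  ultimately show ?thesis using assms
    by (simp add: psd_def prior_update_def matrix_vector_mult_add_rdistrib inner_add_right
          matrix_transpose_mul matrix_mul_assoc)
qed

lemma psd_prior_update_funpow:
  assumes "psd Q" "psd X"
  shows "psd ((prior_update A Q ^^ k) X)"
  by (induction k) (simp_all add: assms psd_prior_update)

text \<open>Unrolling the affine map leaves a congruence by a matrix power and a finite-horizon
  Gramian of the noise. Both are then bounded through the entries of matrix powers.\<close>

lemma prior_update_funpow:
  fixes A :: "real ^ 'n ^ 'n"
  shows "(prior_update A Q ^^ m) X =
    matpow A m ** X ** transpose (matpow A m) + (\<Sum>k<m. matpow A k ** Q ** transpose (matpow A k))"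
proof (induction m)
  case 0
  show ?case by (simp add: transpose_mat)
next
  case (Suc m)
  have madd: "(X + Y) ** Z = X ** Z + Y ** Z" for X Y Z :: "real ^ 'n ^ 'n"
    by (simp add: matrix_matrix_mult_def Finite_Cartesian_Product.vec_eq_iff algebra_simps sum.distrib)
  have "A ** (\<Sum>k<m. g k) ** transpose A = (\<Sum>k<m. A ** g k ** transpose A)" for g :: "nat \<Rightarrow> real ^ 'n ^ 'n"
    by (induction m) (simp_all add: matrix_add_ldistrib madd)
  moreover have "(prior_update A Q ^^ Suc m) X = A ** ((prior_update A Q ^^ m) X) ** transpose A + Q"
    unfolding funpow.simps(2) o_apply by (rule prior_update_def)
  ultimately show ?case unfolding sum.lessThan_Suc_shift
    by (simp add: Suc matrix_add_ldistrib madd matrix_transpose_mul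
          matrix_mul_assoc transpose_mat add.commute add.left_commute del: funpow.simps)
qed

lemma trace_congruence_le:
  fixes B X :: "real ^ 'n ^ 'n"
  assumes "psd X" and b: "\<And>i j. \<bar>vec_nth (vec_nth B i) j\<bar> \<le> b"
  shows "trace (B ** X ** transpose B) \<le> real CARD('n) ^ 3 * b\<^sup>2 * trace X"
proof -
  have b0: "0 \<le> b" using b[of undefined undefined] by simp
  have "trace (B ** X ** transpose B) =
      (\<Sum>i\<in>UNIV. \<Sum>k\<in>UNIV. \<Sum>l\<in>UNIV. vec_nth (vec_nth B i) l * vec_nth (vec_nth X l) k * vec_nth (vec_nth B i) k)"
    by (simp add: trace_def matrix_matrix_mult_def transpose_def sum_distrib_right)
  \<comment> \<open>One factor \<open>CARD('n)\<close> per summation index, each entry of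
    \<open>X\<close> being at most its trace.\<close>
  also have "\<dots> \<le> (\<Sum>i\<in>(UNIV::'n set). \<Sum>k\<in>(UNIV::'n set). \<Sum>l\<in>(UNIV::'n set). b * trace X * b)"
  proof (intro sum_mono)
    fix i k l
    have "vec_nth (vec_nth B i) l * vec_nth (vec_nth X l) k * vec_nth (vec_nth B i) k
      \<le> \<bar>vec_nth (vec_nth B i) l\<bar> * \<bar>vec_nth (vec_nth X l) k\<bar> * \<bar>vec_nth (vec_nth B i) k\<bar>"
      unfolding abs_mult[symmetric] by (rule abs_ge_self)
    also have "\<dots> \<le> b * trace X * b"
      by (intro mult_mono b psd_entry_le_trace assms mult_nonneg_nonneg b0) auto
    finally show "vec_nth (vec_nth B i) l * vec_nth (vec_nth X l) k * vec_nth (vec_nth B i) k \<le> b * trace X * b" .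
  qed
  also have "\<dots> = real CARD('n) ^ 3 * b\<^sup>2 * trace X"
    by (simp add: power2_eq_square power3_eq_cube algebra_simps)
  finally show ?thesis .
qed

lemma trace_sum: "trace (\<Sum>k\<in>I. g k) = (\<Sum>k\<in>I. trace (g k :: real ^ 'n ^ 'n))"
  unfolding trace_def by (simp add: sum.swap[of _ I])

text \<open>The hypothesis on \<open>le\<close> puts the squared spectral radius below
  \<open>1 / (1 - le)\<close>, so a rate \<open>s\<close> fits strictly between. The trace is
  quadratic in the powers of \<open>A\<close>, so their entries are bounded at rate
  \<open>sqrt s\<close>. The summand \<open>1\<close> next to \<open>error_trace A Q P j\<close>
  pays for the noise injected by \<open>Q\<close> even if the current error vanishes.\<close>

lemma error_trace_growth:
  fixes A Q P :: "real ^ 'n ^ 'n" and le :: real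
  assumes psd: "psd Q" "psd P"
    and le: "max_eigenvalue_modulus A = 0 \<or> 1 - 1 / (max_eigenvalue_modulus A)\<^sup>2 < le" "0 < le" "le < 1"
  obtains s G where "1 < s" "s * (1 - le) < 1" "0 < G"
    and "\<And>j m. error_trace A Q P (j + m) \<le> ennreal (G * s ^ m) * (1 + error_trace A Q P j)"
proof -
  define \<mu> where "\<mu> = max_eigenvalue_modulus A"
  \<comment> \<open>Midpoint of the admissible interval; \<open>max 1\<close> forces
    \<open>1 < s\<close>, needed for the geometric sum below.\<close>
  define s where "s = (1 / (1 - le) + max 1 (\<mu>\<^sup>2)) / 2"
  have "\<mu>\<^sup>2 < 1 / (1 - le)"
  \<comment> \<open>The nilpotent case is separate because the quotient by
    \<open>\<mu>\<^sup>2\<close> is then meaningless.\<close>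
  proof (cases "\<mu> = 0")
    case False
    then have "1 - 1 / \<mu>\<^sup>2 < le" "0 < \<mu>\<^sup>2" using le(1) by (simp_all add: \<mu>_def)
    then have "\<mu>\<^sup>2 * (1 - 1 / \<mu>\<^sup>2) < \<mu>\<^sup>2 * le" by (intro mult_strict_left_mono)
    then have "\<mu>\<^sup>2 - 1 < \<mu>\<^sup>2 * le" using \<open>0 < \<mu>\<^sup>2\<close> by (simp add: algebra_simps)
    then show ?thesis using le(3) by (simp add: pos_less_divide_eq algebra_simps)
  qed (use le in simp)
  moreover have "1 < 1 / (1 - le)" using le by (simp add: field_simps)
  ultimately have s: "1 < s" "\<mu>\<^sup>2 < s" "s < 1 / (1 - le)"
    by (auto simp: s_def)
  from s(2) have r: "sqrt s > \<mu>" "sqrt s > 0"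
    using s(1) by (auto intro: real_less_rsqrt)
  from matpow_bound[OF r[unfolded \<mu>_def]] obtain c where
    c: "\<And>k i j. \<bar>vec_nth (vec_nth (matpow A k) i) j\<bar> \<le> c * sqrt s ^ k" by blast
  define D where "D = real CARD('n) ^ 3 * c\<^sup>2"
  have D0: "0 \<le> D" by (simp add: D_def)
  have cong: "trace (matpow A k ** X ** transpose (matpow A k)) \<le> D * s ^ k * trace X" if "psd X" for k X
  proof -
    have "(c * sqrt s ^ k)\<^sup>2 = c\<^sup>2 * s ^ k"
    proof -
      have "(sqrt s ^ k)\<^sup>2 = ((sqrt s)\<^sup>2) ^ k"
        unfolding power_mult[symmetric] by (simp only: mult.commute)
      also have "(sqrt s)\<^sup>2 = s" using s(1) by simp
      finally show ?thesis by (simp only: power_mult_distrib)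
    qed
    then show ?thesis using trace_congruence_le[OF that c, of k] by (simp only: D_def mult.assoc)
  qed
  define f where "f = (\<lambda>j. trace ((prior_update A Q ^^ j) P))"
  have f0: "0 \<le> f j" for j
    unfolding f_def by (intro psd_entry_le_trace psd_prior_update_funpow psd)
  \<comment> \<open>\<open>D\<close> carries the congruence part,
    \<open>D * trace Q / (s - 1)\<close> the geometric sum over the noise terms, and
    \<open>1\<close> keeps \<open>G\<close> positive.\<close>
  define G where "G = D + D * trace Q / (s - 1) + 1"
  have tQ: "0 \<le> trace Q" using psd by (intro psd_entry_le_trace)
  have G: "0 < G" using D0 tQ s(1) by (auto simp: G_def intro!: add_nonneg_pos divide_nonneg_pos)
  have "f (j + m) \<le> G * s ^ m * (1 + f j)" for j m
  proof -
    have "f (j + m) = trace (matpow A m ** ((prior_update A Q ^^ j) P) ** transpose (matpow A m))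
        + (\<Sum>k<m. trace (matpow A k ** Q ** transpose (matpow A k)))"
      unfolding f_def add.commute[of j m] funpow_add o_apply
      by (subst prior_update_funpow) (simp add: trace_add trace_sum)
    also have "\<dots> \<le> D * s ^ m * f j + (\<Sum>k<m. D * s ^ k * trace Q)"
      unfolding f_def by (intro add_mono sum_mono cong psd_prior_update_funpow psd)
    also have "(\<Sum>k<m. D * s ^ k * trace Q) = D * trace Q * ((s ^ m - 1) / (s - 1))"
      using s(1) by (simp add: sum_distrib_left[symmetric] sum_distrib_right[symmetric] geometric_sum)
    also have "\<dots> \<le> D * trace Q / (s - 1) * s ^ m"
      using D0 tQ s(1) by (simp add: divide_simps mult_left_mono)
    also have "D * s ^ m * f j + D * trace Q / (s - 1) * s ^ m
        = (D * f j + D * trace Q / (s - 1)) * s ^ m" by (simp add: algebra_simps)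
    also have "\<dots> \<le> (G * (1 + f j)) * s ^ m"
    proof (intro mult_right_mono)
      define q where "q = D * trace Q / (s - 1)"
      have q: "0 \<le> q" using D0 tQ s(1) by (simp add: q_def)
      have "D * f j + q \<le> (D + q + 1) * (1 + f j)"
        using f0[of j] D0 q mult_nonneg_nonneg[OF q f0[of j]] by (simp add: distrib_left distrib_right)
      then show "D * f j + D * trace Q / (s - 1) \<le> G * (1 + f j)" by (simp only: G_def q_def)
    qed (use s in auto)
    finally show ?thesis by (simp add: algebra_simps)
  qed
  then have "ennreal (f (j + m)) \<le> ennreal (G * s ^ m * (1 + f j))" for j m
    by (rule ennreal_leI)
  moreover have "ennreal (G * s ^ m * (1 + f j)) = ennreal (G * s ^ m) * (1 + ennreal (f j))" for j m
    using f0[of j] G s(1) by (subst ennreal_mult) auto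
  ultimately have "error_trace A Q P (j + m) \<le> ennreal (G * s ^ m) * (1 + error_trace A Q P j)" for j m
    by (simp add: error_trace_def f_def)
  moreover have "s * (1 - le) < 1" using s(3) le by (simp add: field_simps)
  ultimately show ?thesis using that s(1) G by blast
qed

subsection \<open>Cycles of a Markov chain\<close>

abbreviation mass :: "('s \<Rightarrow> ennreal) \<Rightarrow> ennreal" where
  "mass f \<equiv> nn_integral (count_space UNIV) f"

lemma mass_swap: "mass (\<lambda>x. mass (\<lambda>y. f x y)) = mass (\<lambda>y. mass (\<lambda>x. f x y))"
  using nn_integral_fst_count_space[of "\<lambda>(x, y). f x y"] nn_integral_snd_count_space[of "\<lambda>(x, y). f x y"]
  by simp

lemma nn_integral_measure_pmf_mass: "(\<integral>\<^sup>+x. f x \<partial>measure_pmf p) = mass (\<lambda>x. ennreal (pmf p x) * f x)"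
  by (rule nn_integral_measure_pmf)

lemma mass_pmf: "mass (\<lambda>x. ennreal (pmf p x)) = 1"
  using nn_integral_measure_pmf_mass[of p "\<lambda>_. 1"] by simp

lemma mass_split: "mass f = f z + mass (\<lambda>x. if x = z then 0 else f x)"
proof -
  have "mass f = mass (\<lambda>x. f x * indicator {z} x + (if x = z then 0 else f x))"
    by (intro nn_integral_cong) (auto simp: indicator_def)
  also have "\<dots> = f z + mass (\<lambda>x. if x = z then 0 else f x)"
    by (subst nn_integral_add) (auto simp: nn_integral_count_space_indicator[symmetric] one_ennreal_def[symmetric])
  finally show ?thesis .
qed

definition push :: "('s \<Rightarrow> 's pmf) \<Rightarrow> ('s \<Rightarrow> ennreal) \<Rightarrow> 's \<Rightarrow> ennreal" where
  "push K m y = mass (\<lambda>x. m x * ennreal (pmf (K x) y))"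

text \<open>Taboo evolution: mass that enters \<open>z\<close> after time 0 is removed, while
  initial mass at \<open>z\<close> counts once. Started in \<open>z\<close>, the value at age
  \<open>k\<close> is the probability of being in \<open>y\<close> with no return during the first
  \<open>k\<close> steps.\<close>

fun killed :: "('s \<Rightarrow> 's pmf) \<Rightarrow> 's \<Rightarrow> ('s \<Rightarrow> ennreal) \<Rightarrow> nat \<Rightarrow> 's \<Rightarrow> ennreal" where
  "killed K z h 0 = h"
| "killed K z h (Suc k) = (\<lambda>y. if y = z then 0 else push K (killed K z h k) y)"

text \<open>Green function of the killed chain. For \<open>h = indicator {z}\<close> it is the
  excursion measure of a cycle.\<close>

definition visits :: "('s \<Rightarrow> 's pmf) \<Rightarrow> 's \<Rightarrow> ('s \<Rightarrow> ennreal) \<Rightarrow> 's \<Rightarrow> ennreal" where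
  "visits K z h y = (\<Sum>k. killed K z h k y)"

lemma push_add: "push K (\<lambda>x. m x + n x) y = push K m y + push K n y"
  by (simp add: push_def distrib_right nn_integral_add)

lemma push_cmult: "push K (\<lambda>x. c * m x) y = c * push K m y"
  by (simp add: push_def nn_integral_cmult mult.assoc)

lemma push_mono: "(\<And>x. m x \<le> n x) \<Longrightarrow> push K m y \<le> push K n y"
  unfolding push_def by (intro nn_integral_mono mult_right_mono) auto

lemma push_sum: "push K (\<lambda>x. \<Sum>k\<in>I. m k x) y = (\<Sum>k\<in>I. push K (m k) y)"
  by (simp add: push_def sum_distrib_right nn_integral_sum)

lemma push_suminf: "push K (\<lambda>x. \<Sum>k. m k x) y = (\<Sum>k. push K (m k) y :: ennreal)"
  by (simp add: push_def nn_integral_suminf[symmetric])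

lemma push_pmf: "push K (\<lambda>x. ennreal (pmf p x)) y = ennreal (pmf (bind_pmf p K) y)"
  by (simp add: push_def ennreal_pmf_bind nn_integral_measure_pmf_mass)

lemma mass_push_mult:
  fixes K :: "'s \<Rightarrow> 's pmf"
  shows "mass (\<lambda>y. push K m y * g y) = mass (\<lambda>x. m x * (\<integral>\<^sup>+y. g y \<partial>K x))"
proof -
  have "mass (\<lambda>y. push K m y * g y) = mass (\<lambda>y. mass (\<lambda>x. m x * ennreal (pmf (K x) y) * g y))"
    by (simp add: push_def nn_integral_multc)
  also have "\<dots> = mass (\<lambda>x. mass (\<lambda>y. m x * ennreal (pmf (K x) y) * g y))"
    by (rule mass_swap)
  also have "\<dots> = mass (\<lambda>x. m x * (\<integral>\<^sup>+y. g y \<partial>K x))"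
    by (simp add: nn_integral_measure_pmf_mass nn_integral_cmult mult.assoc)
  finally show ?thesis .
qed

lemma mass_push: "mass (push K m) = mass m"
  using mass_push_mult[of K m "\<lambda>_. 1"] by simp

lemma visits_unfold: "visits K z h y = h y + (if y = z then 0 else push K (visits K z h) y)"
proof -
  have "visits K z h y = h y + (\<Sum>k. killed K z h (Suc k) y)"
    unfolding visits_def by (subst suminf_offset[where i = 1]) (auto simp: summableI)
  also have "(\<Sum>k. killed K z h (Suc k) y) = (if y = z then 0 else push K (visits K z h) y)"
    by (simp add: visits_def[abs_def] push_suminf)
  finally show ?thesis .
qed

lemma mass_visits_mult: "mass (\<lambda>x. visits K z h x * g x) = (\<Sum>k. mass (\<lambda>x. killed K z h k x * g x))"
  unfolding visits_def by (subst nn_integral_suminf[symmetric]) auto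

text \<open>Minimality of the Green function: whatever dominates its own first-step expansion
  dominates all partial sums, by induction on their length.\<close>

lemma killed_sum_le:
  assumes "\<And>y. h y + (if y = z then 0 else push K m y) \<le> m y"
  shows "(\<Sum>k<n. killed K z h k y) \<le> m y"
proof (induction n arbitrary: y)
  case (Suc n)
  have "(\<Sum>k<Suc n. killed K z h k y) = h y + (if y = z then 0 else push K (\<lambda>x. \<Sum>k<n. killed K z h k x) y)"
    by (subst sum.lessThan_Suc_shift) (simp add: push_sum)
  also have "\<dots> \<le> h y + (if y = z then 0 else push K m y)"
    by (intro add_left_mono) (auto intro!: push_mono Suc)
  finally show ?case using assms[of y] by simp
qed simp

lemma visits_le:
  assumes "\<And>y. h y + (if y = z then 0 else push K m y) \<le> m y"
  shows "visits K z h y \<le> m y"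
  unfolding visits_def by (rule suminf_le_const[OF summableI killed_sum_le[OF assms]])

text \<open>Foster-Lyapunov bound: \<open>V\<close> is a potential that counts as 0 upon arrival in
  \<open>z\<close>, and each step spends at least \<open>g\<close> of it.\<close>

lemma visits_lyapunov:
  fixes K :: "'s \<Rightarrow> 's pmf"
  assumes V: "\<And>x. g x + (\<integral>\<^sup>+y. (if y = z then 0 else V y) \<partial>K x) \<le> V x"
  shows "mass (\<lambda>x. visits K z h x * g x) \<le> mass (\<lambda>x. h x * V x)"
proof -
  \<comment> \<open>Cost spent so far plus the potential still carried by the surviving mass never
    exceeds the initial potential.\<close>
  have "(\<Sum>k<n. mass (\<lambda>x. killed K z h k x * g x)) + mass (\<lambda>x. killed K z h n x * V x)
      \<le> mass (\<lambda>x. h x * V x)" for n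
  proof (induction n)
    case (Suc n)
    have "mass (\<lambda>x. killed K z h (Suc n) x * V x)
        = mass (\<lambda>y. push K (killed K z h n) y * (if y = z then 0 else V y))"
      by (intro nn_integral_cong) auto
    also have "\<dots> = mass (\<lambda>x. killed K z h n x * (\<integral>\<^sup>+y. (if y = z then 0 else V y) \<partial>K x))"
      by (rule mass_push_mult)
    finally have "mass (\<lambda>x. killed K z h n x * g x) + mass (\<lambda>x. killed K z h (Suc n) x * V x)
        = mass (\<lambda>x. killed K z h n x * (g x + (\<integral>\<^sup>+y. (if y = z then 0 else V y) \<partial>K x)))"
      by (simp add: nn_integral_add distrib_left)
    also have "\<dots> \<le> mass (\<lambda>x. killed K z h n x * V x)"
      by (intro nn_integral_mono mult_left_mono V) auto
    finally show ?case
      unfolding sum.lessThan_Suc add.assoc by (rule order_trans[OF add_left_mono Suc.IH])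
  qed simp
  then have "(\<Sum>k<n. mass (\<lambda>x. killed K z h k x * g x)) \<le> mass (\<lambda>x. h x * V x)" for n
    by (meson le_iff_add order_trans)
  then show ?thesis unfolding mass_visits_mult by (intro suminf_le_const summableI)
qed

text \<open>Off \<open>z\<close> the balance holds by construction; at \<open>z\<close> it follows because a kernel preserves
  the total mass.\<close>

lemma balance_at_point:
  fixes a b :: "'s \<Rightarrow> ennreal"
  assumes "mass a = mass b" "mass a < \<infinity>" "\<And>y. y \<noteq> z \<Longrightarrow> a y = b y"
  shows "a y = b y"
proof (cases "y = z")
  case True
  have "a z + mass (\<lambda>x. if x = z then 0 else a x) = b z + mass (\<lambda>x. if x = z then 0 else a x)"
  proof -
    have "mass (\<lambda>x. if x = z then 0 else a x) = mass (\<lambda>x. if x = z then 0 else b x)"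
      by (intro nn_integral_cong) (use assms in auto)
    then show ?thesis using assms(1) mass_split[of a z] mass_split[of b z] by simp
  qed
  moreover have "mass (\<lambda>x. if x = z then 0 else a x) \<noteq> \<infinity>"
    using assms(2) mass_split[of a z] by (auto simp: top_unique less_top)
  ultimately show ?thesis using True by (simp add: ennreal_add_left_cancel add.commute)
qed (use assms in auto)

abbreviation cycle_visits :: "('s \<Rightarrow> 's pmf) \<Rightarrow> 's \<Rightarrow> 's \<Rightarrow> ennreal" where
  "cycle_visits K z \<equiv> visits K z (indicator {z})"

lemma cycle_at [simp]: "cycle_visits K z z = 1"
  by (subst visits_unfold) simp

lemma push_cycle:
  assumes "mass (cycle_visits K z) < \<infinity>"
  shows "push K (cycle_visits K z) y = cycle_visits K z y"
proof (rule balance_at_point[where z = z])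
  show "mass (push K (cycle_visits K z)) = mass (cycle_visits K z)" by (rule mass_push)
  then show "mass (push K (cycle_visits K z)) < \<infinity>" using assms by simp
  show "push K (cycle_visits K z) y = cycle_visits K z y" if "y \<noteq> z" for y
    using that visits_unfold[of K z "indicator {z}" y] by simp
qed

lemma ennreal_mult_inverse: "0 < a \<Longrightarrow> ennreal a * inverse (ennreal a) = 1"
  by (simp add: inverse_ennreal ennreal_mult[symmetric])

lemma ex_normalized_pmf:
  assumes "0 < mass m" "mass m < \<infinity>"
  shows "\<exists>p. \<forall>x. ennreal (pmf p x) = m x / mass m"
proof -
  have fin: "m x \<noteq> \<infinity>" for x
    using assms(2) mass_split[of m x] by (auto simp: top_unique less_top)
  define f where "f x = enn2real (m x / mass m)" for x
  have f: "ennreal (f x) = m x / mass m" for x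
    using fin[of x] assms by (auto simp: f_def ennreal_enn2real_if ennreal_divide_eq_top_iff)
  have "mass (\<lambda>x. ennreal (f x)) = 1"
    using assms by (simp add: f nn_integral_divide)
  then have "pmf (embed_pmf f) x = f x" for x
    by (intro pmf_embed_pmf) (auto simp: f_def)
  then show ?thesis using f by (intro exI[of _ "embed_pmf f"]) simp
qed

lemma stationary_push: "stationary K p \<longleftrightarrow> (\<forall>y. push K (\<lambda>x. ennreal (pmf p x)) y = ennreal (pmf p y))"
  unfolding stationary_def push_pmf by (auto simp: pmf_eq_iff)

lemma ex_stationary:
  assumes "mass (cycle_visits K z) < \<infinity>"
  shows "\<exists>p. stationary K p"
proof -
  have "1 \<le> mass (cycle_visits K z)" using mass_split[of "cycle_visits K z" z] by (simp add: le_iff_add)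
  then have pos: "0 < mass (cycle_visits K z)" by (rule less_le_trans[rotated]) simp
  then obtain p where p: "\<And>x. ennreal (pmf p x) = cycle_visits K z x / mass (cycle_visits K z)"
    using ex_normalized_pmf assms by blast
  have "push K (\<lambda>x. cycle_visits K z x / mass (cycle_visits K z)) y = cycle_visits K z y / mass (cycle_visits K z)" for y
    using push_cmult[of K "inverse (mass (cycle_visits K z))" "cycle_visits K z" y] push_cycle[OF assms, of y]
    by (simp add: divide_ennreal_def mult.commute)
  then show ?thesis unfolding stationary_push by (intro exI[of _ p]) (simp add: p)
qed

text \<open>Divided by \<open>pmf p z\<close>, a stationary law takes the value 1 at
  \<open>z\<close> and reproduces itself elsewhere, so it is a supersolution for the cycle and
  minimality applies.\<close>

lemma stationary_ge_cycle:
  assumes "stationary K p"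
  shows "ennreal (pmf p z) * cycle_visits K z y \<le> ennreal (pmf p y)"
proof (cases "pmf p z = 0")
  case False
  then have pos: "0 < ennreal (pmf p z)" by (simp add: zero_less_iff_neq_zero pmf_nonneg)
  have p: "push K (\<lambda>x. ennreal (pmf p x)) y = ennreal (pmf p y)" for y
    using assms by (simp add: stationary_push)
  define m where "m x = inverse (ennreal (pmf p z)) * ennreal (pmf p x)" for x
  have inv: "inverse (ennreal (pmf p z)) * ennreal (pmf p z) = 1"
    using pos ennreal_mult_inverse[of "pmf p z"] by (simp add: mult.commute)
  have "cycle_visits K z y \<le> m y"
  proof (rule visits_le)
    show "indicator {z} y + (if y = z then 0 else push K m y) \<le> m y" for y
      unfolding m_def push_cmult p using inv by (auto simp: indicator_def)
  qed
  then have "ennreal (pmf p z) * cycle_visits K z y \<le> ennreal (pmf p z) * m y"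
    by (intro mult_left_mono) auto
  also have "\<dots> = ennreal (pmf p y)"
    using inv by (simp add: m_def mult.assoc[symmetric] mult.commute[of "ennreal (pmf p z)"])
  finally show ?thesis .
qed simp

text \<open>The remainder of a stationary law after removing its cycle part is invariant and vanishes
  at \<open>z\<close>, so uniqueness of stationary laws reduces to the absence of such invariant measures.\<close>

definition rigid :: "('s \<Rightarrow> 's pmf) \<Rightarrow> 's \<Rightarrow> bool" where
  "rigid K z \<longleftrightarrow> (\<forall>d. (\<forall>y. push K d y = d y) \<and> d z = 0 \<and> mass d < \<infinity> \<longrightarrow> d = (\<lambda>_. 0))"

lemma rigidD: "rigid K z \<Longrightarrow> (\<And>y. push K d y = d y) \<Longrightarrow> d z = 0 \<Longrightarrow> mass d < \<infinity> \<Longrightarrow> d y = 0"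
  unfolding rigid_def by (drule spec[of _ d]) auto

text \<open>The last clause is Kac's formula: the mean return time to \<open>z\<close> is the
  reciprocal of its stationary probability.\<close>

lemma stationary_eq_cycle:
  assumes st: "stationary K p"
    and rigid: "rigid K z"
  shows "0 < pmf p z" "ennreal (pmf p y) = ennreal (pmf p z) * cycle_visits K z y"
    "mass (cycle_visits K z) = inverse (ennreal (pmf p z))"
proof -
  have p: "push K (\<lambda>x. ennreal (pmf p x)) y = ennreal (pmf p y)" for y
    using st by (simp add: stationary_push)
  have tot: "mass (\<lambda>x. ennreal (pmf p x)) = 1" by (rule mass_pmf)
  show pos: "0 < pmf p z"
  proof (rule ccontr)
    \<comment> \<open>Otherwise \<open>p\<close> itself would be an invariant measure vanishing at
      \<open>z\<close>.\<close>
    assume "\<not> 0 < pmf p z"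
    then have "pmf p z = 0" by (simp add: pmf_nonneg less_le)
    then have "ennreal (pmf p y) = 0" for y
      using rigidD[OF rigid, of "\<lambda>x. ennreal (pmf p x)"] p tot by simp
    then show False using tot by simp
  qed
  define c where "c = (\<lambda>x. ennreal (pmf p z) * cycle_visits K z x)"
  define d where "d = (\<lambda>x. ennreal (pmf p x) - c x)"
  have c_le: "c x \<le> ennreal (pmf p x)" for x
    unfolding c_def by (rule stationary_ge_cycle[OF st])
  have sum: "ennreal (pmf p x) = c x + d x" for x
    unfolding d_def using c_le[of x] by (metis add_diff_inverse_ennreal)
  have "ennreal (pmf p z) * mass (cycle_visits K z) = mass c"
    by (simp add: c_def nn_integral_cmult)
  also have "\<dots> \<le> 1" unfolding tot[symmetric] by (intro nn_integral_mono c_le)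
  finally have "ennreal (pmf p z) * mass (cycle_visits K z) < \<infinity>" by (simp add: le_less_trans)
  \<comment> \<open>A stationary law that charges \<open>z\<close> forces the cycle to have finite
    mean length.\<close>
  then have fin: "mass (cycle_visits K z) < \<infinity>" using pos by (auto simp: ennreal_mult_less_top)
  have "push K d y = d y" for y
  proof -
    have "c y + push K d y = c y + d y"
      using p[of y] push_cycle[OF fin, of y] unfolding sum push_add by (simp add: c_def push_cmult)
    moreover have "c y < \<infinity>" using c_le[of y] by (simp add: le_less_trans)
    ultimately show ?thesis by (auto simp: ennreal_add_left_cancel)
  qed
  moreover have "d z = 0" by (simp add: d_def c_def)
  moreover have "mass d \<le> mass (\<lambda>x. ennreal (pmf p x))"
    by (intro nn_integral_mono) (simp add: sum)
  then have "mass d < \<infinity>" unfolding tot by (simp add: le_less_trans)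
  ultimately have "d y = 0" for y by (rule rigidD[OF rigid])
  then show eq: "ennreal (pmf p y) = ennreal (pmf p z) * cycle_visits K z y" for y
    using sum[of y] by (simp add: c_def)
  have "1 = ennreal (pmf p z) * mass (cycle_visits K z)"
    unfolding tot[symmetric] by (subst eq) (simp add: nn_integral_cmult)
  then have "inverse (ennreal (pmf p z)) * 1 = (inverse (ennreal (pmf p z)) * ennreal (pmf p z)) * mass (cycle_visits K z)"
    by (metis mult.assoc)
  then show "mass (cycle_visits K z) = inverse (ennreal (pmf p z))"
    using pos ennreal_mult_inverse[of "pmf p z"] by (simp add: mult.commute)
qed

lemma stationary_unique:
  assumes st: "stationary K p" "stationary K q"
    and rigid: "rigid K z"
  shows "p = q"
proof (rule pmf_eqI)
  fix y
  note a = stationary_eq_cycle[OF st(1) rigid] and b = stationary_eq_cycle[OF st(2) rigid]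
  have "ennreal (pmf p z) * mass (cycle_visits K z) = 1" "ennreal (pmf q z) * mass (cycle_visits K z) = 1"
    using ennreal_mult_inverse[OF a(1)] ennreal_mult_inverse[OF b(1)] unfolding a(3)[symmetric] b(3)[symmetric]
    by simp_all
  then have "ennreal (pmf p z) = ennreal (pmf q z)"
    by (metis mult.assoc mult.commute mult.right_neutral)
  then have "ennreal (pmf p y) = ennreal (pmf q y)" using a(2)[of y] b(2)[of y] by simp
  then show "pmf p y = pmf q y" by simp
qed

section \<open>Averages of convolutions and the renewal theorem\<close>

lemma sum_convolution:
  fixes a g :: "nat \<Rightarrow> 'a::comm_semiring_1"
  shows "(\<Sum>k\<le>n. \<Sum>l\<le>k. a (k - l) * g l) = (\<Sum>l\<le>n. g l * (\<Sum>k\<le>n - l. a k))"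
proof (induction n)
  case (Suc n)
  have "(\<Sum>l\<le>n. g l * (\<Sum>k\<le>Suc n - l. a k)) = (\<Sum>l\<le>n. g l * (\<Sum>k\<le>n - l. a k) + a (Suc n - l) * g l)"
    by (intro sum.cong refl) (simp add: Suc_diff_le distrib_left mult.commute)
  then show ?case using Suc by (simp add: sum.distrib add.assoc mult.commute)
qed (simp add: mult.commute)

text \<open>Here \<open>a n\<close> stands for the probability of being in \<open>z\<close> at time
  \<open>n\<close>, and a summable \<open>g l\<close> for what is collected at age \<open>l\<close>
  of a cycle. Since \<open>a\<close> is at most 1, shifting its partial sums by \<open>l\<close>
  costs at most \<open>l\<close>, which is negligible after division by \<open>n\<close>; this
  replaces any convergence of \<open>a\<close> itself.\<close>

locale convolution_average =
  fixes a :: "nat \<Rightarrow> real"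
  assumes a: "\<And>n. 0 \<le> a n" "\<And>n. a n \<le> 1"
begin

definition A :: "nat \<Rightarrow> real" where "A n = (\<Sum>k\<le>n. a k)"

lemma A_diff: "l \<le> n \<Longrightarrow> A n - real l \<le> A (n - l)" and A_mono: "A (n - l) \<le> A n"
proof -
  show "A (n - l) \<le> A n" unfolding A_def by (intro sum_mono2) (use a in auto)
  assume "l \<le> n"
  then have "A n = A (n - l) + (\<Sum>k\<in>{n - l<..n}. a k)"
    unfolding A_def by (subst sum.union_disjoint[symmetric]) (auto intro!: sum.cong)
  also have "(\<Sum>k\<in>{n - l<..n}. a k) \<le> (\<Sum>k\<in>{n - l<..n}. 1)"
    by (intro sum_mono a)
  finally show "A n - real l \<le> A (n - l)" using \<open>l \<le> n\<close> by simp
qed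

lemma A_nonneg: "0 \<le> A n"
  unfolding A_def by (intro sum_nonneg a)

context
  fixes g :: "nat \<Rightarrow> real"
  assumes g: "\<And>n. 0 \<le> g n" "summable g"
begin

lemma convolution_le: "(\<Sum>k\<le>n. \<Sum>l\<le>k. a (k - l) * g l) \<le> A n * suminf g"
proof -
  have "(\<Sum>l\<le>n. g l * A (n - l)) \<le> (\<Sum>l\<le>n. g l * A n)"
    by (intro sum_mono mult_left_mono A_mono g)
  also have "\<dots> \<le> suminf g * A n"
    unfolding sum_distrib_right[symmetric]
    by (intro mult_right_mono sum_le_suminf g A_nonneg) (auto simp: g)
  finally show ?thesis unfolding sum_convolution A_def by (simp add: mult.commute)
qed

text \<open>Keeping only ages up to \<open>j\<close> loses a boundary term of size \<open>j\<close>,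
  independent of \<open>n\<close>. With the upper bound this traps the average when first
  \<open>n\<close> and then \<open>j\<close> grows.\<close>

lemma convolution_ge:
  assumes "j \<le> n"
  shows "(A n - real j) * (\<Sum>l\<le>j. g l) \<le> (\<Sum>k\<le>n. \<Sum>l\<le>k. a (k - l) * g l)"
proof -
  have "(A n - real j) * (\<Sum>l\<le>j. g l) = (\<Sum>l\<le>j. g l * (A n - real j))"
    by (simp add: sum_distrib_right mult.commute)
  also have "\<dots> \<le> (\<Sum>l\<le>j. g l * A (n - l))"
  proof (intro sum_mono mult_left_mono g)
    fix l assume "l \<in> {..j}"
    then show "A n - real j \<le> A (n - l)" using A_diff[of l n] assms by auto
  qed
  also have "\<dots> \<le> (\<Sum>l\<le>n. g l * A (n - l))"
    by (intro sum_mono2) (use assms g A_nonneg in auto)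
  finally show ?thesis unfolding sum_convolution A_def .
qed

end

text \<open>With \<open>m l\<close> the probability that a cycle is longer than \<open>l\<close>,
  the third hypothesis says that at every time there is a last visit. The convolution sums then
  equal \<open>n + 1\<close>, and both bounds can be solved for \<open>A n / n\<close>.\<close>

lemma renewal_average:
  assumes m: "\<And>n. 0 \<le> m n" "summable m" "\<And>k. (\<Sum>l\<le>k. a (k - l) * m l) = 1"
  shows "(\<lambda>n. A n / real n) \<longlonglongrightarrow> 1 / suminf m"
proof (rule order_tendstoI)
  have "a 0 * m 0 = 1" using m(3)[of 0] by simp
  then have m0: "0 < m 0" using m(1)[of 0] by (auto simp: less_le)
  then have U: "0 < suminf m" using m by (intro suminf_pos2[where i = 0])
  have lim: "(\<lambda>n. (real n + 1) / real n) \<longlonglongrightarrow> 1" by real_asymp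
  {
    fix b assume "b < 1 / suminf m"
    moreover have "(\<lambda>n. (real n + 1) / real n * (1 / suminf m)) \<longlonglongrightarrow> 1 * (1 / suminf m)"
      by (intro tendsto_intros lim)
    ultimately have "\<forall>\<^sub>F n in sequentially. b < (real n + 1) / real n * (1 / suminf m)"
      by (simp add: order_tendstoD)
    then show "\<forall>\<^sub>F n in sequentially. b < A n / real n"
    proof (rule eventually_rev_mp, intro eventually_sequentiallyI[of 1] impI)
      fix n :: nat assume n: "1 \<le> n" "b < (real n + 1) / real n * (1 / suminf m)"
      have "real n + 1 \<le> A n * suminf m"
        using convolution_le[OF m(1,2), of n] by (simp add: m(3))
      then have "(real n + 1) * (1 / suminf m) \<le> A n"
        using U by (simp add: field_simps)
      then have "(real n + 1) * (1 / suminf m) / real n \<le> A n / real n"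
        by (intro divide_right_mono) auto
      then show "b < A n / real n" using n by (simp add: mult.commute)
    qed
  next
    fix b assume b: "1 / suminf m < b"
    have "(\<lambda>j. 1 / (\<Sum>l\<le>j. m l)) \<longlonglongrightarrow> 1 / suminf m"
      using summable_LIMSEQ'[OF m(2)] U by (intro tendsto_divide tendsto_const) auto
    from order_tendstoD(2)[OF this b] obtain j where j: "1 / (\<Sum>l\<le>j. m l) < b"
      by (auto simp: eventually_sequentially)
    have M: "0 < (\<Sum>l\<le>j. m l)" by (intro sum_pos2[where i = 0] m0 m) auto
    have "(\<lambda>n. (real n + 1) / real n * (1 / (\<Sum>l\<le>j. m l)) + real j / real n) \<longlonglongrightarrow> 1 * (1 / (\<Sum>l\<le>j. m l)) + 0"
      by (intro tendsto_intros lim lim_const_over_n)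
    then have "\<forall>\<^sub>F n in sequentially. (real n + 1) / real n * (1 / (\<Sum>l\<le>j. m l)) + real j / real n < b"
      using j by (simp add: order_tendstoD)
    then show "\<forall>\<^sub>F n in sequentially. A n / real n < b"
    proof (rule eventually_rev_mp, intro eventually_sequentiallyI[of "Suc j"] impI)
      fix n :: nat
      assume n: "Suc j \<le> n" "(real n + 1) / real n * (1 / (\<Sum>l\<le>j. m l)) + real j / real n < b"
      have "(A n - real j) * (\<Sum>l\<le>j. m l) \<le> real n + 1"
        using convolution_ge[OF m(1,2), of j n] n by (simp add: m(3))
      then have "A n - real j \<le> (real n + 1) * (1 / (\<Sum>l\<le>j. m l))"
        using M by (simp add: field_simps)
      then have "(A n - real j) / real n \<le> (real n + 1) * (1 / (\<Sum>l\<le>j. m l)) / real n"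
        by (intro divide_right_mono) auto
      then show "A n / real n < b" using n by (simp add: diff_divide_distrib mult.commute)
    qed
  }
qed

lemma convolution_average:
  assumes A: "(\<lambda>n. A n / real n) \<longlonglongrightarrow> \<alpha>" and g: "\<And>n. 0 \<le> g n" "summable g"
  shows "(\<lambda>n. (\<Sum>k\<le>n. \<Sum>l\<le>k. a (k - l) * g l) / real n) \<longlonglongrightarrow> \<alpha> * suminf g"
proof (rule order_tendstoI)
  fix b assume "\<alpha> * suminf g < b"
  moreover have "(\<lambda>n. A n / real n * suminf g) \<longlonglongrightarrow> \<alpha> * suminf g"
    by (intro tendsto_intros A)
  ultimately have "\<forall>\<^sub>F n in sequentially. A n / real n * suminf g < b" by (simp add: order_tendstoD)
  then show "\<forall>\<^sub>F n in sequentially. (\<Sum>k\<le>n. \<Sum>l\<le>k. a (k - l) * g l) / real n < b"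
  proof (rule eventually_mono)
    fix n assume *: "A n / real n * suminf g < b"
    show "(\<Sum>k\<le>n. \<Sum>l\<le>k. a (k - l) * g l) / real n < b"
      using divide_right_mono[OF convolution_le[OF g, of n], of "real n"] * by simp
  qed
next
  fix b assume b: "b < \<alpha> * suminf g"
  have "(\<lambda>j. \<alpha> * (\<Sum>l\<le>j. g l)) \<longlonglongrightarrow> \<alpha> * suminf g"
    by (intro tendsto_intros summable_LIMSEQ' g)
  from order_tendstoD(1)[OF this b] obtain j where j: "b < \<alpha> * (\<Sum>l\<le>j. g l)"
    by (auto simp: eventually_sequentially)
  have "(\<lambda>n. (A n / real n - real j / real n) * (\<Sum>l\<le>j. g l)) \<longlonglongrightarrow> (\<alpha> - 0) * (\<Sum>l\<le>j. g l)"
    by (intro tendsto_intros A lim_const_over_n)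
  then have "\<forall>\<^sub>F n in sequentially. b < (A n / real n - real j / real n) * (\<Sum>l\<le>j. g l)"
    using j by (simp add: order_tendstoD)
  then show "\<forall>\<^sub>F n in sequentially. b < (\<Sum>k\<le>n. \<Sum>l\<le>k. a (k - l) * g l) / real n"
  proof (rule eventually_rev_mp, intro eventually_sequentiallyI[of j] impI)
    fix n assume n: "j \<le> n" "b < (A n / real n - real j / real n) * (\<Sum>l\<le>j. g l)"
    show "b < (\<Sum>k\<le>n. \<Sum>l\<le>k. a (k - l) * g l) / real n"
      using divide_right_mono[OF convolution_ge[OF g n(1)], of "real n"] n(2)
      by (simp add: diff_divide_distrib[symmetric])
  qed
qed

end

abbreviation law :: "('s \<Rightarrow> 's pmf) \<Rightarrow> 's \<Rightarrow> nat \<Rightarrow> 's pmf" where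
  "law K z k \<equiv> ((\<lambda>\<mu>. bind_pmf \<mu> K) ^^ k) (return_pmf z)"

text \<open>The last visit to \<open>z\<close> happens \<open>l\<close> steps before time
  \<open>k\<close>, and the path then evolves without return. In the state \<open>z\<close> itself
  only \<open>l = 0\<close> contributes, since positive ages are killed there.\<close>

lemma last_visit:
  "ennreal (pmf (law K z k) y) =
    (\<Sum>l\<le>k. ennreal (pmf (law K z (k - l)) z) * killed K z (indicator {z}) l y)"
proof (induction k arbitrary: y)
  case 0
  show ?case by (auto simp: indicator_def)
next
  case (Suc k)
  show ?case
  proof (cases "y = z")
    case True
    then show ?thesis by (subst sum.atMost_Suc_shift) simp
  next
    case False
    have "ennreal (pmf (law K z (Suc k)) y) = push K (\<lambda>x. ennreal (pmf (law K z k) x)) y"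
      by (simp add: push_pmf)
    also have "\<dots> = (\<Sum>l\<le>k. ennreal (pmf (law K z (k - l)) z) * push K (killed K z (indicator {z}) l) y)"
      unfolding Suc by (simp add: push_sum push_cmult)
    finally show ?thesis using False by (subst sum.atMost_Suc_shift) simp
  qed
qed

lemma nn_integral_law:
  "(\<integral>\<^sup>+x. c x \<partial>law K z k) =
    (\<Sum>l\<le>k. ennreal (pmf (law K z (k - l)) z) * mass (\<lambda>x. killed K z (indicator {z}) l x * c x))"
  unfolding nn_integral_measure_pmf_mass
  by (subst last_visit) (simp add: sum_distrib_right nn_integral_sum nn_integral_cmult mult.assoc)

text \<open>Elementary renewal theorem: decomposing at the last visit to \<open>z\<close> expresses the average cost
  through the frequency of visits to \<open>z\<close>, and the constant cost \<open>1\<close> identifies that frequency.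
  No aperiodicity is needed.\<close>

theorem average_law_tendsto:
  assumes st: "stationary K p" and rigid: "rigid K z"
    and fin: "(\<integral>\<^sup>+x. c x \<partial>p) < \<infinity>"
  shows "(\<lambda>T. (\<Sum>k=1..T. \<integral>\<^sup>+x. c x \<partial>law K z k) / of_nat T) \<longlonglongrightarrow> (\<integral>\<^sup>+x. c x \<partial>p)"
proof -
  define a where "a k = pmf (law K z k) z" for k
  interpret convolution_average a
    by standard (simp_all add: a_def pmf_nonneg pmf_le_1)
  \<comment> \<open>Expected cost collected at age \<open>l\<close> of a single cycle; a cycle that
    ended earlier contributes nothing.\<close>
  define t where "t d l = mass (\<lambda>x. killed K z (indicator {z}) l x * d x)" for d l
  note cyc = stationary_eq_cycle[OF st rigid]
  \<comment> \<open>Ratio formula: the cost of a cycle is the stationary cost times the mean return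
    time.\<close>
  have sum_t: "(\<Sum>l. t d l) = inverse (ennreal (pmf p z)) * (\<integral>\<^sup>+x. d x \<partial>p)" for d
  proof -
    have "(\<integral>\<^sup>+x. d x \<partial>p) = mass (\<lambda>x. ennreal (pmf p z) * (cycle_visits K z x * d x))"
      unfolding nn_integral_measure_pmf_mass by (subst cyc(2)) (simp add: mult.assoc)
    also have "\<dots> = ennreal (pmf p z) * (\<Sum>l. t d l)"
      by (simp add: nn_integral_cmult mass_visits_mult t_def)
    finally have "inverse (ennreal (pmf p z)) * (\<integral>\<^sup>+x. d x \<partial>p)
        = (inverse (ennreal (pmf p z)) * ennreal (pmf p z)) * (\<Sum>l. t d l)"
      by (simp add: mult.assoc)
    then show ?thesis using ennreal_mult_inverse[OF cyc(1)] by (simp add: mult.commute)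
  qed
  have real_t: "\<And>l. t d l = ennreal (enn2real (t d l))" "summable (\<lambda>l. enn2real (t d l))"
    "(\<Sum>l. enn2real (t d l)) = enn2real (\<integral>\<^sup>+x. d x \<partial>p) / pmf p z"
    if d: "(\<integral>\<^sup>+x. d x \<partial>p) < \<infinity>" for d
  proof -
    have S: "(\<Sum>l. t d l) = ennreal (enn2real (\<integral>\<^sup>+x. d x \<partial>p) / pmf p z)"
      unfolding sum_t using d cyc(1)
      by (cases "\<integral>\<^sup>+x. d x \<partial>p")
         (simp_all add: inverse_ennreal ennreal_mult[symmetric] divide_inverse mult.commute)
    have "t d l \<le> (\<Sum>l. t d l)" for l
      using sum_le_suminf[OF summableI, of "{l}" "t d"] by simp
    then have "t d l < \<infinity>" for l using S by (metis ennreal_less_top infinity_ennreal_def le_less_trans)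
    then show eq: "t d l = ennreal (enn2real (t d l))" for l by simp
    have sums: "(\<lambda>l. ennreal (enn2real (t d l))) sums ennreal (enn2real (\<integral>\<^sup>+x. d x \<partial>p) / pmf p z)"
      unfolding eq[symmetric] S[symmetric] by (intro summable_sums summableI)
    then have "(\<lambda>l. enn2real (t d l)) sums (enn2real (\<integral>\<^sup>+x. d x \<partial>p) / pmf p z)"
      using cyc(1) by (subst (asm) sums_ennreal) auto
    then show "summable (\<lambda>l. enn2real (t d l))"
      "(\<Sum>l. enn2real (t d l)) = enn2real (\<integral>\<^sup>+x. d x \<partial>p) / pmf p z"
      by (auto simp: sums_iff)
  qed
  have law_d: "(\<integral>\<^sup>+x. d x \<partial>law K z k) = ennreal (\<Sum>l\<le>k. a (k - l) * enn2real (t d l))"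
    if d: "(\<integral>\<^sup>+x. d x \<partial>p) < \<infinity>" for d k
    unfolding nn_integral_law t_def[symmetric] a_def[symmetric]
    by (subst real_t(1)[OF d], subst sum_ennreal[symmetric]) (auto simp: ennreal_mult a)
  have one: "(\<integral>\<^sup>+x. 1 \<partial>measure_pmf p) = (1::ennreal)" by simp
  \<comment> \<open>Cost 1 has expectation 1 at every time, which is the renewal equation for the
    survival probabilities.\<close>
  have "(\<Sum>l\<le>k. a (k - l) * enn2real (t (\<lambda>_. 1) l)) = 1" for k
  proof -
    have "ennreal (\<Sum>l\<le>k. a (k - l) * enn2real (t (\<lambda>_. 1) l)) = ennreal 1"
      by (subst law_d[symmetric]) (simp_all add: one)
    then show ?thesis by (subst (asm) ennreal_inj) (auto intro!: sum_nonneg mult_nonneg_nonneg a)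
  qed
  from renewal_average[OF _ real_t(2) this] have "(\<lambda>n. A n / real n) \<longlonglongrightarrow> pmf p z"
    using real_t(3)[of "\<lambda>_. 1"] by (simp add: one)
  from convolution_average[OF this _ real_t(2)[OF fin]]
  have lim: "(\<lambda>n. (\<Sum>k\<le>n. \<Sum>l\<le>k. a (k - l) * enn2real (t c l)) / real n) \<longlonglongrightarrow> enn2real (\<integral>\<^sup>+x. c x \<partial>p)"
    using cyc(1) by (simp add: real_t(3)[OF fin])
  \<comment> \<open>The convolution sums start at time 0, the averages at time 1; the extra term
    disappears in the limit.\<close>
  have "(\<lambda>n. (\<Sum>k\<le>n. \<Sum>l\<le>k. a (k - l) * enn2real (t c l)) / real n - (a 0 * enn2real (t c 0)) / real n)
      \<longlonglongrightarrow> enn2real (\<integral>\<^sup>+x. c x \<partial>p) - 0"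
    by (intro tendsto_diff lim lim_const_over_n)
  then have "(\<lambda>n. (\<Sum>k=1..n. \<Sum>l\<le>k. a (k - l) * enn2real (t c l)) / real n) \<longlonglongrightarrow> enn2real (\<integral>\<^sup>+x. c x \<partial>p)"
    by (simp add: diff_divide_distrib[symmetric] atMost_atLeast0 sum.atLeast_Suc_atMost[of 0])
  then have "(\<lambda>n. ennreal ((\<Sum>k=1..n. \<Sum>l\<le>k. a (k - l) * enn2real (t c l)) / real n))
      \<longlonglongrightarrow> ennreal (enn2real (\<integral>\<^sup>+x. c x \<partial>p))"
    by (intro tendsto_ennrealI)
  then have "(\<lambda>n. ennreal ((\<Sum>k=1..n. \<Sum>l\<le>k. a (k - l) * enn2real (t c l)) / real n)) \<longlonglongrightarrow> (\<integral>\<^sup>+x. c x \<partial>p)"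
    using fin by simp
  moreover have "\<forall>\<^sub>F n in sequentially. ennreal ((\<Sum>k=1..n. \<Sum>l\<le>k. a (k - l) * enn2real (t c l)) / real n)
      = (\<Sum>k=1..n. \<integral>\<^sup>+x. c x \<partial>law K z k) / of_nat n"
  proof (intro eventually_sequentiallyI[of 1])
    fix n :: nat assume "1 \<le> n"
    then show "ennreal ((\<Sum>k=1..n. \<Sum>l\<le>k. a (k - l) * enn2real (t c l)) / real n)
      = (\<Sum>k=1..n. \<integral>\<^sup>+x. c x \<partial>law K z k) / of_nat n"
      unfolding law_d[OF fin]
      by (subst divide_ennreal[symmetric])
         (auto simp: sum_ennreal sum_nonneg a ennreal_of_nat_eq_real_of_nat)
  qed
  ultimately show ?thesis by (rule Lim_transform_eventually)
qed

subsection \<open>Occupation laws\<close>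

lemma infsum_ennreal_eq_mass:
  fixes f :: "'s::countable \<Rightarrow> ennreal"
  shows "infsum f UNIV = mass f"
proof -
  have "infsum f UNIV = (SUP F\<in>{F. finite F}. sum f F)"
    by (subst nonneg_infsum_complete) auto
  also have "\<dots> = mass f"
  proof (rule antisym)
    show "(SUP F\<in>{F. finite F}. sum f F) \<le> mass f"
    proof (rule SUP_least)
      fix F :: "'s set" assume "F \<in> {F. finite F}"
      then have "sum f F = mass (\<lambda>x. f x * indicator F x)"
        by (subst nn_integral_count_space'[where A = F]) (auto simp: indicator_def)
      also have "\<dots> \<le> mass f" by (intro nn_integral_mono) (auto simp: indicator_def)
      finally show "sum f F \<le> mass f" .
    qed
    \<comment> \<open>An increasing exhaustion of the countable type by finite sets, for monotone
      convergence.\<close>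
    define F where "F n = {x :: 's. to_nat x \<le> n}" for n
    have fin: "finite (F n)" for n
    proof (rule finite_subset)
      show "F n \<subseteq> from_nat ` {..n}"
        by (rule subsetI, rule image_eqI[where x = "to_nat _"]) (auto simp: F_def)
    qed simp
    have "f x = (SUP n. f x * indicator (F n) x)" for x
    proof (rule antisym)
      show "f x \<le> (SUP n. f x * indicator (F n) x)"
        by (rule SUP_upper2[of "to_nat x"]) (auto simp: F_def)
      show "(SUP n. f x * indicator (F n) x) \<le> f x"
        by (rule SUP_least) (auto simp: indicator_def)
    qed
    then have "mass f = mass (\<lambda>x. SUP n. f x * indicator (F n) x)" by simp
    also have "\<dots> = (SUP n. mass (\<lambda>x. f x * indicator (F n) x))"
      by (rule nn_integral_monotone_convergence_SUP)
         (auto simp: incseq_def le_fun_def F_def indicator_def)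
    also have "\<dots> \<le> (SUP F\<in>{F. finite F}. sum f F)"
    proof (rule SUP_least)
      fix n
      have "mass (\<lambda>x. f x * indicator (F n) x) = sum f (F n)"
        by (subst nn_integral_count_space'[where A = "F n"]) (auto simp: indicator_def fin)
      then show "mass (\<lambda>x. f x * indicator (F n) x) \<le> (SUP F\<in>{F. finite F}. sum f F)"
        by (auto intro!: SUP_upper2[of "F n"] simp: fin)
    qed
    finally show "mass f \<le> (SUP F\<in>{F. finite F}. sum f F)" .
  qed
  finally show ?thesis .
qed

text \<open>Moves the \<open>has_sum\<close> conditions of the programs to \<open>ennreal\<close>;
  conversely a finite mass bounds all finite partial sums and so yields summability.\<close>

lemma has_sum_iff_mass:
  fixes f :: "'s::countable \<Rightarrow> real"
  assumes f: "\<And>x. 0 \<le> f x"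
  shows "(f has_sum s) UNIV \<longleftrightarrow> 0 \<le> s \<and> mass (\<lambda>x. ennreal (f x)) = ennreal s"
proof -
  have eq: "mass (\<lambda>x. ennreal (f x)) = (SUP F\<in>{F. finite F \<and> F \<subseteq> UNIV}. ennreal (sum f F))"
    unfolding infsum_ennreal_eq_mass[symmetric]
    by (subst nonneg_infsum_complete) (auto simp: sum_ennreal f)
  have forward: "mass (\<lambda>x. ennreal (f x)) = ennreal t" if "(f has_sum t) UNIV" for t
    using infsum_nonneg_is_SUPREMUM_ennreal[of f UNIV] that f unfolding eq
    by (auto simp: has_sum_iff)
  show ?thesis
  proof
    assume *: "(f has_sum s) UNIV"
    then show "0 \<le> s \<and> mass (\<lambda>x. ennreal (f x)) = ennreal s"
      using forward has_sum_nonneg[OF *] f by auto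
  next
    assume *: "0 \<le> s \<and> mass (\<lambda>x. ennreal (f x)) = ennreal s"
    have "f summable_on UNIV"
    proof (rule nonneg_bdd_above_summable_on)
      show "bdd_above (sum f ` {F. F \<subseteq> UNIV \<and> finite F})"
      proof (rule bdd_aboveI2)
        fix F :: "'s set" assume "F \<in> {F. F \<subseteq> UNIV \<and> finite F}"
        then have "ennreal (sum f F) \<le> ennreal s"
          using * unfolding eq by (metis (mono_tags, lifting) SUP_upper mem_Collect_eq)
        then show "sum f F \<le> s" using * by (simp add: ennreal_le_iff)
      qed
    qed (use f in auto)
    then obtain t where t: "(f has_sum t) UNIV" by (auto simp: summable_on_def)
    then have "ennreal t = ennreal s" "0 \<le> t" using forward[OF t] * has_sum_nonneg[OF t] f by auto
    then show "(f has_sum s) UNIV" using t * by simp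
  qed
qed

section \<open>Laws of states and actions\<close>

lemma pmf_bind_bernoulli:
  assumes "s \<in> {0..1}"
  shows "pmf (bernoulli_pmf s \<bind> f) y = s * pmf (f True) y + (1 - s) * pmf (f False) y"
  using assms by (simp add: pmf_bind mult.commute)

lemma bernoulli_of_bool: "bernoulli_pmf (of_bool a) = return_pmf a"
proof (rule pmf_eqI)
  show "pmf (bernoulli_pmf (of_bool a)) b = pmf (return_pmf a) b" for b
    by (cases a; cases b) simp_all
qed

definition cap2 :: "(nat \<Rightarrow> nat) \<Rightarrow> nat \<times> nat \<Rightarrow> nat \<times> nat" where
  "cap2 cap = map_prod cap cap"

definition occ_of :: "(nat \<times> nat) pmf \<Rightarrow> (nat \<Rightarrow> nat \<Rightarrow> real) \<Rightarrow> (nat \<times> nat \<times> bool) pmf" where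
  "occ_of \<pi> \<tau> = do { (i, j) \<leftarrow> \<pi>; a \<leftarrow> bernoulli_pmf (\<tau> i j); return_pmf (i, j, a) }"

definition state_of :: "nat \<times> nat \<times> bool \<Rightarrow> nat \<times> nat" where
  "state_of = (\<lambda>(i, j, a). (i, j))"

definition sensor_of :: "nat \<times> nat \<times> bool \<Rightarrow> nat \<times> bool" where
  "sensor_of = (\<lambda>(i, j, a). (i, a))"

abbreviation "sensor_marginal \<equiv> map_pmf sensor_of"

lemma sensor_law_eq: "sensor_law \<tau> \<pi> = sensor_marginal (occ_of \<pi> \<tau>)"
  unfolding sensor_law_def occ_of_def
  by (simp add: map_bind_pmf sensor_of_def case_prod_beta')

lemma map_state_of_occ_of: "map_pmf state_of (occ_of \<pi> \<tau>) = \<pi>"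
proof -
  have "map_pmf state_of (occ_of \<pi> \<tau>) = bind_pmf \<pi> return_pmf"
    unfolding occ_of_def by (simp add: map_bind_pmf state_of_def case_prod_beta')
  then show ?thesis by (simp add: bind_return_pmf')
qed

lemma pmf_occ_of:
  assumes "\<And>i j. \<tau> i j \<in> {0..1}"
  shows "pmf (occ_of \<pi> \<tau>) (i, j, a) = pmf \<pi> (i, j) * (if a then \<tau> i j else 1 - \<tau> i j)"
proof -
  have "ennreal (pmf (occ_of \<pi> \<tau>) (i, j, a))
      = (\<integral>\<^sup>+x. ennreal (if a then \<tau> i j else 1 - \<tau> i j) * indicator {(i, j)} x \<partial>\<pi>)"
    unfolding occ_of_def ennreal_pmf_bind
  proof (intro nn_integral_cong)
    fix x :: "nat \<times> nat"
    show "ennreal (pmf (case x of (i, j) \<Rightarrow> bernoulli_pmf (\<tau> i j) \<bind> (\<lambda>a. return_pmf (i, j, a))) (i, j, a))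
        = ennreal (if a then \<tau> i j else 1 - \<tau> i j) * indicator {(i, j)} x"
      using assms[of "fst x" "snd x"]
      by (cases x) (auto simp: pmf_bind_bernoulli indicator_def)
  qed
  also have "\<dots> = ennreal (pmf \<pi> (i, j) * (if a then \<tau> i j else 1 - \<tau> i j))"
    using assms[of i j] by (simp add: nn_integral_cmult emeasure_pmf_single ennreal_mult mult.commute)
  finally show ?thesis using assms[of i j] by simp
qed

lemma pmf_map_state_of:
  fixes q :: "(nat \<times> nat \<times> bool) pmf"
  shows "pmf (map_pmf state_of q) (i, j) = pmf q (i, j, True) + pmf q (i, j, False)"
proof -
  have "pmf (map_pmf state_of q) (i, j) = measure q (state_of -` {(i, j)})" by (rule pmf_map)
  also have "state_of -` {(i, j)} = {(i, j, True), (i, j, False)}"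
    by (auto simp: state_of_def)
  also have "measure q {(i, j, True), (i, j, False)} = pmf q (i, j, True) + pmf q (i, j, False)"
    by (subst measure_measure_pmf_finite) auto
  finally show ?thesis .
qed

text \<open>In states without mass both sides vanish whatever the policy does. This matches the
  freedom granted by \<open>policy_of\<close>.\<close>

lemma occ_disintegrate:
  fixes q :: "(nat \<times> nat \<times> bool) pmf"
  assumes "\<And>i j. \<tau> i j \<in> {0..1}"
    and "\<And>i j. pmf q (i, j, True) + pmf q (i, j, False) \<noteq> 0 \<Longrightarrow>
      \<tau> i j = pmf q (i, j, True) / (pmf q (i, j, True) + pmf q (i, j, False))"
  shows "q = occ_of (map_pmf state_of q) \<tau>"
proof (rule pmf_eqI)
  fix x :: "nat \<times> nat \<times> bool"
  obtain i j a where x: "x = (i, j, a)" by (cases x) auto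
  have nn: "0 \<le> pmf q (i, j, True)" "0 \<le> pmf q (i, j, False)" by (auto simp: pmf_nonneg)
  show "pmf q x = pmf (occ_of (map_pmf state_of q) \<tau>) x"
  proof (cases "pmf q (i, j, True) + pmf q (i, j, False) = 0")
    case True
    then have "pmf q (i, j, True) = 0" "pmf q (i, j, False) = 0" using nn by linarith+
    then show ?thesis unfolding x pmf_occ_of[OF assms(1)] pmf_map_state_of by (cases a) auto
  next
    case False
    then show ?thesis
      unfolding x pmf_occ_of[OF assms(1)] pmf_map_state_of assms(2)[OF False]
      by (cases a) (auto simp: field_simps)
  qed
qed

lemma ex_occ_disintegrate:
  fixes q :: "(nat \<times> nat \<times> bool) pmf"
  shows
  "\<exists>\<tau>. (\<forall>i j. \<tau> i j \<in> {0..1}) \<and> q = occ_of (map_pmf state_of q) \<tau>"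
proof -
  \<comment> \<open>In states without mass this is \<open>0 / 0 = 0\<close>, which is still a
    probability.\<close>
  define \<tau> where "\<tau> i j = pmf q (i, j, True) / (pmf q (i, j, True) + pmf q (i, j, False))" for i j
  have "\<tau> i j \<in> {0..1}" for i j
    unfolding \<tau>_def atLeastAtMost_iff
    by (intro conjI divide_nonneg_nonneg add_nonneg_nonneg pmf_nonneg) (simp add: divide_le_eq_1 pmf_nonneg less_le)
  then show ?thesis by (intro exI[of _ \<tau>] conjI occ_disintegrate allI) (auto simp: \<tau>_def)
qed

locale channel =
  fixes l le la :: real
  assumes l: "l \<in> {0..1}" and le01: "le \<in> {0..1}" and la: "la \<in> {0..1}"
begin

abbreviation step :: "(nat \<Rightarrow> nat \<Rightarrow> real) \<Rightarrow> nat \<times> nat \<Rightarrow> (nat \<times> nat) pmf" where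
  "step \<equiv> joint_step l le la"

abbreviation act :: "bool \<Rightarrow> nat \<times> nat \<Rightarrow> (nat \<times> nat) pmf" where
  "act a \<equiv> step (\<lambda>_ _. of_bool a)"

definition kern :: "(nat \<Rightarrow> nat) \<Rightarrow> (nat \<Rightarrow> nat \<Rightarrow> real) \<Rightarrow> nat \<times> nat \<Rightarrow> (nat \<times> nat) pmf" where
  "kern cap \<tau> x = map_pmf (cap2 cap) (step \<tau> x)"

text \<open>Flow balance as an identity of laws. Taking \<open>id\<close> or \<open>cap_at N\<close>
  for \<open>cap\<close> covers both programs.\<close>

definition balanced :: "(nat \<Rightarrow> nat) \<Rightarrow> (nat \<times> nat \<times> bool) pmf \<Rightarrow> bool" where
  "balanced cap q \<longleftrightarrow>
    map_pmf state_of q = bind_pmf q (\<lambda>(i, j, a). map_pmf (cap2 cap) (act a (i, j)))"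

lemma kern_id: "kern id = step"
  by (simp add: kern_def[abs_def] cap2_def prod.map_id0)

lemma step_eq_bind: "step \<tau> (i, j) = bernoulli_pmf (\<tau> i j) \<bind> (\<lambda>a. act a (i, j))"
proof -
  show ?thesis unfolding joint_step_def by (simp add: bernoulli_of_bool bind_return_pmf)
qed

lemma balanced_occ_of: "balanced cap (occ_of \<pi> \<tau>) \<longleftrightarrow> stationary (kern cap \<tau>) \<pi>"
proof -
  have "bind_pmf (occ_of \<pi> \<tau>) (\<lambda>(i, j, a). map_pmf (cap2 cap) (act a (i, j))) = bind_pmf \<pi> (kern cap \<tau>)"
    unfolding occ_of_def bind_assoc_pmf
  proof (intro bind_pmf_cong refl)
    fix x
    show "(case x of (i, j) \<Rightarrow> bernoulli_pmf (\<tau> i j) \<bind> (\<lambda>a. return_pmf (i, j, a)))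
        \<bind> (\<lambda>(i, j, a). map_pmf (cap2 cap) (act a (i, j))) = kern cap \<tau> x"
      by (cases x) (simp add: kern_def step_eq_bind[of \<tau>] bind_assoc_pmf bind_return_pmf map_bind_pmf)
  qed
  then show ?thesis by (auto simp: balanced_def stationary_def map_state_of_occ_of)
qed

lemma pmf_act:
  assumes "cap 0 = 0"
  shows "pmf (map_pmf (cap2 cap) (act a x)) y = mdp_trans cap l le la x a y"
proof -
  obtain i j where x: "x = (i, j)" by (cases x)
  show ?thesis unfolding x joint_step_def mdp_trans_def using l le01 la assms
    by (cases a) (simp_all add: map_bind_pmf pmf_bind_bernoulli cap2_def indicator_def of_bool_def,
       simp_all add: algebra_simps)
qed

lemma mdp_trans_nonneg: "0 \<le> mdp_trans cap l le la x a y"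
  using l le01 la by (cases x) (auto simp: mdp_trans_def mult_le_one intro!: add_nonneg_nonneg mult_nonneg_nonneg)

lemma balanced_iff:
  assumes "cap 0 = 0"
  shows "balanced cap q \<longleftrightarrow> (\<forall>i j. mass (\<lambda>(i', j', a). ennreal (pmf q (i', j', a) * mdp_trans cap l le la (i', j') a (i, j)))
     = ennreal (pmf q (i, j, True) + pmf q (i, j, False)))"
proof -
  have "ennreal (pmf (bind_pmf q (\<lambda>(i, j, a). map_pmf (cap2 cap) (act a (i, j)))) y)
      = mass (\<lambda>(i', j', a). ennreal (pmf q (i', j', a) * mdp_trans cap l le la (i', j') a y))" for y
    unfolding ennreal_pmf_bind nn_integral_measure_pmf_mass
    by (intro nn_integral_cong) (auto simp: pmf_act[of cap, OF assms] ennreal_mult mdp_trans_nonneg split: prod.split)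
  then have "balanced cap q \<longleftrightarrow> (\<forall>i j. ennreal (pmf (map_pmf state_of q) (i, j)) =
      mass (\<lambda>(i', j', a). ennreal (pmf q (i', j', a) * mdp_trans cap l le la (i', j') a (i, j))))"
    unfolding balanced_def pmf_eq_iff by (auto simp flip: ennreal_inj[OF pmf_nonneg pmf_nonneg])
  then show ?thesis unfolding pmf_map_state_of by auto
qed

text \<open>Lets feasible points be handled as laws on state-action triples, with
  \<open>balanced\<close> in place of an infinite system of sums.\<close>

lemma Omega_iff: "\<rho> \<in> Omega l le la \<longleftrightarrow> (\<exists>q. balanced id q \<and> \<rho> = (\<lambda>i j a. pmf q (i, j, a)))"
proof
  assume "\<rho> \<in> Omega l le la"
  then have nn: "\<And>i j a. 0 \<le> \<rho> i j a" and tot: "((\<lambda>(i, j, a). \<rho> i j a) has_sum 1) UNIV"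
    and bal: "\<And>i j. ((\<lambda>(i', j', a). \<rho> i' j' a * mdp_trans id l le la (i', j') a (i, j))
       has_sum (\<Sum>a\<in>UNIV. \<rho> i j a)) UNIV"
    by (auto simp: Omega_def)
  define q where "q = embed_pmf (\<lambda>(i, j, a). \<rho> i j a)"
  have "mass (\<lambda>x. ennreal ((\<lambda>(i, j, a). \<rho> i j a) x)) = 1"
    using tot nn by (subst (asm) has_sum_iff_mass) auto
  then have "pmf q x = (\<lambda>(i, j, a). \<rho> i j a) x" for x
    unfolding q_def by (intro pmf_embed_pmf) (auto simp: nn)
  then have q: "pmf q (i, j, a) = \<rho> i j a" for i j a by simp
  have "mass (\<lambda>(i', j', a). ennreal (\<rho> i' j' a * mdp_trans id l le la (i', j') a (i, j)))
        = ennreal (\<rho> i j True + \<rho> i j False)" for i j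
    using bal[of i j] nn
    by (subst (asm) has_sum_iff_mass) (auto simp: split_beta' mdp_trans_nonneg UNIV_bool add.commute)
  then have "balanced id q" by (subst balanced_iff) (auto simp: q)
  then show "\<exists>q. balanced id q \<and> \<rho> = (\<lambda>i j a. pmf q (i, j, a))" by (auto simp: q)
next
  assume "\<exists>q. balanced id q \<and> \<rho> = (\<lambda>i j a. pmf q (i, j, a))"
  then obtain q where q: "balanced id q" "\<rho> = (\<lambda>i j a. pmf q (i, j, a))" by auto
  have "((\<lambda>(i, j, a). pmf q (i, j, a)) has_sum 1) UNIV"
    using mass_pmf[of q] by (subst has_sum_iff_mass) (auto simp: split_beta' pmf_nonneg)
  moreover have "((\<lambda>(i', j', a). pmf q (i', j', a) * mdp_trans id l le la (i', j') a (i, j))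
       has_sum (\<Sum>a\<in>UNIV. pmf q (i, j, a))) UNIV" for i j
    using q(1) unfolding balanced_iff[of id, simplified]
    by (subst has_sum_iff_mass)
       (auto simp: split_beta' pmf_nonneg mdp_trans_nonneg UNIV_bool add.commute add_nonneg_nonneg)
  ultimately show "\<rho> \<in> Omega l le la" by (simp add: Omega_def q(2) pmf_nonneg)
qed

end

lemma mass_prod: "mass F = mass (\<lambda>x. mass (\<lambda>y. F (x, y)))"
  by (rule nn_integral_fst_count_space[symmetric])

lemma mass_bool: "mass F = F True + F False"
  by (subst nn_integral_count_space'[where A = UNIV]) (auto simp: UNIV_bool add.commute)

lemma mass_state_action:
  fixes F :: "nat \<times> nat \<times> bool \<Rightarrow> ennreal"
  shows "mass F = mass (\<lambda>(i, j). F (i, j, True) + F (i, j, False))"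
  by (subst (1 2) mass_prod, subst mass_prod) (simp add: mass_bool)

definition l1 :: "'s pmf \<Rightarrow> 's pmf \<Rightarrow> ennreal" where
  "l1 p q = mass (\<lambda>x. ennreal \<bar>pmf p x - pmf q x\<bar>)"

lemma suminf_tail_tendsto_0:
  fixes f :: "nat \<Rightarrow> ennreal"
  assumes "suminf f < \<infinity>"
  shows "(\<lambda>N. \<Sum>k. f (k + N)) \<longlonglongrightarrow> 0"
proof -
  have le: "f k \<le> suminf f" for k
    using sum_le_suminf[OF summableI, of "{k}" f] by simp
  define r where "r k = enn2real (f k)" for k
  have fr: "f = (\<lambda>k. ennreal (r k))"
    using le assms by (auto simp: r_def fun_eq_iff) (metis ennreal_enn2real le_less_trans)
  have r0: "0 \<le> r k" for k by (simp add: r_def)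
  have sr: "summable r"
    using assms unfolding fr by (intro summable_suminf_not_top r0) auto
  have "(\<Sum>k. f (k + N)) = ennreal (\<Sum>k. r (k + N))" for N
    unfolding fr using sr r0 by (intro suminf_ennreal2) auto
  moreover have "(\<lambda>N. \<Sum>k. r (k + N)) \<longlonglongrightarrow> 0"
    by (rule suminf_exist_split2[OF sr])
  ultimately show ?thesis using tendsto_ennrealI[of "\<lambda>N. \<Sum>k. r (k + N)" 0] by simp
qed

lemma terms_tendsto_0:
  fixes f :: "nat \<Rightarrow> ennreal"
  assumes "suminf f < \<infinity>"
  shows "f \<longlonglongrightarrow> 0"
proof (rule tendsto_sandwich[OF _ _ tendsto_const suminf_tail_tendsto_0[OF assms]])
  show "\<forall>\<^sub>F N in sequentially. f N \<le> (\<Sum>k. f (k + N))"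
    using sum_le_suminf[OF summableI, of "{0}" "\<lambda>k. f (k + N)" for N] by simp
qed auto

lemma mass_indicator_mult: "mass (\<lambda>x. indicator {y} x * f x) = (f y :: ennreal)"
  by (subst nn_integral_count_space'[where A = "{y}"]) (auto simp: indicator_def)

section \<open>Recurrence of the holding-time chain\<close>

definition saturated :: "nat \<Rightarrow> (nat \<Rightarrow> nat \<Rightarrow> real) \<Rightarrow> bool" where
  "saturated N \<tau> \<longleftrightarrow> (\<forall>i j. N \<le> i \<or> N \<le> j \<longrightarrow> \<tau> i j = 1)"

text \<open>The boundary constraint of the truncated program, extended to all states beyond the
  horizon so that it also makes sense for laws of the full model.\<close>

definition idle_free :: "nat \<Rightarrow> (nat \<times> nat \<times> bool) pmf \<Rightarrow> bool" where
  "idle_free N q \<longleftrightarrow> (\<forall>i j. N \<le> i \<or> N \<le> j \<longrightarrow> pmf q (i, j, False) = 0)"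

locale lossy_channel = channel +
  assumes p0: "0 < l * la" and p1: "l * la < 1" and le0: "0 < le" and le1: "le < 1"
begin

abbreviation "p \<equiv> l * la"
abbreviation "z \<equiv> (0::nat, 0::nat)"

lemma pmf_kern:
  assumes "\<tau> i j \<in> {0..1}" "cap 0 = 0"
  shows "pmf (kern cap \<tau> (i, j)) y =
    \<tau> i j * mdp_trans cap l le la (i, j) True y + (1 - \<tau> i j) * mdp_trans cap l le la (i, j) False y"
  unfolding kern_def step_eq_bind[of \<tau>] map_bind_pmf
  by (subst pmf_bind_bernoulli[OF assms(1)]) (simp only: pmf_act[of cap, OF assms(2)])

text \<open>Idling in the corner of a capped square would be absorbing and carry an invariant law of
  its own. The condition on \<open>cap\<close> excludes this: wherever the policy may idle, the
  sensor coordinate really increases.\<close>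

lemma rigid_kern:
  assumes \<tau>: "\<And>i j. \<tau> i j \<in> {0..1}" and cap: "cap 0 = 0" "\<And>i j. \<tau> i j \<noteq> 1 \<Longrightarrow> cap (Suc i) = Suc i"
  shows "rigid (kern cap \<tau>) z"
  unfolding rigid_def
proof (intro allI impI, elim conjE)
  fix d :: "nat \<times> nat \<Rightarrow> ennreal"
  assume inv: "\<forall>y. push (kern cap \<tau>) d y = d y" and dz: "d z = 0"
  have "d x * ennreal (pmf (kern cap \<tau> x) z) = 0" for x
  proof -
    have "mass (\<lambda>x. d x * ennreal (pmf (kern cap \<tau> x) z)) = 0"
      using inv dz by (metis push_def)
    then show ?thesis by (cases x) (simp add: nn_integral_0_iff_AE AE_count_space)
  qed
  \<comment> \<open>Sending reaches \<open>z\<close> in one step with positive probability, so mass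
    can sit only where the policy never sends.\<close>
  then have idle: "\<tau> i j = 0" if "d (i, j) \<noteq> 0" for i j
  proof -
    have "ennreal (pmf (kern cap \<tau> (i, j)) z) = 0"
      using \<open>\<And>x. d x * ennreal (pmf (kern cap \<tau> x) z) = 0\<close>[of "(i, j)"] that by simp
    then have "pmf (kern cap \<tau> (i, j)) z = 0"
      by (simp add: pmf_nonneg order.antisym)
    then have "\<tau> i j * mdp_trans cap l le la (i, j) True z = 0"
      unfolding pmf_kern[of \<tau> _ _ cap, OF \<tau> cap(1)] using \<tau>[of i j] mdp_trans_nonneg[of cap "(i, j)" _ z]
      by (metis add_nonneg_eq_0_iff atLeastAtMost_iff diff_ge_0_iff_ge mult_nonneg_nonneg)
    moreover have "0 < mdp_trans cap l le la (i, j) True z"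
    proof -
      have "0 < p * le" using p0 le0 by simp
      \<comment> \<open>An inequality only, because for horizon 0 the capped successors coincide
        with \<open>z\<close>.\<close>
      also have "p * le \<le> mdp_trans cap l le la (i, j) True z"
        using p0 p1 le0 le1 by (simp add: mdp_trans_def)
      finally show ?thesis .
    qed
    ultimately show ?thesis by simp
  qed
  \<comment> \<open>Idle moves raise the first coordinate by one, so row \<open>i\<close> is fed by
    lower rows only and row 0 by none.\<close>
  have "\<forall>j. d (i, j) = 0" for i
  proof (induction i rule: less_induct)
    case (less i)
    show ?case
    proof
      fix j
      have "d x * ennreal (pmf (kern cap \<tau> x) (i, j)) = 0" for x
      proof (rule ccontr)
        obtain a b where x: "x = (a, b)" by (cases x)
        assume "d x * ennreal (pmf (kern cap \<tau> x) (i, j)) \<noteq> 0"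
        then have "d (a, b) \<noteq> 0" "pmf (kern cap \<tau> (a, b)) (i, j) \<noteq> 0" by (auto simp: x)
        moreover from this have "\<tau> a b = 0" by (intro idle)
        ultimately have "(i, j) = (cap (Suc a), cap (Suc b))"
          unfolding pmf_kern[of \<tau> _ _ cap, OF \<tau> cap(1)] by (auto simp: mdp_trans_def split: if_splits)
        then have "i = Suc a" using cap(2)[of a b] \<open>\<tau> a b = 0\<close> by simp
        then show False using less[of a] \<open>d (a, b) \<noteq> 0\<close> by auto
      qed
      then have "push (kern cap \<tau>) d (i, j) = 0"
        unfolding push_def by (simp only: nn_integral_const) simp
      then show "d (i, j) = 0" using inv by simp
    qed
  qed
  then show "d = (\<lambda>_. 0)" by (auto simp: fun_eq_iff)
qed

lemma rigid_step: "(\<And>i j. \<tau> i j \<in> {0..1}) \<Longrightarrow> rigid (step \<tau>) z"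
  using rigid_kern[of \<tau> id] by (simp add: kern_id)

lemma nn_integral_step:
  assumes "\<tau> i j \<in> {0..1}"
  shows "(\<integral>\<^sup>+y. f y \<partial>step \<tau> (i, j)) =
    ennreal (\<tau> i j * ((1 - p) * (1 - le)) + (1 - \<tau> i j)) * f (Suc i, Suc j) +
    ennreal (\<tau> i j * (p * (1 - le))) * f (0, Suc j) +
    ennreal (\<tau> i j * ((1 - p) * le)) * f (Suc i, 0) +
    ennreal (\<tau> i j * (p * le)) * f (0, 0)"
proof -
  define F where "F = {(Suc i, Suc j), (0, Suc j), (Suc i, 0), (0, 0)}"
  have pmf: "pmf (step \<tau> (i, j)) y =
    \<tau> i j * mdp_trans id l le la (i, j) True y + (1 - \<tau> i j) * mdp_trans id l le la (i, j) False y" for y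
    using pmf_kern[of \<tau> i j id, OF assms] by (simp add: kern_id)
  have "(\<integral>\<^sup>+y. f y \<partial>step \<tau> (i, j)) = (\<Sum>y\<in>F. ennreal (pmf (step \<tau> (i, j)) y) * f y)"
    unfolding nn_integral_measure_pmf_mass
    by (subst nn_integral_count_space'[where A = F])
       (auto simp: F_def pmf mdp_trans_def)
  then show ?thesis by (simp add: F_def pmf mdp_trans_def add.assoc)
qed

text \<open>Real form of the drift hypothesis of \<open>visits_lyapunov\<close>; the fourth
  successor \<open>z\<close> is absent because the potential counts as zero there.\<close>

lemma lyapunov_step_real:
  assumes "\<tau> i j \<in> {0..1}" "\<And>y. 0 \<le> V y" "0 \<le> g"
    and "g + (\<tau> i j * ((1 - p) * (1 - le)) + (1 - \<tau> i j)) * V (Suc i, Suc j) +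
      \<tau> i j * (p * (1 - le)) * V (0, Suc j) + \<tau> i j * ((1 - p) * le) * V (Suc i, 0) \<le> V (i, j)"
  shows "ennreal g + (\<integral>\<^sup>+y. (if y = z then 0 else ennreal (V y)) \<partial>step \<tau> (i, j)) \<le> ennreal (V (i, j))"
proof -
  have nn: "0 \<le> \<tau> i j" "0 \<le> 1 - \<tau> i j" "0 \<le> p" "0 \<le> 1 - p" "0 \<le> le" "0 \<le> 1 - le"
    using assms(1) p0 p1 le0 le1 by auto
  have "ennreal g + (\<integral>\<^sup>+y. (if y = z then 0 else ennreal (V y)) \<partial>step \<tau> (i, j)) =
    ennreal (g + (\<tau> i j * ((1 - p) * (1 - le)) + (1 - \<tau> i j)) * V (Suc i, Suc j) +
      \<tau> i j * (p * (1 - le)) * V (0, Suc j) + \<tau> i j * ((1 - p) * le) * V (Suc i, 0))"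
    unfolding nn_integral_step[of \<tau>, OF assms(1)]
    using nn assms(2,3) by (simp add: ennreal_mult[symmetric] ennreal_plus[symmetric] add.assoc del: ennreal_plus)
  also have "\<dots> \<le> ennreal (V (i, j))" by (intro ennreal_leI assms(4))
  finally show ?thesis .
qed

text \<open>The policy may idle below row \<open>N\<close>, but each such step raises the sensor's
  holding time. So the potential decreases in that coordinate up to the cap, after which every step
  is a trial with success probability \<open>p * le\<close>.\<close>

lemma saturated_recurrent:
  assumes \<tau>: "\<And>i j. \<tau> i j \<in> {0..1}" and sat: "saturated N \<tau>"
  shows "mass (cycle_visits (step \<tau>) z) < \<infinity>"
proof -
  \<comment> \<open>Chosen so that \<open>p * (le * F) = 1 + p * N\<close>, which makes the drift
    exact from row \<open>N\<close> on; below, \<open>i + 1 \<le> le * F\<close> suffices.\<close>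
  define F where "F = (1 / p + real N) / le"
  define V where "V = (\<lambda>(i::nat, j::nat). F - real (min i N))"
  have leF: "le * F = 1 / p + real N" using le0 by (simp add: F_def)
  have "1 / p + real N \<le> F" unfolding F_def using p0 le0 le1 by (simp add: le_divide_eq mult_left_le)
  moreover have "0 \<le> 1 / p" using p0 by simp
  ultimately have FN: "real N \<le> F" by linarith
  have V0: "0 \<le> V y" for y
    using FN by (cases y) (auto simp: V_def min_def)
  have key: "1 + (\<tau> i j * ((1 - p) * (1 - le)) + (1 - \<tau> i j)) * V (Suc i, Suc j) +
      \<tau> i j * (p * (1 - le)) * V (0, Suc j) + \<tau> i j * ((1 - p) * le) * V (Suc i, 0) \<le> V (i, j)" for i j
  proof (cases "i < N")
    case True
    then have V: "V (Suc i, b) = F - real i - 1" "V (0, b) = F" "V (i, b) = F - real i" for b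
      by (auto simp: V_def)
    have "real i + 1 \<le> le * F"
      unfolding leF using True p0 by (simp add: add_increasing)
    then have "\<tau> i j * (p * (real i + 1)) \<le> \<tau> i j * (p * (le * F))"
      using \<tau>[of i j] p0 by (intro mult_left_mono) auto
    then show ?thesis unfolding V by (simp add: algebra_simps)
  next
    case False
    then have V: "V (Suc i, b) = F - real N" "V (i, b) = F - real N" for b
      by (auto simp: V_def)
    have V0: "V (0, Suc j) = F" by (simp add: V_def)
    have \<tau>1: "\<tau> i j = 1" using sat False by (auto simp: saturated_def)
    have "p * (le * F) = 1 + p * real N" unfolding leF using p0 by (cases "l = 0"; cases "la = 0") (simp_all add: distrib_left)
    then show ?thesis unfolding V V0 \<tau>1 by (simp add: algebra_simps)
  qed
  have "mass (\<lambda>x. cycle_visits (step \<tau>) z x * 1) \<le> mass (\<lambda>x. indicator {z} x * ennreal (V x))"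
  proof (rule visits_lyapunov)
    fix x :: "nat \<times> nat"
    show "1 + (\<integral>\<^sup>+y. (if y = z then 0 else ennreal (V y)) \<partial>step \<tau> x) \<le> ennreal (V x)"
      using lyapunov_step_real[of \<tau> "fst x" "snd x" V 1, OF \<tau> V0 _ key] by simp
  qed
  then show ?thesis by (simp add: mass_indicator_mult le_less_trans)
qed

lemma saturated_ex1_stationary:
  assumes \<tau>: "\<And>i j. \<tau> i j \<in> {0..1}" and sat: "saturated N \<tau>"
  shows "\<exists>!\<pi>. stationary (step \<tau>) \<pi>"
  using ex_stationary[OF saturated_recurrent[OF \<tau> sat]] stationary_unique[OF _ _ rigid_step[of \<tau>, OF \<tau>]]
  by blast

abbreviation alive :: "(nat \<Rightarrow> nat \<Rightarrow> real) \<Rightarrow> nat \<Rightarrow> nat \<times> nat \<Rightarrow> ennreal" where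
  "alive \<tau> \<equiv> killed (step \<tau>) z (indicator {z})"

text \<open>A holding time grows by at most one per step; this is where the age of a cycle bounds
  the position.\<close>

lemma killed_support:
  "k < i \<or> k < j \<Longrightarrow> alive \<tau> k (i, j) = 0" if \<tau>: "\<And>i j. \<tau> i j \<in> {0..1}" for \<tau>
proof (induction k arbitrary: i j)
  case (Suc k)
  have "alive \<tau> k x * ennreal (pmf (step \<tau> x) (i, j)) = 0" for x
  proof (rule ccontr)
    obtain a b where x: "x = (a, b)" by (cases x)
    assume "alive \<tau> k x * ennreal (pmf (step \<tau> x) (i, j)) \<noteq> 0"
    then have *: "alive \<tau> k (a, b) \<noteq> 0" "pmf (step \<tau> (a, b)) (i, j) \<noteq> 0"
      by (auto simp: x)
    have "a \<le> k" "b \<le> k" using Suc.IH[of a b] *(1) by (meson not_less)+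
    moreover have "i \<le> Suc a \<and> j \<le> Suc b"
    proof (rule ccontr)
      assume "\<not> (i \<le> Suc a \<and> j \<le> Suc b)"
      then have "i \<noteq> Suc a \<and> i \<noteq> 0 \<or> j \<noteq> Suc b \<and> j \<noteq> 0" by auto
      then show False
        using *(2) pmf_kern[of \<tau> a b id "(i, j)", OF \<tau>] by (auto simp: kern_id mdp_trans_def)
    qed
    ultimately show False using Suc.prems by linarith
  qed
  then have "push (step \<tau>) (alive \<tau> k) (i, j) = 0"
    unfolding push_def by (simp only: nn_integral_const) simp
  then show ?case by simp
qed (auto simp: indicator_def)

text \<open>At a fixed age only finitely many states carry mass, so a finite-valued cost has finite
  expectation there even when its stationary cost is infinite.\<close>

lemma killed_finite_mult:
  assumes \<tau>: "\<And>i j. \<tau> i j \<in> {0..1}" and g: "\<And>j. g j < (\<infinity>::ennreal)"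
  shows "mass (\<lambda>x. alive \<tau> k x * g (snd x)) < \<infinity>"
proof -
  have fin: "finite {x :: nat \<times> nat. fst x \<le> k \<and> snd x \<le> k}"
    by (rule finite_subset[of _ "{..k} \<times> {..k}"]) auto
  have le1: "alive \<tau> k x \<le> 1" for x
  proof -
    have "mass (alive \<tau> k) \<le> 1"
    proof (induction k)
      case 0
      show ?case using mass_indicator_mult[of z "\<lambda>_. 1"] by simp
    next
      case (Suc k)
      have "mass (alive \<tau> (Suc k)) \<le> mass (push (step \<tau>) (alive \<tau> k))"
        by (intro nn_integral_mono) auto
      then show ?case using Suc by (simp add: mass_push)
    qed
    moreover have "alive \<tau> k x \<le> mass (alive \<tau> k)"
      using mass_split[of "alive \<tau> k" x] by (simp add: le_iff_add)
    ultimately show ?thesis by (rule order_trans[rotated])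
  qed
  then have "alive \<tau> k x * g (snd x) < \<infinity>" for x
    using g[of "snd x"] le_less_trans[OF le1[of x] ennreal_one_less_top] by (auto simp: ennreal_mult_less_top)
  then show ?thesis
    using killed_support[of \<tau> k, OF \<tau>]
    by (subst nn_integral_count_space'[OF fin]) (auto simp: not_le fin)
qed

end

subsection \<open>Truncating a cycle\<close>

text \<open>Two measures of masses \<open>Z\<close> and \<open>U\<close> differ by removing
  \<open>r\<close> and adding \<open>v\<close>. The same two terms control the difference of the
  masses, whence the factor 2; cancelling \<open>Z\<close> is harmless because it is at least
  1.\<close>

lemma l1_bound:
  fixes Z U :: real and r v :: "'s \<Rightarrow> ennreal"
  assumes eq: "\<And>x. ennreal Z * ennreal (pmf q' x) + r x = ennreal U * ennreal (pmf q x) + v x"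
    and Z: "1 \<le> Z" and U: "0 \<le> U" and fin: "mass r < \<infinity>" "mass v < \<infinity>"
  shows "l1 q' q \<le> 2 * (mass r + mass v)"
proof -
  have rv_fin: "r x < \<infinity>" "v x < \<infinity>" for x
    using fin mass_split[of r x] mass_split[of v x] by (auto simp: less_top)
  define R where "R = enn2real (mass r)"
  define M where "M = enn2real (mass v)"
  define r' where "r' x = enn2real (r x)" for x
  define v' where "v' x = enn2real (v x)" for x
  have RM: "mass r = ennreal R" "mass v = ennreal M" "0 \<le> R" "0 \<le> M"
    using fin by (simp_all add: R_def M_def)
  have rv: "r x = ennreal (r' x)" "v x = ennreal (v' x)" "0 \<le> r' x" "0 \<le> v' x" for x
    using rv_fin[of x] by (simp_all add: r'_def v'_def)
  have eqr: "Z * pmf q' x + r' x = U * pmf q x + v' x" for x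
  proof -
    have "ennreal (Z * pmf q' x + r' x) = ennreal (U * pmf q x + v' x)"
      using eq[of x] Z U rv[of x] by (simp add: ennreal_mult ennreal_plus)
    then show ?thesis using Z U rv[of x] by (subst (asm) ennreal_inj) auto
  qed
  have "ennreal (Z + R) = mass (\<lambda>x. ennreal Z * ennreal (pmf q' x) + r x)"
    using Z RM by (simp add: nn_integral_add nn_integral_cmult mass_pmf ennreal_plus)
  also have "\<dots> = ennreal (U + M)"
    unfolding eq using U RM by (simp add: nn_integral_add nn_integral_cmult mass_pmf ennreal_plus)
  finally have tot: "Z + R = U + M" using Z U RM by (subst (asm) ennreal_inj) auto
  have point: "\<bar>pmf q' x - pmf q x\<bar> \<le> (R + M) * pmf q x + r' x + v' x" for x
  proof -
    have "Z * (pmf q' x - pmf q x) = (U - Z) * pmf q x + v' x - r' x"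
      using eqr[of x] by (simp add: algebra_simps)
    then have "Z * \<bar>pmf q' x - pmf q x\<bar> = \<bar>(U - Z) * pmf q x + v' x - r' x\<bar>"
      using Z by (metis abs_mult abs_of_nonneg order_trans zero_le_one)
    also have "\<dots> \<le> \<bar>U - Z\<bar> * pmf q x + v' x + r' x"
      using rv[of x] abs_mult[of "U - Z" "pmf q x"] by (simp add: pmf_nonneg)
    also have "\<bar>U - Z\<bar> * pmf q x \<le> (R + M) * pmf q x"
      using tot RM by (intro mult_right_mono) (auto simp: pmf_nonneg)
    finally have "Z * \<bar>pmf q' x - pmf q x\<bar> \<le> (R + M) * pmf q x + v' x + r' x" by simp
    moreover have "1 * \<bar>pmf q' x - pmf q x\<bar> \<le> Z * \<bar>pmf q' x - pmf q x\<bar>"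
      using Z by (intro mult_right_mono) auto
    ultimately show ?thesis by simp
  qed
  have "l1 q' q \<le> mass (\<lambda>x. ennreal (R + M) * ennreal (pmf q x) + r x + v x)"
    unfolding l1_def
  proof (intro nn_integral_mono)
    fix x
    have "ennreal \<bar>pmf q' x - pmf q x\<bar> \<le> ennreal ((R + M) * pmf q x + r' x + v' x)"
      by (intro ennreal_leI point)
    also have "\<dots> = ennreal (R + M) * ennreal (pmf q x) + r x + v x"
      unfolding rv(1,2)[of x] using RM(3,4) rv(3,4)[of x] pmf_nonneg[of q x]
      by (simp add: ennreal_mult mult_nonneg_nonneg add_nonneg_nonneg del: pmf_nonneg)
    finally show "ennreal \<bar>pmf q' x - pmf q x\<bar> \<le> ennreal (R + M) * ennreal (pmf q x) + r x + v x" .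
  qed
  also have "\<dots> = ennreal (R + M) + mass r + mass v"
    by (simp add: nn_integral_add nn_integral_cmult mass_pmf)
  also have "\<dots> = 2 * (mass r + mass v)"
    unfolding RM(1,2) mult_2 using RM(3,4) by (simp add: add.assoc)
  finally show ?thesis .
qed

text \<open>All that the remaining argument knows about the linear system: finite costs that grow
  more slowly than the tail of the time between receptions by the eavesdropper decays.\<close>

locale priced_channel = lossy_channel +
  fixes c :: "nat \<Rightarrow> ennreal" and s G :: real
  assumes s1: "1 < s" and s_le: "s * (1 - le) < 1" and G0: "0 < G"
    and c_fin: "\<And>j. c j < \<infinity>"
    and growth: "\<And>j m. c (j + m) \<le> ennreal (G * s ^ m) * (1 + c j)"
begin

text \<open>Expected cost, plus elapsed time, until the next reception by the eavesdropper when the sensor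
  always sends.\<close>

definition W :: "nat \<Rightarrow> ennreal" where
  "W j = (\<Sum>m. ennreal ((1 - le) ^ m) * (1 + c (j + m)))"

lemma W_unfold: "W j = 1 + c j + ennreal (1 - le) * W (Suc j)"
proof -
  have "W j = 1 + c j + (\<Sum>m. ennreal ((1 - le) ^ Suc m) * (1 + c (j + Suc m)))"
    unfolding W_def by (subst suminf_offset[where i = 1]) (auto simp: summableI)
  also have "(\<Sum>m. ennreal ((1 - le) ^ Suc m) * (1 + c (j + Suc m))) = ennreal (1 - le) * W (Suc j)"
    unfolding W_def ennreal_suminf_cmult[symmetric]
    using le1 by (intro suminf_cong) (simp add: ennreal_mult mult.assoc)
  finally show ?thesis .
qed

lemma W_le: "W j \<le> ennreal ((1 + G) / (1 - (1 - le) * s)) * (1 + c j)"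
proof -
  have bound: "ennreal ((1 - le) ^ m) * (1 + c (j + m)) \<le> ennreal ((1 + G) * ((1 - le) * s) ^ m) * (1 + c j)" for m
  proof -
    have "1 + c (j + m) \<le> ennreal (s ^ m) * (1 + c j) + ennreal (G * s ^ m) * (1 + c j)"
    proof (intro add_mono growth)
      have "1 \<le> ennreal (s ^ m)" using s1 by simp
      then show "1 \<le> ennreal (s ^ m) * (1 + c j)"
        by (metis le_iff_add mult.right_neutral mult_mono zero_le)
    qed
    also have "\<dots> = ennreal ((1 + G) * s ^ m) * (1 + c j)"
      using s1 G0 by (simp add: distrib_right[symmetric] ennreal_plus[symmetric] del: ennreal_plus)
        (simp add: algebra_simps)
    finally have "ennreal ((1 - le) ^ m) * (1 + c (j + m)) \<le> ennreal ((1 - le) ^ m) * (ennreal ((1 + G) * s ^ m) * (1 + c j))"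
      by (intro mult_left_mono) auto
    also have "\<dots> = ennreal ((1 + G) * ((1 - le) * s) ^ m) * (1 + c j)"
      using le1 s1 G0 by (simp add: mult.assoc[symmetric] ennreal_mult[symmetric] power_mult_distrib)
        (simp add: algebra_simps)
    finally show ?thesis .
  qed
  have ratio: "0 \<le> (1 - le) * s" "(1 - le) * s < 1" using le1 s1 s_le by (auto simp: mult.commute)
  have "W j \<le> (\<Sum>m. ennreal ((1 + G) * ((1 - le) * s) ^ m) * (1 + c j))"
    unfolding W_def by (intro suminf_le bound summableI)
  also have "\<dots> = (\<Sum>m. ennreal ((1 + G) * ((1 - le) * s) ^ m)) * (1 + c j)"
    by (rule ennreal_suminf_multc)
  also have "(\<Sum>m. ennreal ((1 + G) * ((1 - le) * s) ^ m)) = ennreal (\<Sum>m. (1 + G) * ((1 - le) * s) ^ m)"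
    using ratio G0 by (intro suminf_ennreal2 summable_mult summable_geometric) auto
  also have "(\<Sum>m. (1 + G) * ((1 - le) * s) ^ m) = (1 + G) / (1 - (1 - le) * s)"
    using ratio by (subst suminf_mult) (auto intro!: summable_geometric simp: suminf_geometric)
  finally show ?thesis .
qed

lemma W_fin: "W j < \<infinity>"
  using W_le[of j] c_fin[of j] by (auto simp: ennreal_mult_less_top intro: le_less_trans)

text \<open>Sending until both holding times vanish may take several receptions by the eavesdropper.
  The potential is the cost \<open>w j\<close> up to the next reception plus a constant for further
  rounds, which all start with eavesdropper time 0.\<close>

lemma drain_cost:
  "\<exists>D. \<forall>h. mass (\<lambda>x. visits (act True) z h x * (1 + c (snd x))) \<le> ennreal D * mass (\<lambda>x. h x * (1 + c (snd x)))"
proof -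
  define w where "w j = enn2real (W j)" for j
  define cr where "cr j = enn2real (c j)" for j
  have Ww: "W j = ennreal (w j)" and cw: "c j = ennreal (cr j)" and w0: "0 \<le> w j" and c0: "0 \<le> cr j" for j
    using W_fin[of j] c_fin[of j] by (simp_all add: w_def cr_def)
  have w_unfold: "w j = 1 + cr j + (1 - le) * w (Suc j)" for j
  proof -
    have "ennreal (w j) = ennreal (1 + cr j + (1 - le) * w (Suc j))"
      using W_unfold[of j] c0[of j] w0[of "Suc j"] le1 unfolding Ww cw
      by (simp add: ennreal_mult ennreal_plus)
    then show ?thesis using w0 c0 le1 by (subst (asm) ennreal_inj) auto
  qed
  \<comment> \<open>A reception comes without acknowledgement with probability \<open>1 - p\<close>,
    so \<open>(1 - p) / p\<close> extra rounds are expected, each costing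
    \<open>w 0\<close>.\<close>
  define B where "B = (1 - p) * w 0 / p"
  have B0: "0 \<le> B" using p0 p1 w0 by (simp add: B_def)
  define V where "V x = w (snd x) + B" for x :: "nat \<times> nat"
  have V0: "0 \<le> V y" for y using w0 B0 by (simp add: V_def)
  define K where "K = (1 + G) / (1 - (1 - le) * s)"
  have K0: "0 \<le> K" using G0 s_le by (simp add: K_def mult.commute)
  have lyap: "1 + c (snd x) + (\<integral>\<^sup>+y. (if y = z then 0 else ennreal (V y)) \<partial>act True x) \<le> ennreal (V x)" for x
  proof -
    obtain i j where x: "x = (i, j)" by (cases x)
    have e: "p * le * B = (1 - p) * le * w 0" using p0 by (cases "l = 0"; cases "la = 0") (simp_all add: B_def)
    have "(1 + cr j) + (of_bool True * ((1 - p) * (1 - le)) + (1 - of_bool True)) * V (Suc i, Suc j) +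
      of_bool True * (p * (1 - le)) * V (0, Suc j) + of_bool True * ((1 - p) * le) * V (Suc i, 0) \<le> V (i, j)"
      unfolding V_def by (simp add: w_unfold[of j], simp add: algebra_simps, insert e, simp only: algebra_simps)
    from lyapunov_step_real[of "\<lambda>_ _. of_bool True" i j V "1 + cr j", OF _ V0 _ this]
    show ?thesis using c0[of j] by (simp add: x cw)
  qed
  have "mass (\<lambda>x. visits (act True) z h x * (1 + c (snd x))) \<le> ennreal (K + B) * mass (\<lambda>x. h x * (1 + c (snd x)))" for h
  proof -
    have "mass (\<lambda>x. visits (act True) z h x * (1 + c (snd x))) \<le> mass (\<lambda>x. h x * ennreal (V x))"
      by (rule visits_lyapunov[OF lyap])
    also have "\<dots> \<le> mass (\<lambda>x. ennreal (K + B) * (h x * (1 + c (snd x))))"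
    proof (intro nn_integral_mono)
      fix x
      have "ennreal (V x) = W (snd x) + ennreal B" using w0 B0 by (simp add: V_def Ww)
      also have "\<dots> \<le> ennreal K * (1 + c (snd x)) + ennreal B * (1 + c (snd x))"
        using mult_left_mono[of 1 "1 + c (snd x)" "ennreal B"]
        by (intro add_mono) (auto simp: K_def W_le)
      also have "\<dots> = ennreal (K + B) * (1 + c (snd x))" using K0 B0 by (simp add: distrib_right)
      finally have "h x * ennreal (V x) \<le> h x * (ennreal (K + B) * (1 + c (snd x)))"
        by (intro mult_left_mono) auto
      then show "h x * ennreal (V x) \<le> ennreal (K + B) * (h x * (1 + c (snd x)))"
        by (simp add: mult.left_commute)
    qed
    finally show ?thesis by (simp add: nn_integral_cmult)
  qed
  then show ?thesis by blast
qed

text \<open>Each transmission ends the cycle with probability \<open>p * le\<close>, whatever the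
  state, so the duration is geometric and a constant potential does.\<close>

lemma drain_mass: "mass (visits (act True) z h) \<le> ennreal (1 / (p * le)) * mass h"
proof -
  define K where "K = 1 / (p * le)"
  have e: "p * le * K = 1" and K0: "0 \<le> K"
    using p0 le0 by (cases "l = 0"; cases "la = 0"; simp add: K_def)+
  have "mass (\<lambda>x. visits (act True) z h x * 1) \<le> mass (\<lambda>x. h x * ennreal K)"
  proof (rule visits_lyapunov)
    fix x :: "nat \<times> nat"
    obtain i j where x: "x = (i, j)" by (cases x)
    have "1 + (of_bool True * ((1 - p) * (1 - le)) + (1 - of_bool True)) * K +
      of_bool True * (p * (1 - le)) * K + of_bool True * ((1 - p) * le) * K \<le> K"
      by (simp, simp add: algebra_simps, insert e, simp only: algebra_simps)
    from lyapunov_step_real[of "\<lambda>_ _. of_bool True" i j "\<lambda>_. K" 1, OF _ _ _ this] K0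
    show "1 + (\<integral>\<^sup>+y. (if y = z then 0 else ennreal K) \<partial>act True x) \<le> ennreal K"
      by (simp add: x)
  qed
  then show ?thesis by (simp add: nn_integral_multc mult.commute K_def)
qed

definition cost :: "(nat \<times> nat \<times> bool) pmf \<Rightarrow> ennreal" where
  "cost q = (\<integral>\<^sup>+(i, j, a). c j \<partial>q)"

lemma cost_occ_of: "cost (occ_of \<pi> \<tau>) = (\<integral>\<^sup>+x. c (snd x) \<partial>\<pi>)"
proof -
  have "cost (occ_of \<pi> \<tau>) = (\<integral>\<^sup>+x. c (snd x) \<partial>map_pmf state_of (occ_of \<pi> \<tau>))"
    by (simp add: cost_def state_of_def case_prod_beta')
  then show ?thesis by (simp only: map_state_of_occ_of)
qed

lemma pmf_step_act:
  assumes "\<tau> i j \<in> {0..1}"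
  shows "pmf (step \<tau> (i, j)) y = \<tau> i j * pmf (act True (i, j)) y + (1 - \<tau> i j) * pmf (act False (i, j)) y"
  unfolding step_eq_bind[of \<tau>] by (rule pmf_bind_bernoulli[OF assms])

text \<open>Follow \<open>\<tau>\<close> for the first \<open>N\<close> steps of a cycle and then send until both holding times vanish.
  Within \<open>N\<close> steps the holding times stay below \<open>N\<close>, so the normalised occupation measure of such
  a cycle idles only inside the truncation square. The policy depends on the elapsed time, but
  its occupation measure still satisfies the flow balance.\<close>

lemma truncated_occupation:
  assumes \<tau>: "\<And>i j. \<tau> i j \<in> {0..1}" and st: "stationary (step \<tau>) \<pi>"
  shows "\<exists>q. (\<forall>N. balanced id (q N) \<and> idle_free N (q N) \<and> cost (q N) < \<infinity>) \<and>
    (\<lambda>N. l1 (q N) (occ_of \<pi> \<tau>)) \<longlonglongrightarrow> 0 \<and>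
    (cost (occ_of \<pi> \<tau>) < \<infinity> \<longrightarrow> (\<exists>B. B \<longlonglongrightarrow> enn2real (cost (occ_of \<pi> \<tau>)) \<and>
       (\<forall>N\<ge>1. enn2real (cost (q N)) \<le> B N)))"
proof -
  define t where "t = alive \<tau>"
  define u where "u = cycle_visits (step \<tau>) z"
  \<comment> \<open>Mean cycle length, by Kac's formula.\<close>
  define U where "U = 1 / pmf \<pi> z"
  note cyc = stationary_eq_cycle[OF st rigid_step[of \<tau>, OF \<tau>]]
  have U: "0 \<le> U" using cyc(1) by (simp add: U_def)
  have mass_u: "mass u = ennreal U"
    using cyc(1,3) by (simp add: u_def U_def inverse_ennreal divide_inverse)
  have u_eq: "u x = ennreal U * ennreal (pmf \<pi> x)" for x
    using cyc(1) unfolding cyc(2)[of x] u_def[symmetric] mult.assoc[symmetric]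
    by (simp add: U_def ennreal_mult[symmetric])
  define a where "a = (\<lambda>(i, j, b). ennreal (if b then \<tau> i j else 1 - \<tau> i j))"
  have a_sum: "a (i, j, True) + a (i, j, False) = 1" for i j
    using \<tau>[of i j] by (simp add: a_def ennreal_plus[symmetric] del: ennreal_plus)
  have mass_a: "mass (\<lambda>(i, j, b). m (i, j) * a (i, j, b)) = mass m" for m
    by (subst mass_state_action) (simp add: distrib_left[symmetric] a_sum)
  \<comment> \<open>Phase one follows \<open>\<tau>\<close> up to age \<open>N\<close>;
    \<open>rN\<close> is the part of the original cycle that is cut off, and \<open>vN\<close> the
    sending phase started from the survivors at age \<open>N\<close>.\<close>
  define uN where "uN N x = (\<Sum>k<N. t k x)" for N x
  define rN where "rN N x = (\<Sum>k. t (k + N) x)" for N x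
  define vN where "vN N = visits (act True) z (t N)" for N
  have u_split: "u x = uN N x + rN N x" for N x
    unfolding u_def visits_def uN_def rN_def t_def by (subst suminf_offset[where i = N]) (auto simp: summableI add.commute)
  have uN_le: "mass (uN N) \<le> ennreal U" for N
    unfolding mass_u[symmetric] by (intro nn_integral_mono) (simp add: u_split[of _ N])
  have mass_uN: "mass (uN N) = (\<Sum>k<N. mass (t k))" for N
    unfolding uN_def by (simp add: nn_integral_sum)
  have suminf_t: "(\<Sum>k. mass (t k)) = ennreal U"
    unfolding mass_u[symmetric] u_def visits_def t_def by (rule nn_integral_suminf[symmetric]) auto
  have mass_rN: "mass (rN N) = (\<Sum>k. mass (t (k + N)))" for N
    unfolding rN_def by (rule nn_integral_suminf) auto
  have t_fin: "mass (t k) < \<infinity>" for k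
    using sum_le_suminf[OF summableI, of "{k}" "\<lambda>k. mass (t k)"] suminf_t
    by (auto intro: le_less_trans)
  have vN_le: "mass (vN N) \<le> ennreal (1 / (p * le)) * mass (t N)" for N
    unfolding vN_def by (rule drain_mass)
  have vN_fin: "mass (vN N) < \<infinity>" for N
    using vN_le[of N] t_fin[of N] by (auto simp: ennreal_mult_less_top intro: le_less_trans)
  define v where "v N = (\<lambda>(i, j, b). if b then vN N (i, j) else 0)" for N
  define f where "f N x = (case x of (i, j, b) \<Rightarrow> uN N (i, j) * a (i, j, b)) + v N x" for N x
  have mass_v: "mass (v N) = mass (vN N)" for N
    by (subst mass_state_action) (simp add: v_def)
  define Z where "Z N = mass (uN N) + mass (vN N)" for N
  have mass_f: "mass (f N) = Z N" for N
    unfolding f_def by (simp add: nn_integral_add mass_a mass_v Z_def)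
  have Z_fin: "Z N < \<infinity>" for N
    using uN_le[of N] vN_fin[of N] by (auto simp: Z_def intro: le_less_trans)
  \<comment> \<open>A cycle visits \<open>z\<close> once, at its start; for \<open>N = 0\<close>
    that visit belongs to the sending phase. This bounds the normaliser \<open>Z N\<close> below by
    1.\<close>
  have w_z: "uN N z + vN N z = 1" for N
  proof -
    have "uN N z + vN N z = (\<Sum>k<Suc N. t k z)"
      unfolding vN_def by (subst visits_unfold) (simp add: uN_def)
    also have "\<dots> = 1" by (subst sum.lessThan_Suc_shift) (simp add: t_def)
    finally show ?thesis .
  qed
  have Z1: "1 \<le> Z N" for N
  proof -
    have "uN N z \<le> mass (uN N)" "vN N z \<le> mass (vN N)"
      using mass_split[of "uN N" z] mass_split[of "vN N" z] by (simp_all add: le_iff_add)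
    then show ?thesis unfolding Z_def w_z[of N, symmetric] by (rule add_mono)
  qed
  then have Z0: "0 < Z N" for N by (rule less_le_trans[rotated]) simp
  have "\<exists>q. \<forall>x. ennreal (pmf q x) = f N x / Z N" for N
    using ex_normalized_pmf[of "f N"] Z0[of N] Z_fin[of N] by (simp add: mass_f)
  then obtain q where q: "\<And>N x. ennreal (pmf (q N) x) = f N x / Z N" by metis

  \<comment> \<open>Off \<open>z\<close>, the mass \<open>t N\<close> leaves phase one and enters
    phase two, so it cancels; at \<open>z\<close>, conservation of mass decides.\<close>
  have balance: "push (step \<tau>) (uN N) y + push (act True) (vN N) y = uN N y + vN N y" for N y
  proof (rule balance_at_point[where z = z])
    have "mass (\<lambda>y. push (step \<tau>) (uN N) y + push (act True) (vN N) y) = Z N"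
      by (simp add: nn_integral_add mass_push Z_def)
    moreover have "mass (\<lambda>y. uN N y + vN N y) = Z N" by (simp add: nn_integral_add Z_def)
    ultimately show "mass (\<lambda>y. push (step \<tau>) (uN N) y + push (act True) (vN N) y) = mass (\<lambda>y. uN N y + vN N y)"
      "mass (\<lambda>y. push (step \<tau>) (uN N) y + push (act True) (vN N) y) < \<infinity>"
      using Z_fin[of N] by simp_all
    fix y :: "nat \<times> nat" assume y: "y \<noteq> z"
    have "push (step \<tau>) (uN N) y = (\<Sum>k<N. t (Suc k) y)"
      unfolding uN_def push_sum using y by (simp add: t_def)
    also have "\<dots> = (\<Sum>k<Suc N. t k y)"
      using y by (subst sum.lessThan_Suc_shift) (simp add: t_def)
    finally have "push (step \<tau>) (uN N) y = uN N y + t N y" by (simp add: uN_def)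
    moreover have "vN N y = t N y + push (act True) (vN N) y"
      using y unfolding vN_def by (subst visits_unfold) simp
    ultimately show "push (step \<tau>) (uN N) y + push (act True) (vN N) y = uN N y + vN N y"
      by (simp add: add.assoc)
  qed
  have "balanced id (q N)" for N
    unfolding balanced_def
  proof (rule pmf_eqI)
    fix y :: "nat \<times> nat"
    obtain i j where y: "y = (i, j)" by (cases y)
    have "ennreal (pmf (bind_pmf (q N) (\<lambda>(i, j, b). map_pmf (cap2 id) (act b (i, j)))) y)
        = mass (\<lambda>x. f N x / Z N * ennreal (pmf (case x of (i, j, b) \<Rightarrow> act b (i, j)) y))"
      unfolding ennreal_pmf_bind nn_integral_measure_pmf_mass q
      by (intro nn_integral_cong) (auto simp: cap2_def prod.map_id0 split: prod.split)
    also have "\<dots> = mass (\<lambda>x. (f N x * ennreal (pmf (case x of (i, j, b) \<Rightarrow> act b (i, j)) y)) / Z N)"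
      by (simp add: divide_ennreal_def mult.assoc mult.left_commute mult.commute)
    also have "\<dots> = mass (\<lambda>x. f N x * ennreal (pmf (case x of (i, j, b) \<Rightarrow> act b (i, j)) y)) / Z N"
      by (simp add: nn_integral_divide)
    also have "mass (\<lambda>x. f N x * ennreal (pmf (case x of (i, j, b) \<Rightarrow> act b (i, j)) y))
        = mass (\<lambda>x. uN N x * ennreal (pmf (step \<tau> x) y) + vN N x * ennreal (pmf (act True x) y))"
    proof (subst mass_state_action, intro nn_integral_cong)
      fix x :: "nat \<times> nat"
      obtain k m where x: "x = (k, m)" by (cases x)
      have "ennreal (pmf (step \<tau> x) y) = a (k, m, True) * ennreal (pmf (act True x) y) + a (k, m, False) * ennreal (pmf (act False x) y)"
        using \<tau>[of k m] unfolding x pmf_step_act[of \<tau>, OF \<tau>[of k m]]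
        by (simp add: a_def ennreal_mult pmf_nonneg mult_nonneg_nonneg)
      then show "(case x of (k, m) \<Rightarrow>
            f N (k, m, True) * ennreal (pmf (case (k, m, True) of (i, j, b) \<Rightarrow> act b (i, j)) y) +
            f N (k, m, False) * ennreal (pmf (case (k, m, False) of (i, j, b) \<Rightarrow> act b (i, j)) y))
          = uN N x * ennreal (pmf (step \<tau> x) y) + vN N x * ennreal (pmf (act True x) y)"
        by (simp add: x f_def v_def algebra_simps)
    qed
    also have "\<dots> = uN N y + vN N y"
      using balance[of N y] by (simp add: push_def nn_integral_add)
    finally have "ennreal (pmf (bind_pmf (q N) (\<lambda>(i, j, b). map_pmf (cap2 id) (act b (i, j)))) y)
        = (uN N y + vN N y) / Z N" .
    moreover have "ennreal (pmf (map_pmf state_of (q N)) y) = (uN N y + vN N y) / Z N"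
    proof -
      have "f N (i, j, True) + f N (i, j, False) = uN N y * (a (i, j, True) + a (i, j, False)) + vN N y"
        by (simp add: f_def v_def y algebra_simps)
      then show ?thesis unfolding y pmf_map_state_of
        by (simp add: pmf_nonneg q a_sum add_divide_distrib_ennreal[symmetric] y)
    qed
    ultimately show "pmf (map_pmf state_of (q N)) y
        = pmf (bind_pmf (q N) (\<lambda>(i, j, b). map_pmf (cap2 id) (act b (i, j)))) y"
      by (metis ennreal_inj pmf_nonneg)
  qed
  moreover have "idle_free N (q N)" for N
    unfolding idle_free_def
  proof (intro allI impI)
    fix i j assume ij: "N \<le> i \<or> N \<le> j"
    have "uN N (i, j) = 0"
      unfolding uN_def t_def using ij by (intro sum.neutral ballI killed_support[of \<tau>, OF \<tau>]) auto
    then have "ennreal (pmf (q N) (i, j, False)) = 0" by (simp add: q f_def v_def)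
    then show "pmf (q N) (i, j, False) = 0" by (simp add: pmf_nonneg order.antisym)
  qed
  moreover have cost_q: "cost (q N) * Z N = mass (\<lambda>x. uN N x * c (snd x)) + mass (\<lambda>x. vN N x * c (snd x))" for N
  proof -
    have "cost (q N) = mass (\<lambda>x. (f N x * c (fst (snd x))) / Z N)"
      unfolding cost_def nn_integral_measure_pmf_mass q
      by (intro nn_integral_cong) (auto simp: divide_ennreal_def mult.assoc mult.left_commute mult.commute split: prod.split)
    also have "\<dots> = mass (\<lambda>x. f N x * c (fst (snd x))) / Z N" by (simp add: nn_integral_divide)
    also have "mass (\<lambda>x. f N x * c (fst (snd x))) = mass (\<lambda>x. uN N x * c (snd x) + vN N x * c (snd x))"
    proof (subst mass_state_action, intro nn_integral_cong)
      fix x :: "nat \<times> nat"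
      obtain k m where x: "x = (k, m)" by (cases x)
      have "f N (k, m, True) * c m + f N (k, m, False) * c m = uN N x * (a (k, m, True) + a (k, m, False)) * c m + vN N x * c m"
        by (simp add: f_def v_def x algebra_simps)
      then show "(case x of (i, j) \<Rightarrow> f N (i, j, True) * c (fst (snd (i, j, True))) + f N (i, j, False) * c (fst (snd (i, j, False))))
          = uN N x * c (snd x) + vN N x * c (snd x)"
        by (simp add: x a_sum)
    qed
    finally have "cost (q N) = (mass (\<lambda>x. uN N x * c (snd x)) + mass (\<lambda>x. vN N x * c (snd x))) / Z N"
      by (simp add: nn_integral_add)
    then show ?thesis using Z0[of N] Z_fin[of N]
      by (simp add: ennreal_divide_times ennreal_mult_divide_eq)
  qed
  obtain D where D: "\<And>h. mass (\<lambda>x. visits (act True) z h x * (1 + c (snd x))) \<le> ennreal D * mass (\<lambda>x. h x * (1 + c (snd x)))"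
    using drain_cost by blast
  \<comment> \<open>Time and cost carried by the survivors at the hand-over. Summed over
    \<open>N\<close> this is the length plus the cost of a whole cycle, so \<open>X N\<close> tends
    to 0 when the stationary cost is finite.\<close>
  define X where "X N = mass (\<lambda>x. t N x * (1 + c (snd x)))" for N
  have X_fin: "X N < \<infinity>" for N
    unfolding X_def t_def using c_fin by (intro killed_finite_mult \<tau>) simp
  have vN_cost: "mass (\<lambda>x. vN N x * c (snd x)) \<le> ennreal D * X N" for N
  proof -
    have "mass (\<lambda>x. vN N x * c (snd x)) \<le> mass (\<lambda>x. vN N x * (1 + c (snd x)))"
      by (intro nn_integral_mono mult_left_mono) auto
    then show ?thesis using D[of "t N"] unfolding vN_def X_def by (rule order_trans)
  qed
  have "cost (q N) < \<infinity>" for N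
  proof -
    have "mass (\<lambda>x. uN N x * c (snd x)) = (\<Sum>k<N. mass (\<lambda>x. t k x * c (snd x)))"
      by (simp add: uN_def sum_distrib_right nn_integral_sum)
    also have "\<dots> < \<infinity>"
      using killed_finite_mult[of \<tau> c, OF \<tau> c_fin] by (simp add: t_def)
    finally have "cost (q N) * Z N < \<infinity>"
      using vN_cost[of N] X_fin[of N] unfolding cost_q by (auto simp: ennreal_mult_less_top intro: le_less_trans)
    then show ?thesis using Z0[of N] by (auto simp: ennreal_mult_less_top)
  qed
  moreover have "(\<lambda>N. l1 (q N) (occ_of \<pi> \<tau>)) \<longlonglongrightarrow> 0"
  proof (rule tendsto_sandwich[OF _ _ tendsto_const])
    \<comment> \<open>Compared with the original cycle, \<open>rN\<close> is removed and
      \<open>vN\<close> added. One is a tail, the other at most a multiple of a term, of the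
      convergent series of survival masses.\<close>
    have "l1 (q N) (occ_of \<pi> \<tau>) \<le> 2 * (mass (\<lambda>(i, j, b). rN N (i, j) * a (i, j, b)) + mass (v N))" for N
    proof (rule l1_bound[where Z = "enn2real (Z N)" and U = U])
      have Zr: "ennreal (enn2real (Z N)) = Z N" using Z_fin[of N] by simp
      show "ennreal (enn2real (Z N)) * ennreal (pmf (q N) x) + (case x of (i, j, b) \<Rightarrow> rN N (i, j) * a (i, j, b))
          = ennreal U * ennreal (pmf (occ_of \<pi> \<tau>) x) + v N x" for x
      proof -
        obtain i j b where x: "x = (i, j, b)" by (cases x) auto
        have "Z N * ennreal (pmf (q N) x) = f N x"
          using Z0[of N] Z_fin[of N] 
          unfolding q ennreal_times_divide mult.commute[of "Z N"] by (simp add: ennreal_mult_divide_eq)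
        moreover have "ennreal U * ennreal (pmf (occ_of \<pi> \<tau>) x) = u (i, j) * a (i, j, b)"
          unfolding x pmf_occ_of[of \<tau>, OF \<tau>] u_eq a_def using \<tau>[of i j]
          by (cases b) (simp_all add: ennreal_mult pmf_nonneg mult.assoc)
        ultimately show ?thesis unfolding Zr by (simp add: x f_def u_split[of "(i, j)" N] algebra_simps)
      qed
      show "1 \<le> enn2real (Z N)" using Z1[of N] Z_fin[of N]
        by (metis enn2real_1 enn2real_mono infinity_ennreal_def)
      have "mass (rN N) \<le> ennreal U" unfolding mass_u[symmetric] by (intro nn_integral_mono) (simp add: u_split[of _ N])
      then show "mass (\<lambda>(i, j, b). rN N (i, j) * a (i, j, b)) < \<infinity>" unfolding mass_a by (auto intro: le_less_trans)
      show "mass (v N) < \<infinity>" using vN_fin by (simp add: mass_v)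
    qed (rule U)
    then show "\<forall>\<^sub>F N in sequentially. l1 (q N) (occ_of \<pi> \<tau>)
        \<le> 2 * ((\<Sum>k. mass (t (k + N))) + ennreal (1 / (p * le)) * mass (t N))"
      unfolding mass_a mass_v mass_rN
      by (intro always_eventually allI) (meson add_left_mono mult_left_mono order_trans vN_le zero_le)
    have "(\<lambda>N. 2 * ((\<Sum>k. mass (t (k + N))) + ennreal (1 / (p * le)) * mass (t N)))
        \<longlonglongrightarrow> 2 * (0 + ennreal (1 / (p * le)) * 0)"
      using suminf_t by (intro ennreal_tendsto_cmult tendsto_add suminf_tail_tendsto_0 terms_tendsto_0) auto
    then show "(\<lambda>N. 2 * ((\<Sum>k. mass (t (k + N))) + ennreal (1 / (p * le)) * mass (t N))) \<longlonglongrightarrow> 0" by simp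
  qed auto
  moreover have "\<exists>B. B \<longlonglongrightarrow> enn2real (cost (occ_of \<pi> \<tau>)) \<and> (\<forall>N\<ge>1. enn2real (cost (q N)) \<le> B N)"
    if I_fin: "cost (occ_of \<pi> \<tau>) < \<infinity>"
  proof -
    define I where "I = cost (occ_of \<pi> \<tau>)"
    have mass_uc: "mass (\<lambda>x. u x * c (snd x)) = ennreal U * I"
      unfolding I_def cost_occ_of nn_integral_measure_pmf_mass u_eq
      by (simp add: mult.assoc nn_integral_cmult)
    have sumX: "(\<Sum>N. X N) < \<infinity>"
    proof -
      have "(\<Sum>N. X N) = mass (\<lambda>x. u x * (1 + c (snd x)))"
        unfolding X_def u_def t_def by (rule mass_visits_mult[symmetric])
      also have "\<dots> = ennreal U + ennreal U * I"
        by (simp add: distrib_left nn_integral_add mass_u mass_uc)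
      also have "\<dots> < \<infinity>" using I_fin by (simp add: I_def ennreal_mult_less_top)
      finally show ?thesis .
    qed
    define m where "m N = enn2real (mass (uN N))" for N
    \<comment> \<open>Dividing by the mass of phase one instead of \<open>Z N\<close> only enlarges
      the bound, and this mass tends to \<open>U\<close>. The real witness \<open>D\<close> may be
      negative, whence \<open>max 0 D\<close>. For \<open>N = 0\<close> phase one is empty, so the
      bound is claimed from 1 on.\<close>
    define B where "B N = (U * enn2real I + max 0 D * enn2real (X N)) / m N" for N
    have uN_fin: "mass (uN N) < \<infinity>" for N using uN_le[of N] by (auto intro: le_less_trans)
    have "(\<lambda>N. mass (uN N)) \<longlonglongrightarrow> ennreal U"
      unfolding mass_uN suminf_t[symmetric] by (intro summable_LIMSEQ summableI)
    then have m_lim: "m \<longlonglongrightarrow> U"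
      unfolding m_def[abs_def] using U by (intro tendsto_enn2real) auto
    have X_lim: "(\<lambda>N. enn2real (X N)) \<longlonglongrightarrow> 0"
      by (rule tendsto_enn2real) (use terms_tendsto_0[OF sumX] in auto)
    have U0: "U \<noteq> 0" using cyc(1) by (simp add: U_def)
    have "B \<longlonglongrightarrow> (U * enn2real I + max 0 D * 0) / U"
      unfolding B_def[abs_def] by (intro tendsto_intros m_lim X_lim U0)
    then have "B \<longlonglongrightarrow> enn2real I" using U0 by simp
    moreover have "enn2real (cost (q N)) \<le> B N" if "1 \<le> N" for N
    proof -
      have "1 \<le> mass (uN N)"
      proof -
        have "1 = t 0 z" by (simp add: t_def)
        also have "\<dots> \<le> uN N z" unfolding uN_def using that by (intro member_le_sum) auto
        also have "\<dots> \<le> mass (uN N)" using mass_split[of "uN N" z] by (simp add: le_iff_add)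
        finally show ?thesis .
      qed
      then have m1: "0 < m N" unfolding m_def using uN_fin[of N]
        by (metis enn2real_positive_iff ennreal_zero_less_one infinity_ennreal_def less_le_trans)
      have "cost (q N) * mass (uN N) \<le> cost (q N) * Z N"
        by (intro mult_left_mono) (auto simp: Z_def)
      also have "\<dots> \<le> ennreal U * I + ennreal D * X N"
        unfolding cost_q mass_uc[symmetric]
        by (intro add_mono vN_cost nn_integral_mono mult_right_mono) (auto simp: u_split[of _ N])
      also have "\<dots> = ennreal (U * enn2real I + max 0 D * enn2real (X N))"
        using I_fin X_fin[of N] U by (simp add: I_def ennreal_mult[symmetric] ennreal_plus ennreal_max_0 ennreal_enn2real_if ennreal_mult max_def ennreal_neg)
      finally have "enn2real (cost (q N) * mass (uN N)) \<le> U * enn2real I + max 0 D * enn2real (X N)"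
        using U by (intro enn2real_leI) auto
      then show ?thesis using m1 by (simp add: B_def enn2real_mult m_def pos_le_divide_eq)
    qed
    ultimately show ?thesis unfolding I_def by blast
  qed
  ultimately show ?thesis by blast
qed

end

subsection \<open>Capped occupation laws\<close>

definition cap_at :: "nat \<Rightarrow> nat \<Rightarrow> nat" where "cap_at N n = min n N"

definition cap_occ :: "nat \<Rightarrow> nat \<times> nat \<times> bool \<Rightarrow> nat \<times> nat \<times> bool" where
  "cap_occ N = (\<lambda>(i, j, a). (cap_at N i, cap_at N j, a))"

definition cap_sensor :: "nat \<Rightarrow> nat \<times> bool \<Rightarrow> nat \<times> bool" where
  "cap_sensor N = (\<lambda>(i, a). (cap_at N i, a))"

abbreviation cap_law :: "nat \<Rightarrow> (nat \<times> bool) pmf \<Rightarrow> (nat \<times> bool) pmf" where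
  "cap_law N \<equiv> map_pmf (cap_sensor N)"

lemma cap_at_simps [simp]: "cap_at N 0 = 0" "cap_at N n \<le> N" "i \<le> N \<Longrightarrow> cap_at N i = i"
    "cap_at N (Suc (cap_at N i)) = cap_at N (Suc i)"
  by (auto simp: cap_at_def)

lemma sensor_of_cap_occ: "sensor_marginal (map_pmf (cap_occ N) q) = cap_law N (sensor_marginal q)"
  by (simp add: pmf.map_comp o_def sensor_of_def cap_occ_def cap_sensor_def case_prod_beta')

text \<open>\<open>Omega_trunc\<close> ignores values outside the square; a law representing one of
  its members must vanish there.\<close>

definition boxed :: "nat \<Rightarrow> (nat \<times> nat \<times> bool) pmf \<Rightarrow> bool" where
  "boxed N q \<longleftrightarrow> (\<forall>i j a. N < i \<or> N < j \<longrightarrow> pmf q (i, j, a) = 0)"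

lemma boxed_map_cap_occ: "boxed N (map_pmf (cap_occ N) q)"
  unfolding boxed_def
proof (intro allI impI)
  fix i j a assume *: "N < i \<or> N < j"
  have "(i, j, a) \<notin> set_pmf (map_pmf (cap_occ N) q)"
    using * by (auto simp: cap_occ_def cap_at_def)
  then show "pmf (map_pmf (cap_occ N) q) (i, j, a) = 0" by (metis set_pmf_iff)
qed

lemma idle_free_map_cap_occ:
  assumes "idle_free N q"
  shows "idle_free N (map_pmf (cap_occ N) q)"
  unfolding idle_free_def
proof (intro allI impI)
  fix i j assume ij: "N \<le> i \<or> N \<le> j"
  have "(i, j, False) \<notin> set_pmf (map_pmf (cap_occ N) q)"
  proof
    assume "(i, j, False) \<in> set_pmf (map_pmf (cap_occ N) q)"
    then obtain i' j' where "(i', j', False) \<in> set_pmf q" "N \<le> i' \<or> N \<le> j'"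
      using ij by (auto simp: cap_occ_def cap_at_def min_def split: if_splits)
    then show False using assms by (auto simp: idle_free_def set_pmf_iff)
  qed
  then show "pmf (map_pmf (cap_occ N) q) (i, j, False) = 0" by (metis set_pmf_iff)
qed

lemma mass_box:
  fixes F :: "nat \<times> nat \<times> bool \<Rightarrow> ennreal"
  assumes "\<And>i j a. N < i \<or> N < j \<Longrightarrow> F (i, j, a) = 0"
  shows "mass F = (\<Sum>i\<le>N. \<Sum>j\<le>N. \<Sum>a\<in>UNIV. F (i, j, a))"
proof -
  have "mass F = (\<Sum>x\<in>{..N} \<times> {..N} \<times> UNIV. F x)"
  proof (intro nn_integral_count_space')
    fix x assume "x \<notin> {..N} \<times> {..N} \<times> (UNIV :: bool set)"
    then show "F x = 0" using assms[of "fst x" "fst (snd x)" "snd (snd x)"] by (cases x) auto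
  qed auto
  then show ?thesis by (simp only: sum.cartesian_product')
qed

section \<open>The l1 distance under maps and capping\<close>

lemma pmf_map_mass: "ennreal (pmf (map_pmf f q) y) = mass (\<lambda>x. ennreal (pmf q x) * of_bool (f x = y))"
proof -
  have "ennreal (pmf (map_pmf f q) y) = (\<integral>\<^sup>+x. ennreal (pmf (return_pmf (f x)) y) \<partial>q)"
    by (simp add: map_pmf_def ennreal_pmf_bind)
  also have "\<dots> = mass (\<lambda>x. ennreal (pmf q x) * of_bool (f x = y))"
    unfolding nn_integral_measure_pmf_mass by (intro nn_integral_cong) (auto simp: indicator_def)
  finally show ?thesis .
qed

lemma abs_diff_le_ennreal:
  assumes "ennreal a \<le> ennreal b + e" "ennreal b \<le> ennreal a + e" "0 \<le> a" "0 \<le> b"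
  shows "ennreal \<bar>a - b\<bar> \<le> e"
proof (cases e)
  case (real r)
  then have "a \<le> b + r" "b \<le> a + r"
    using assms by (simp_all add: ennreal_plus[symmetric] ennreal_le_iff del: ennreal_plus)
  then show ?thesis using real by (simp add: ennreal_leI abs_le_iff)
qed simp

text \<open>Triangle inequality on each fibre; every point is then counted in exactly one
  fibre.\<close>

lemma l1_map_le:
  fixes p q :: "'s pmf"
  shows "l1 (map_pmf f p) (map_pmf f q) \<le> l1 p q"
proof -
  have 1: "ennreal \<bar>pmf (map_pmf f p) y - pmf (map_pmf f q) y\<bar>
      \<le> mass (\<lambda>x. ennreal \<bar>pmf p x - pmf q x\<bar> * of_bool (f x = y))" for y
  proof -
    have le: "ennreal (pmf (map_pmf f p) y) \<le> ennreal (pmf (map_pmf f q) y)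
        + mass (\<lambda>x. ennreal \<bar>pmf p x - pmf q x\<bar> * of_bool (f x = y))" for p q :: "'s pmf"
      unfolding pmf_map_mass nn_integral_add[symmetric, OF borel_measurable_count_space borel_measurable_count_space]
    proof (intro nn_integral_mono)
      fix x
      have "ennreal (pmf p x) \<le> ennreal (pmf q x + \<bar>pmf p x - pmf q x\<bar>)" by (intro ennreal_leI) auto
      then show "ennreal (pmf p x) * of_bool (f x = y)
        \<le> ennreal (pmf q x) * of_bool (f x = y) + ennreal \<bar>pmf p x - pmf q x\<bar> * of_bool (f x = y)"
        by (auto simp: pmf_nonneg)
    qed
    show ?thesis
      using le[of p q] le[of q p] by (intro abs_diff_le_ennreal) (auto simp: abs_minus_commute pmf_nonneg)
  qed
  have "l1 (map_pmf f p) (map_pmf f q) \<le> mass (\<lambda>y. mass (\<lambda>x. ennreal \<bar>pmf p x - pmf q x\<bar> * of_bool (f x = y)))"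
    unfolding l1_def by (intro nn_integral_mono 1)
  also have "\<dots> = mass (\<lambda>x. mass (\<lambda>y. ennreal \<bar>pmf p x - pmf q x\<bar> * of_bool (f x = y)))"
    by (rule mass_swap)
  also have "\<dots> = l1 p q"
    unfolding l1_def
  proof (intro nn_integral_cong)
    fix x
    show "mass (\<lambda>y. ennreal \<bar>pmf p x - pmf q x\<bar> * of_bool (f x = y)) = ennreal \<bar>pmf p x - pmf q x\<bar>"
      by (subst nn_integral_count_space'[where A = "{f x}"]) auto
  qed
  finally show ?thesis .
qed

lemma l1_commute: "l1 p q = l1 q p"
  by (simp add: l1_def abs_minus_commute)

lemma l1_triangle: "l1 p r \<le> l1 p q + l1 q r"
  unfolding l1_def nn_integral_add[symmetric, OF borel_measurable_count_space borel_measurable_count_space]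
  by (intro nn_integral_mono) (simp add: ennreal_plus[symmetric] ennreal_leI del: ennreal_plus)

lemma l1_le_2: "l1 p q \<le> 2"
proof -
  have "l1 p q \<le> mass (\<lambda>x. ennreal (pmf p x) + ennreal (pmf q x))"
    unfolding l1_def using pmf_nonneg[of p] pmf_nonneg[of q]
    by (intro nn_integral_mono) (auto simp: ennreal_plus[symmetric] abs_le_iff add_increasing add_increasing2 intro!: ennreal_leI simp del: ennreal_plus)
  then show ?thesis by (simp add: nn_integral_add mass_pmf)
qed

text \<open>Being at most 2, the sum converges, so the \<open>infsum\<close> in
  \<open>l1_dist\<close> is not the default value of a divergent sum.\<close>

lemma l1_dist_eq: "ennreal (l1_dist p q) = l1 p q"
proof -
  have "l1 p q = ennreal (enn2real (l1 p q))"
    using le_less_trans[OF l1_le_2[of p q]] by simp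
  then have "((\<lambda>x. \<bar>pmf p x - pmf q x\<bar>) has_sum enn2real (l1 p q)) UNIV"
    by (subst has_sum_iff_mass) (auto simp: l1_def)
  then have "l1_dist p q = enn2real (l1 p q)" unfolding l1_dist_def by (rule infsumI)
  then show ?thesis using \<open>l1 p q = ennreal (enn2real (l1 p q))\<close> by simp
qed

lemma suminf_cap_at:
  fixes f :: "nat \<Rightarrow> ennreal"
  shows "i < N \<Longrightarrow> (\<Sum>k. f k * of_bool (cap_at N k = i)) = f i"
    and "(\<Sum>k. f k * of_bool (cap_at N k = N)) = (\<Sum>m. f (m + N))"
proof -
  assume i: "i < N"
  then have "(\<Sum>k. f k * of_bool (cap_at N k = i)) = (\<Sum>k\<in>{i}. f k * of_bool (cap_at N k = i))"
    by (intro suminf_finite) (auto simp: cap_at_def min_def split: if_splits)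
  then show "(\<Sum>k. f k * of_bool (cap_at N k = i)) = f i" using i by simp
next
  show "(\<Sum>k. f k * of_bool (cap_at N k = N)) = (\<Sum>m. f (m + N))"
    by (subst suminf_offset[where i = N]) (auto simp: summableI cap_at_def)
qed

lemma pmf_cap_sensor:
  "i < N \<Longrightarrow> pmf (cap_law N \<sigma>) (i, a) = pmf \<sigma> (i, a)"
  "pmf (cap_law N \<sigma>) (N, a) = (\<Sum>\<^sub>\<infinity>i\<in>{N..}. pmf \<sigma> (i, a))"
  "ennreal (pmf (cap_law N \<sigma>) (N, a)) = (\<Sum>m. ennreal (pmf \<sigma> (m + N, a)))"
proof -
  have mass: "ennreal (pmf (cap_law N \<sigma>) (i, a)) = (\<Sum>k. ennreal (pmf \<sigma> (k, a)) * of_bool (cap_at N k = i))" for i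
  proof -
    have "ennreal (pmf (cap_law N \<sigma>) (i, a))
       = mass (\<lambda>k. mass (\<lambda>b. ennreal (pmf \<sigma> (k, b)) * of_bool (cap_sensor N (k, b) = (i, a))))"
      unfolding pmf_map_mass by (rule mass_prod)
    also have "\<dots> = mass (\<lambda>k. ennreal (pmf \<sigma> (k, a)) * of_bool (cap_at N k = i))"
      by (intro nn_integral_cong) (cases a; simp add: mass_bool cap_sensor_def)
    finally show ?thesis by (simp add: nn_integral_count_space_nat)
  qed
  show "pmf (cap_law N \<sigma>) (i, a) = pmf \<sigma> (i, a)" if "i < N"
    using mass[of i] unfolding suminf_cap_at(1)[OF that] by (simp add: pmf_nonneg)
  show tail: "ennreal (pmf (cap_law N \<sigma>) (N, a)) = (\<Sum>m. ennreal (pmf \<sigma> (m + N, a)))"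
    unfolding mass by (rule suminf_cap_at(2))
  have "((\<lambda>m. pmf \<sigma> (m + N, a)) has_sum pmf (cap_law N \<sigma>) (N, a)) UNIV"
    by (subst has_sum_iff_mass) (auto simp: pmf_nonneg tail nn_integral_count_space_nat)
  then have "((\<lambda>i. pmf \<sigma> (i, a)) has_sum pmf (cap_law N \<sigma>) (N, a)) ((\<lambda>m. m + N) ` UNIV)"
    by (subst has_sum_reindex) (auto simp: o_def)
  moreover have "(\<lambda>m. m + N) ` UNIV = {N..}"
    by (auto simp: image_iff) (metis le_add_diff_inverse2)
  ultimately show "pmf (cap_law N \<sigma>) (N, a) = (\<Sum>\<^sub>\<infinity>i\<in>{N..}. pmf \<sigma> (i, a))"
    by (metis infsumI)
qed

lemma mass_bool_sum: "mass F = (\<Sum>a\<in>(UNIV :: bool set). F a)"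
  by (subst nn_integral_count_space'[where A = UNIV]) auto

lemma l1_sensor_split:
  fixes \<sigma> \<omega> :: "(nat \<times> bool) pmf"
  shows "l1 \<sigma> \<omega> = (\<Sum>i<N. \<Sum>a\<in>UNIV. ennreal \<bar>pmf \<sigma> (i, a) - pmf \<omega> (i, a)\<bar>)
    + (\<Sum>m. \<Sum>a\<in>UNIV. ennreal \<bar>pmf \<sigma> (m + N, a) - pmf \<omega> (m + N, a)\<bar>)"
proof -
  have "l1 \<sigma> \<omega> = (\<Sum>i. \<Sum>a\<in>UNIV. ennreal \<bar>pmf \<sigma> (i, a) - pmf \<omega> (i, a)\<bar>)"
    unfolding l1_def by (subst mass_prod) (simp only: mass_bool_sum nn_integral_count_space_nat)
  then show ?thesis by (subst (asm) suminf_offset[where i = N]) (auto simp: summableI add.commute simp del: sum_ennreal)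
qed

lemma l1_cap_sensor:
  "l1 (cap_law N \<sigma>) (cap_law N \<omega>) =
    (\<Sum>i\<le>N. \<Sum>a\<in>UNIV. ennreal \<bar>pmf (cap_law N \<sigma>) (i, a) - pmf (cap_law N \<omega>) (i, a)\<bar>)"
proof -
  have 0: "pmf (cap_law N \<sigma>) (Suc (m + N), a) = 0" for m a and \<sigma> :: "(nat \<times> bool) pmf"
  proof -
    have "(Suc (m + N), a) \<notin> set_pmf (cap_law N \<sigma>)"
      by (auto simp: cap_sensor_def cap_at_def)
    then show ?thesis by (metis set_pmf_iff)
  qed
  show ?thesis by (subst l1_sensor_split[where N = "Suc N"]) (simp add: 0 lessThan_Suc_atMost)
qed

text \<open>From row \<open>N\<close> on, differences are bounded by sums of masses. If
  \<open>S\<close> and \<open>T\<close> are the tails of \<open>\<sigma>\<close> and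
  \<open>\<omega>\<close> for one action, then \<open>S + T \<le> |S - T| + 2 * T\<close>, and
  \<open>|S - T|\<close> is part of the capped distance.\<close>

lemma l1_le_cap_sensor:
  "l1 \<sigma> \<omega> \<le> l1 (cap_law N \<sigma>) (cap_law N \<omega>)
    + 2 * (\<Sum>a\<in>UNIV. ennreal (pmf (cap_law N \<omega>) (N, a)))"
proof -
  let ?s = "cap_law N \<sigma>" and ?w = "cap_law N \<omega>"
  have "(\<Sum>m. \<Sum>a\<in>UNIV. ennreal \<bar>pmf \<sigma> (m + N, a) - pmf \<omega> (m + N, a)\<bar>)
      \<le> (\<Sum>m. \<Sum>a\<in>UNIV. ennreal (pmf \<sigma> (m + N, a)) + ennreal (pmf \<omega> (m + N, a)))"
  proof (intro suminf_le sum_mono summableI)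
    fix m :: nat and a :: bool
    show "ennreal \<bar>pmf \<sigma> (m + N, a) - pmf \<omega> (m + N, a)\<bar> \<le> ennreal (pmf \<sigma> (m + N, a)) + ennreal (pmf \<omega> (m + N, a))"
      using pmf_nonneg[of \<sigma> "(m + N, a)"] pmf_nonneg[of \<omega> "(m + N, a)"]
      unfolding ennreal_plus[OF pmf_nonneg pmf_nonneg, symmetric] by (intro ennreal_leI) linarith
  qed
  also have "\<dots> = (\<Sum>a\<in>UNIV. ennreal (pmf ?s (N, a)) + ennreal (pmf ?w (N, a)))"
    unfolding pmf_cap_sensor(3) suminf_sum[OF summableI] by (simp only: suminf_add[OF summableI summableI])
  also have "\<dots> \<le> (\<Sum>a\<in>UNIV. ennreal \<bar>pmf ?s (N, a) - pmf ?w (N, a)\<bar> + 2 * ennreal (pmf ?w (N, a)))"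
  proof (intro sum_mono)
    fix a
    have "ennreal (pmf ?s (N, a)) + ennreal (pmf ?w (N, a)) \<le> ennreal (\<bar>pmf ?s (N, a) - pmf ?w (N, a)\<bar> + 2 * pmf ?w (N, a))"
      unfolding ennreal_plus[OF pmf_nonneg pmf_nonneg, symmetric] by (intro ennreal_leI) linarith
    also have "\<dots> = ennreal \<bar>pmf ?s (N, a) - pmf ?w (N, a)\<bar> + 2 * ennreal (pmf ?w (N, a))"
      by (simp add: ennreal_plus ennreal_mult pmf_nonneg)
    finally show "ennreal (pmf ?s (N, a)) + ennreal (pmf ?w (N, a)) \<le> \<dots>" .
  qed
  finally have "l1 \<sigma> \<omega> \<le> (\<Sum>i<N. \<Sum>a\<in>UNIV. ennreal \<bar>pmf ?s (i, a) - pmf ?w (i, a)\<bar>)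
      + (\<Sum>a\<in>UNIV. ennreal \<bar>pmf ?s (N, a) - pmf ?w (N, a)\<bar> + 2 * ennreal (pmf ?w (N, a)))"
    by (subst l1_sensor_split[where N = N]) (simp add: pmf_cap_sensor(1) add_left_mono)
  also have "\<dots> = l1 ?s ?w + 2 * (\<Sum>a\<in>UNIV. ennreal (pmf ?w (N, a)))"
    by (simp only: l1_cap_sensor lessThan_Suc_atMost[symmetric] sum.lessThan_Suc sum.distrib sum_distrib_left add.assoc)
  finally show ?thesis .
qed

lemma tail_cap_sensor: "(\<Sum>a\<in>UNIV. ennreal (pmf (cap_law N \<omega>) (N, a))) = ennreal (measure \<omega> {x. N \<le> fst x})"
proof -
  have "(\<Sum>a\<in>UNIV. ennreal (pmf (cap_law N \<omega>) (N, a))) = ennreal (measure (cap_law N \<omega>) {(N, True), (N, False)})"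
    by (subst measure_measure_pmf_finite) (auto simp: UNIV_bool pmf_nonneg add.commute)
  also have "measure (cap_law N \<omega>) {(N, True), (N, False)} = measure \<omega> (cap_sensor N -` {(N, True), (N, False)})"
    by simp
  also have "cap_sensor N -` {(N, True), (N, False)} = {x. N \<le> fst x}"
    by (auto simp: cap_sensor_def cap_at_def split: if_splits)
  finally show ?thesis .
qed

lemma tail_tendsto_0: "(\<lambda>N. measure (measure_pmf (\<omega> :: (nat \<times> bool) pmf)) {x. N \<le> fst x}) \<longlonglongrightarrow> 0"
proof -
  have "(\<lambda>N. measure (measure_pmf \<omega>) {x. N \<le> fst x}) \<longlonglongrightarrow> measure (measure_pmf \<omega>) (\<Inter>N. {x. N \<le> fst x})"
    by (intro measure_pmf.finite_Lim_measure_decseq) (auto simp: decseq_def)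
  moreover have "(\<Inter>N. {x :: nat \<times> bool. N \<le> fst x}) = {}"
    using not_less_eq_eq by auto
  ultimately show ?thesis by simp
qed

lemma sum_box_ennreal:
  fixes h :: "nat \<Rightarrow> nat \<Rightarrow> bool \<Rightarrow> real"
  assumes "\<And>i j a. i \<le> N \<Longrightarrow> j \<le> N \<Longrightarrow> 0 \<le> h i j a"
  shows "(\<Sum>i\<le>N. \<Sum>j\<le>N. \<Sum>a\<in>UNIV. ennreal (h i j a)) = ennreal (\<Sum>i\<le>N. \<Sum>j\<le>N. \<Sum>a\<in>UNIV. h i j a)"
proof -
  have "(\<Sum>i\<le>N. \<Sum>j\<le>N. \<Sum>a\<in>UNIV. ennreal (h i j a)) = (\<Sum>i\<le>N. ennreal (\<Sum>j\<le>N. \<Sum>a\<in>UNIV. h i j a))"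
  proof (intro sum.cong refl)
    fix i assume "i \<in> {..N}"
    then have "(\<Sum>j\<le>N. \<Sum>a\<in>UNIV. ennreal (h i j a)) = (\<Sum>j\<le>N. ennreal (\<Sum>a\<in>UNIV. h i j a))"
      by (intro sum.cong refl sum_ennreal) (auto simp: assms)
    then show "(\<Sum>j\<le>N. \<Sum>a\<in>UNIV. ennreal (h i j a)) = ennreal (\<Sum>j\<le>N. \<Sum>a\<in>UNIV. h i j a)"
      using \<open>i \<in> {..N}\<close> by (simp only:) (intro sum_ennreal sum_nonneg, auto simp: assms)
  qed
  then show ?thesis by (simp only:) (intro sum_ennreal sum_nonneg, auto simp: assms)
qed

section \<open>The truncated program as a set of laws\<close>

context channel
begin

abbreviation capped_trans :: "nat \<Rightarrow> nat \<times> nat \<Rightarrow> bool \<Rightarrow> nat \<times> nat \<Rightarrow> real" where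
  "capped_trans N \<equiv> mdp_trans (cap_at N) l le la"

lemma Omega_trunc_iff:
  "\<rho> \<in> Omega_trunc N l le la \<longleftrightarrow>
    (\<exists>q. balanced (cap_at N) q \<and> boxed N q \<and> (\<forall>i\<le>N. \<forall>j\<le>N. \<forall>a. \<rho> i j a = pmf q (i, j, a)))"
proof
  have cap: "(\<lambda>n. min n N) = cap_at N" by (simp add: cap_at_def fun_eq_iff)
  assume "\<rho> \<in> Omega_trunc N l le la"
  then have nn: "\<And>i j a. i \<le> N \<Longrightarrow> j \<le> N \<Longrightarrow> 0 \<le> \<rho> i j a"
    and tot: "(\<Sum>i\<le>N. \<Sum>j\<le>N. \<Sum>a\<in>UNIV. \<rho> i j a) = 1"
    and bal: "\<And>i j. i \<le> N \<Longrightarrow> j \<le> N \<Longrightarrow> (\<Sum>a\<in>UNIV. \<rho> i j a) =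
        (\<Sum>i'\<le>N. \<Sum>j'\<le>N. \<Sum>a\<in>UNIV. \<rho> i' j' a * capped_trans N (i', j') a (i, j))"
    by (auto simp: Omega_trunc_def cap)
  define \<rho>' where "\<rho>' x = (case x of (i, j, a) \<Rightarrow> if i \<le> N \<and> j \<le> N then \<rho> i j a else 0)" for x
  have nn': "0 \<le> \<rho>' x" for x using nn by (auto simp: \<rho>'_def split: prod.split)
  have sum: "mass (\<lambda>x. ennreal (\<rho>' x * g x)) = ennreal (\<Sum>i\<le>N. \<Sum>j\<le>N. \<Sum>a\<in>UNIV. \<rho> i j a * g (i, j, a))"
    if g: "\<And>x. 0 \<le> g x" for g
  proof -
    have "mass (\<lambda>x. ennreal (\<rho>' x * g x)) = (\<Sum>i\<le>N. \<Sum>j\<le>N. \<Sum>a\<in>UNIV. ennreal (\<rho>' (i, j, a) * g (i, j, a)))"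
      by (rule mass_box) (auto simp: \<rho>'_def)
    also have "\<dots> = (\<Sum>i\<le>N. \<Sum>j\<le>N. \<Sum>a\<in>UNIV. ennreal (\<rho> i j a * g (i, j, a)))"
      by (intro sum.cong refl) (auto simp: \<rho>'_def)
    also have "\<dots> = ennreal (\<Sum>i\<le>N. \<Sum>j\<le>N. \<Sum>a\<in>UNIV. \<rho> i j a * g (i, j, a))"
      using nn g by (intro sum_box_ennreal) auto
    finally show ?thesis .
  qed
  define q where "q = embed_pmf \<rho>'"
  have q: "pmf q x = \<rho>' x" for x
    unfolding q_def using sum[of "\<lambda>_. 1"] tot nn' by (intro pmf_embed_pmf) auto
  have "balanced (cap_at N) q"
    unfolding balanced_iff[of "cap_at N", OF cap_at_simps(1)]
  proof (intro allI)
    fix i j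
    have "mass (\<lambda>(i', j', a). ennreal (pmf q (i', j', a) * capped_trans N (i', j') a (i, j)))
       = mass (\<lambda>x. ennreal (\<rho>' x * (\<lambda>(i', j', a). capped_trans N (i', j') a (i, j)) x))"
      by (intro nn_integral_cong) (auto simp: q)
    also have "\<dots> = ennreal (\<Sum>i'\<le>N. \<Sum>j'\<le>N. \<Sum>a\<in>UNIV. \<rho> i' j' a * capped_trans N (i', j') a (i, j))"
      by (subst sum) (auto simp: mdp_trans_nonneg)
    also have "(\<Sum>i'\<le>N. \<Sum>j'\<le>N. \<Sum>a\<in>UNIV. \<rho> i' j' a * capped_trans N (i', j') a (i, j))
        = pmf q (i, j, True) + pmf q (i, j, False)"
    proof (cases "i \<le> N \<and> j \<le> N")
      case True
      then show ?thesis using bal[of i j] by (simp add: q \<rho>'_def UNIV_bool add.commute)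
    next
      case False
      \<comment> \<open>Capped transitions never leave the square, so outside it the balance reads
        \<open>0 = 0\<close>.\<close>
      then have "capped_trans N (i', j') a (i, j) = 0" for i' j' a
        using cap_at_simps(2)[of N "Suc i'"] cap_at_simps(2)[of N "Suc j'"] by (auto simp: mdp_trans_def)
      then show ?thesis using False by (auto simp: q \<rho>'_def)
    qed
    finally show "mass (\<lambda>(i', j', a). ennreal (pmf q (i', j', a) * capped_trans N (i', j') a (i, j)))
       = ennreal (pmf q (i, j, True) + pmf q (i, j, False))" .
  qed
  then show "\<exists>q. balanced (cap_at N) q \<and> boxed N q \<and> (\<forall>i\<le>N. \<forall>j\<le>N. \<forall>a. \<rho> i j a = pmf q (i, j, a))"
    by (intro exI[of _ q]) (auto simp: q boxed_def \<rho>'_def)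
next
  have cap: "(\<lambda>n. min n N) = cap_at N" by (simp add: cap_at_def fun_eq_iff)
  assume "\<exists>q. balanced (cap_at N) q \<and> boxed N q \<and> (\<forall>i\<le>N. \<forall>j\<le>N. \<forall>a. \<rho> i j a = pmf q (i, j, a))"
  then obtain q where q: "balanced (cap_at N) q" "boxed N q" "\<And>i j a. i \<le> N \<Longrightarrow> j \<le> N \<Longrightarrow> \<rho> i j a = pmf q (i, j, a)"
    by blast
  have sum: "mass (\<lambda>x. ennreal (pmf q x * g x)) = ennreal (\<Sum>i\<le>N. \<Sum>j\<le>N. \<Sum>a\<in>UNIV. \<rho> i j a * g (i, j, a))"
    if g: "\<And>x. 0 \<le> g x" for g
  proof -
    have "mass (\<lambda>x. ennreal (pmf q x * g x)) = (\<Sum>i\<le>N. \<Sum>j\<le>N. \<Sum>a\<in>UNIV. ennreal (pmf q (i, j, a) * g (i, j, a)))"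
      using q(2) by (intro mass_box) (auto simp: boxed_def)
    also have "\<dots> = ennreal (\<Sum>i\<le>N. \<Sum>j\<le>N. \<Sum>a\<in>UNIV. pmf q (i, j, a) * g (i, j, a))"
      using g by (intro sum_box_ennreal) (auto simp: pmf_nonneg)
    also have "(\<Sum>i\<le>N. \<Sum>j\<le>N. \<Sum>a\<in>UNIV. pmf q (i, j, a) * g (i, j, a)) = (\<Sum>i\<le>N. \<Sum>j\<le>N. \<Sum>a\<in>UNIV. \<rho> i j a * g (i, j, a))"
      by (intro sum.cong refl) (simp add: q(3))
    finally show ?thesis .
  qed
  have nn: "0 \<le> \<rho> i j a" if "i \<le> N" "j \<le> N" for i j a using that by (simp add: q(3) pmf_nonneg)
  have "(\<Sum>i\<le>N. \<Sum>j\<le>N. \<Sum>a\<in>UNIV. \<rho> i j a) = 1"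
  proof -
    have "ennreal (\<Sum>i\<le>N. \<Sum>j\<le>N. \<Sum>a\<in>UNIV. \<rho> i j a) = ennreal 1"
      using sum[of "\<lambda>_. 1"] mass_pmf[of q] by simp
    then show ?thesis by (subst (asm) ennreal_inj) (auto intro!: sum_nonneg nn)
  qed
  moreover have "(\<Sum>a\<in>UNIV. \<rho> i j a) =
      (\<Sum>i'\<le>N. \<Sum>j'\<le>N. \<Sum>a\<in>UNIV. \<rho> i' j' a * capped_trans N (i', j') a (i, j))"
    if ij: "i \<le> N" "j \<le> N" for i j
  proof -
    have "ennreal (\<Sum>i'\<le>N. \<Sum>j'\<le>N. \<Sum>a\<in>UNIV. \<rho> i' j' a * capped_trans N (i', j') a (i, j))
        = mass (\<lambda>x. ennreal (pmf q x * (\<lambda>(i', j', a). capped_trans N (i', j') a (i, j)) x))"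
      by (subst sum) (auto simp: mdp_trans_nonneg)
    also have "\<dots> = mass (\<lambda>(i', j', a). ennreal (pmf q (i', j', a) * capped_trans N (i', j') a (i, j)))"
      by (intro nn_integral_cong) auto
    also have "\<dots> = ennreal (pmf q (i, j, True) + pmf q (i, j, False))"
      using q(1) unfolding balanced_iff[of "cap_at N", OF cap_at_simps(1)] by blast
    also have "\<dots> = ennreal (\<Sum>a\<in>UNIV. \<rho> i j a)" using ij by (simp only: q(3) UNIV_bool) (simp add: add.commute)
    finally show ?thesis
      by (subst (asm) ennreal_inj) (auto intro!: sum_nonneg nn mult_nonneg_nonneg mdp_trans_nonneg ij)
  qed
  ultimately show "\<rho> \<in> Omega_trunc N l le la" by (simp add: Omega_trunc_def cap nn)
qed

text \<open>Lumpability: forgetting by how much a holding time exceeds \<open>N\<close> does not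
  change the capped successor. Hence balanced laws project to balanced laws.\<close>

lemma cap_act: "map_pmf (cap2 (cap_at N)) (act a (cap_at N i, cap_at N j)) = map_pmf (cap2 (cap_at N)) (act a (i, j))"
  by (rule pmf_eqI, simp only: pmf_act[of "cap_at N", OF cap_at_simps(1)]) (simp add: mdp_trans_def)

lemma balanced_map_cap_occ:
  assumes "balanced id q"
  shows "balanced (cap_at N) (map_pmf (cap_occ N) q)"
proof -
  have "map_pmf state_of (map_pmf (cap_occ N) q) = map_pmf (cap2 (cap_at N)) (map_pmf state_of q)"
    by (simp add: pmf.map_comp o_def state_of_def cap_occ_def cap2_def case_prod_beta')
  also have "\<dots> = bind_pmf q (\<lambda>(i, j, a). map_pmf (cap2 (cap_at N)) (act a (i, j)))"
    using assms unfolding balanced_def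
    by (simp add: map_bind_pmf cap2_def prod.map_id0 case_prod_beta')
  also have "\<dots> = bind_pmf (map_pmf (cap_occ N) q) (\<lambda>(i, j, a). map_pmf (cap2 (cap_at N)) (act a (i, j)))"
    unfolding bind_map_pmf by (intro bind_pmf_cong refl) (auto simp: cap_occ_def cap_act)
  finally show ?thesis by (simp add: balanced_def)
qed

end

lemma sum_boxed_sensor:
  assumes "boxed N q"
  shows "(\<Sum>j\<le>N. pmf q (i, j, a)) = pmf (sensor_marginal q) (i, a)"
proof -
  have "ennreal (pmf (sensor_marginal q) (i, a)) = mass (\<lambda>x. ennreal (pmf q x) * of_bool (sensor_of x = (i, a)))"
    by (rule pmf_map_mass)
  also have "\<dots> = (\<Sum>x\<in>(\<lambda>j. (i, j, a)) ` {..N}. ennreal (pmf q x) * of_bool (sensor_of x = (i, a)))"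
  proof (rule nn_integral_count_space')
    fix x assume x: "x \<notin> (\<lambda>j. (i, j, a)) ` {..N}"
    obtain k j b where "x = (k, j, b)" by (cases x) auto
    then show "ennreal (pmf q x) * of_bool (sensor_of x = (i, a)) = 0"
      using x assms by (cases "j \<le> N") (auto simp: boxed_def sensor_of_def)
  qed auto
  also have "\<dots> = (\<Sum>j\<le>N. ennreal (pmf q (i, j, a)))"
    by (subst sum.reindex) (auto simp: inj_on_def sensor_of_def)
  also have "\<dots> = ennreal (\<Sum>j\<le>N. pmf q (i, j, a))" by (simp add: pmf_nonneg)
  finally show ?thesis by (subst (asm) ennreal_inj) (auto simp: pmf_nonneg sum_nonneg)
qed

context lossy_channel
begin

text \<open>The slack variables only have to dominate the deviations, so the deviations themselves
  are the best choice and the constraints collapse to one distance.\<close>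

lemma trunc_lp_feasible_iff:
  "(\<exists>\<epsilon>. trunc_lp_feasible l le la \<omega> \<epsilon>s N \<rho> \<epsilon>) \<longleftrightarrow>
    (\<exists>q. balanced (cap_at N) q \<and> boxed N q \<and> idle_free N q \<and> (\<forall>i\<le>N. \<forall>j\<le>N. \<forall>a. \<rho> i j a = pmf q (i, j, a)) \<and>
      l1 (sensor_marginal q) (cap_law N \<omega>) \<le> ennreal \<epsilon>s)" if \<epsilon>s: "0 \<le> \<epsilon>s"
proof -
  define dev where "dev q i a = \<bar>pmf (sensor_marginal q) (i, a) - pmf (cap_law N \<omega>) (i, a)\<bar>" for q i a
  have sensor_capped: "sensor_marginal q = cap_law N (sensor_marginal q)" if "boxed N q" for q
  proof -
    have "map_pmf (cap_occ N) q = q"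
    proof (rule map_pmf_idI)
      fix x assume "x \<in> set_pmf q"
      then have "pmf q x \<noteq> 0" by (simp add: set_pmf_iff)
      then have "fst x \<le> N \<and> fst (snd x) \<le> N"
        using that unfolding boxed_def by (cases x) (metis fst_conv not_le snd_conv)
      then show "cap_occ N x = x" by (cases x) (auto simp: cap_occ_def)
    qed
    then show ?thesis using sensor_of_cap_occ[of N q] by simp
  qed
  have l1_dev: "l1 (sensor_marginal q) (cap_law N \<omega>) = ennreal (\<Sum>i\<le>N. \<Sum>a\<in>UNIV. dev q i a)" if "boxed N q" for q
    by (subst (1) sensor_capped[OF that], subst l1_cap_sensor, subst sensor_capped[OF that, symmetric])
      (simp add: dev_def sum_nonneg)
  have dev_sum: "(\<forall>i<N. \<forall>a. \<bar>(\<Sum>j\<le>N. \<rho> i j a) - pmf \<omega> (i, a)\<bar> \<le> \<epsilon> i a) \<and>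
      (\<forall>a. \<bar>(\<Sum>j\<le>N. \<rho> N j a) - (\<Sum>\<^sub>\<infinity>i\<in>{N..}. pmf \<omega> (i, a))\<bar> \<le> \<epsilon> N a) \<longleftrightarrow> (\<forall>i\<le>N. \<forall>a. dev q i a \<le> \<epsilon> i a)"
    if q: "boxed N q" "\<forall>i\<le>N. \<forall>j\<le>N. \<forall>a. \<rho> i j a = pmf q (i, j, a)" for q \<epsilon>
  proof -
    have "(\<Sum>j\<le>N. \<rho> i j a) = pmf (sensor_marginal q) (i, a)" if "i \<le> N" for i a
      using q that by (subst sum_boxed_sensor[OF q(1), symmetric]) (auto intro!: sum.cong)
    then show ?thesis
      by (auto simp: dev_def pmf_cap_sensor(1) pmf_cap_sensor(2)[symmetric] le_less)
  qed
  show ?thesis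
  proof
    assume "\<exists>\<epsilon>. trunc_lp_feasible l le la \<omega> \<epsilon>s N \<rho> \<epsilon>"
    then obtain \<epsilon> where feas: "trunc_lp_feasible l le la \<omega> \<epsilon>s N \<rho> \<epsilon>" by blast
    then obtain q where q: "balanced (cap_at N) q" "boxed N q" "\<forall>i\<le>N. \<forall>j\<le>N. \<forall>a. \<rho> i j a = pmf q (i, j, a)"
      unfolding trunc_lp_feasible_def Omega_trunc_iff by blast
    have "idle_free N q"
      unfolding idle_free_def
    proof (intro allI impI)
      fix i j assume ij: "N \<le> i \<or> N \<le> j"
      show "pmf q (i, j, False) = 0"
      proof (cases "i \<le> N \<and> j \<le> N")
        case True
        then have "i = N \<or> j = N" using ij by linarith
        then have "\<rho> i j False = 0" using feas True unfolding trunc_lp_feasible_def by blast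
        then show ?thesis using q(3) True by auto
      qed (use q(2) in \<open>auto simp: boxed_def\<close>)
    qed
    moreover have "(\<Sum>i\<le>N. \<Sum>a\<in>UNIV. dev q i a) \<le> (\<Sum>i\<le>N. \<Sum>a\<in>UNIV. \<epsilon> i a)"
      using dev_sum[OF q(2,3), of \<epsilon>] feas by (intro sum_mono) (auto simp: trunc_lp_feasible_def)
    then have "(\<Sum>i\<le>N. \<Sum>a\<in>UNIV. dev q i a) \<le> \<epsilon>s" using feas by (auto simp: trunc_lp_feasible_def)
    then have "l1 (sensor_marginal q) (cap_law N \<omega>) \<le> ennreal \<epsilon>s"
      unfolding l1_dev[OF q(2)] by (rule ennreal_leI)
    ultimately show "\<exists>q. balanced (cap_at N) q \<and> boxed N q \<and> idle_free N q \<and> (\<forall>i\<le>N. \<forall>j\<le>N. \<forall>a. \<rho> i j a = pmf q (i, j, a)) \<and>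
      l1 (sensor_marginal q) (cap_law N \<omega>) \<le> ennreal \<epsilon>s"
      using q by blast
  next
    assume "\<exists>q. balanced (cap_at N) q \<and> boxed N q \<and> idle_free N q \<and> (\<forall>i\<le>N. \<forall>j\<le>N. \<forall>a. \<rho> i j a = pmf q (i, j, a)) \<and>
      l1 (sensor_marginal q) (cap_law N \<omega>) \<le> ennreal \<epsilon>s"
    then obtain q where q: "balanced (cap_at N) q" "boxed N q" "\<forall>i\<le>N. \<forall>j\<le>N. \<forall>a. \<rho> i j a = pmf q (i, j, a)"
      and idle: "idle_free N q" and dev: "l1 (sensor_marginal q) (cap_law N \<omega>) \<le> ennreal \<epsilon>s" by blast
    have "(\<Sum>i\<le>N. \<Sum>a\<in>UNIV. dev q i a) \<le> \<epsilon>s"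
      using dev \<epsilon>s unfolding l1_dev[OF q(2)] by (simp add: ennreal_le_iff)
    moreover have "\<forall>i\<le>N. \<forall>j\<le>N. i = N \<or> j = N \<longrightarrow> \<rho> i j False = 0"
      using q(3) idle by (auto simp: idle_free_def)
    ultimately have "trunc_lp_feasible l le la \<omega> \<epsilon>s N \<rho> (dev q)"
      using dev_sum[OF q(2,3), of "dev q"] q unfolding trunc_lp_feasible_def Omega_trunc_iff by blast
    then show "\<exists>\<epsilon>. trunc_lp_feasible l le la \<omega> \<epsilon>s N \<rho> \<epsilon>" by blast
  qed
qed

end

section \<open>The eavesdropper's holding time beyond the horizon\<close>

definition eavesdropper_of :: "nat \<times> nat \<times> bool \<Rightarrow> nat" where
  "eavesdropper_of = (\<lambda>(i, j, a). j)"

abbreviation "eavesdropper_marginal \<equiv> map_pmf eavesdropper_of"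

lemma sum_boxed_eavesdropper:
  assumes "boxed N q" "j \<le> N"
  shows "(\<Sum>i\<le>N. \<Sum>a\<in>UNIV. ennreal (pmf q (i, j, a))) = ennreal (pmf (eavesdropper_marginal q) j)"
proof -
  have "ennreal (pmf (eavesdropper_marginal q) j)
      = (\<Sum>i\<le>N. \<Sum>k\<le>N. \<Sum>a\<in>UNIV. ennreal (pmf q (i, k, a)) * of_bool (eavesdropper_of (i, k, a) = j))"
    unfolding pmf_map_mass using assms by (intro mass_box) (auto simp: boxed_def)
  also have "\<dots> = (\<Sum>i\<le>N. \<Sum>k\<le>N. if k = j then (\<Sum>a\<in>UNIV. ennreal (pmf q (i, k, a))) else 0)"
    by (intro sum.cong refl) (auto simp: eavesdropper_of_def)
  also have "\<dots> = (\<Sum>i\<le>N. \<Sum>a\<in>UNIV. ennreal (pmf q (i, j, a)))"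
    using assms(2) by (simp add: sum.delta' del: sum_ennreal)
  finally show ?thesis ..
qed

lemma pmf_map_cap_at:
  "i < N \<Longrightarrow> pmf (map_pmf (cap_at N) B) i = pmf B i"
  "ennreal (pmf (map_pmf (cap_at N) B) N) = (\<Sum>m. ennreal (pmf B (m + N)))"
proof -
  have mass: "ennreal (pmf (map_pmf (cap_at N) B) i) = (\<Sum>k. ennreal (pmf B k) * of_bool (cap_at N k = i))" for i
    unfolding pmf_map_mass by (rule nn_integral_count_space_nat)
  show "pmf (map_pmf (cap_at N) B) i = pmf B i" if "i < N"
    using mass[of i] unfolding suminf_cap_at(1)[OF that] by (simp add: pmf_nonneg)
  show "ennreal (pmf (map_pmf (cap_at N) B) N) = (\<Sum>m. ennreal (pmf B (m + N)))"
    unfolding mass by (rule suminf_cap_at(2))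
qed

context lossy_channel
begin

lemma pmf_act_eavesdropper:
  "pmf (map_pmf snd (act a (i, j))) (Suc k) = of_bool (j = k) * (if a then 1 - le else 1)"
proof -
  have "ennreal (pmf (map_pmf snd (act a (i, j))) (Suc k)) = (\<integral>\<^sup>+y. of_bool (snd y = Suc k) \<partial>act a (i, j))"
    by (simp add: pmf_map_mass nn_integral_measure_pmf_mass)
  also have "\<dots> = ennreal (of_bool (j = k) * (if a then 1 - le else 1))"
  proof -
    have nn: "0 \<le> (1 - p) * (1 - le)" "0 \<le> p * (1 - le)"
      using p0 p1 le1 by (auto intro!: mult_nonneg_nonneg[of "1 - p"] mult_nonneg_nonneg[of p])
    have "ennreal ((1 - p) * (1 - le)) + ennreal (p * (1 - le)) = ennreal (1 - le)"
      unfolding ennreal_plus[OF nn, symmetric] by (simp add: algebra_simps)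
    then show ?thesis by (subst nn_integral_step) auto
  qed
  finally show ?thesis using le1 by (subst (asm) ennreal_inj) (auto simp: pmf_nonneg)
qed

text \<open>From \<open>N\<close> on the sensor always sends, and holding time \<open>k + 1\<close>
  is reached only from \<open>k\<close> by a missed packet, an event of probability
  \<open>1 - le\<close>.\<close>

lemma eavesdropper_geometric:
  assumes bal: "balanced id q" and idle: "idle_free N q"
  shows "ennreal (pmf (eavesdropper_marginal q) (m + N)) = ennreal ((1 - le) ^ m) * ennreal (pmf (eavesdropper_marginal q) N)"
proof (induction m)
  case (Suc m)
  let ?k = "m + N"
  have "eavesdropper_marginal q = map_pmf snd (map_pmf state_of q)"
    by (simp add: pmf.map_comp o_def eavesdropper_of_def state_of_def case_prod_beta')
  also have "\<dots> = bind_pmf q (\<lambda>(i, j, a). map_pmf snd (act a (i, j)))"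
    using bal unfolding balanced_def by (simp add: map_bind_pmf cap2_def prod.map_id0 case_prod_beta')
  finally have "ennreal (pmf (eavesdropper_marginal q) (Suc ?k))
      = (\<integral>\<^sup>+x. ennreal (pmf (case x of (i, j, a) \<Rightarrow> map_pmf snd (act a (i, j))) (Suc ?k)) \<partial>q)"
    by (simp only: ennreal_pmf_bind)
  also have "\<dots> = (\<integral>\<^sup>+x. ennreal (1 - le) * of_bool (eavesdropper_of x = ?k) \<partial>q)"
  proof (rule nn_integral_cong_AE, unfold AE_measure_pmf_iff, rule ballI)
    fix x assume "x \<in> set_pmf q"
    obtain i j a where x: "x = (i, j, a)" by (cases x) auto
    have "a" if "j = ?k"
    proof (rule ccontr)
      assume "\<not> a"
      then have "pmf q x = 0" using idle that by (auto simp: x idle_free_def)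
      then show False using \<open>x \<in> set_pmf q\<close> by (simp add: set_pmf_iff)
    qed
    then show "ennreal (pmf (case x of (i, j, a) \<Rightarrow> map_pmf snd (act a (i, j))) (Suc ?k))
        = ennreal (1 - le) * of_bool (eavesdropper_of x = ?k)"
      unfolding x prod.case pmf_act_eavesdropper by (auto simp: eavesdropper_of_def)
  qed
  also have "\<dots> = ennreal (1 - le) * ennreal (pmf (eavesdropper_marginal q) ?k)"
    by (subst nn_integral_cmult) (simp_all add: pmf_map_mass nn_integral_measure_pmf_mass)
  finally show ?case using le1 by (simp add: Suc ennreal_mult mult.assoc)
qed simp

text \<open>A saturated policy is constantly 1 beyond the horizon, so it cannot tell a state from
  its capped image.\<close>

lemma cap_state_occ_of:
  assumes sat: "saturated N \<tau>"
  shows "map_pmf (cap_occ N) (occ_of \<pi> \<tau>) = occ_of (map_pmf (cap2 (cap_at N)) \<pi>) \<tau>"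
proof -
  have "\<tau> (cap_at N i) (cap_at N j) = \<tau> i j" for i j
    using sat by (auto simp: saturated_def cap_at_def min_def)
  then show ?thesis
    unfolding occ_of_def map_bind_pmf bind_map_pmf
    by (intro bind_pmf_cong refl) (auto simp: map_bind_pmf cap_occ_def cap2_def)
qed

lemma saturated_idle_free:
  assumes "\<And>i j. \<tau> i j \<in> {0..1}" "saturated N \<tau>"
  shows "idle_free N (occ_of \<pi> \<tau>)"
  using assms(2) by (auto simp: idle_free_def pmf_occ_of[of \<tau>, OF assms(1)] saturated_def)

text \<open>The capped chain of a saturated policy has a unique stationary law, so a feasible point of the
  truncated program is the capped occupation law of its policy in the full model.\<close>

lemma truncated_policy_occupation:
  assumes \<tau>: "\<And>i j. \<tau> i j \<in> {0..1}" and sat: "saturated N \<tau>"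
    and q: "balanced (cap_at N) q" "idle_free N q"
    and policy: "\<And>i j. i < N \<Longrightarrow> j < N \<Longrightarrow> pmf q (i, j, True) + pmf q (i, j, False) \<noteq> 0 \<Longrightarrow>
      \<tau> i j = pmf q (i, j, True) / (pmf q (i, j, True) + pmf q (i, j, False))"
    and st: "stationary (step \<tau>) \<pi>"
  shows "map_pmf (cap_occ N) (occ_of \<pi> \<tau>) = q"
proof -
  have q_eq: "q = occ_of (map_pmf state_of q) \<tau>"
  proof (rule occ_disintegrate[of \<tau>, OF \<tau>])
    fix i j assume *: "pmf q (i, j, True) + pmf q (i, j, False) \<noteq> 0"
    show "\<tau> i j = pmf q (i, j, True) / (pmf q (i, j, True) + pmf q (i, j, False))"
    proof (cases "i < N \<and> j < N")
      case False
      \<comment> \<open>On the boundary the quotient is 1 because idling has no mass, in agreement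
        with the prescribed value.\<close>
      then have "\<tau> i j = 1" "pmf q (i, j, False) = 0"
        using sat q(2) by (auto simp: saturated_def idle_free_def not_less)
      then show ?thesis using * by simp
    qed (use policy * in auto)
  qed
  have "balanced id (occ_of \<pi> \<tau>)" using st by (simp add: balanced_occ_of kern_id)
  then have "balanced (cap_at N) (occ_of (map_pmf (cap2 (cap_at N)) \<pi>) \<tau>)"
    unfolding cap_state_occ_of[OF sat, symmetric] by (rule balanced_map_cap_occ)
  then have "stationary (kern (cap_at N) \<tau>) (map_pmf (cap2 (cap_at N)) \<pi>)" by (simp add: balanced_occ_of)
  moreover have "stationary (kern (cap_at N) \<tau>) (map_pmf state_of q)"
    using q(1) by (subst (asm) q_eq) (simp add: balanced_occ_of)
  moreover have "rigid (kern (cap_at N) \<tau>) z"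
  proof (rule rigid_kern[OF \<tau>])
    fix i j assume "\<tau> i j \<noteq> 1"
    then have "i < N" using sat by (meson saturated_def not_le)
    then show "cap_at N (Suc i) = Suc i" by simp
  qed simp
  ultimately have "map_pmf (cap2 (cap_at N)) \<pi> = map_pmf state_of q" by (rule stationary_unique)
  then show ?thesis using q_eq by (simp add: cap_state_occ_of[OF sat])
qed

end

context priced_channel
begin

lemma lp_cost_eq: "lp_cost c (\<lambda>i j a. pmf q (i, j, a)) = cost q"
  unfolding lp_cost_def cost_def infsum_ennreal_eq_mass nn_integral_measure_pmf_mass
  by (intro nn_integral_cong) auto

lemma cost_eavesdropper: "cost q = (\<Sum>j. ennreal (pmf (eavesdropper_marginal q) j) * c j)"
proof -
  have "cost q = (\<integral>\<^sup>+j. c j \<partial>eavesdropper_marginal q)"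
    by (simp add: cost_def eavesdropper_of_def case_prod_beta')
  then show ?thesis by (simp only: nn_integral_measure_pmf_mass nn_integral_count_space_nat)
qed

text \<open>Cost beyond the horizon per unit of mass at holding time \<open>N\<close>; the weights
  are those of \<open>eavesdropper_geometric\<close>.\<close>

definition tail_cost :: "nat \<Rightarrow> ennreal" where
  "tail_cost N = (\<Sum>m. ennreal ((1 - le) ^ m) * c (m + N))"

lemma tail_cost_fin: "tail_cost N < \<infinity>"
proof -
  have "tail_cost N \<le> W N"
    unfolding tail_cost_def W_def by (intro suminf_le summableI mult_left_mono) (auto simp: add.commute)
  then show ?thesis using W_fin[of N] by (rule le_less_trans)
qed

lemma cost_idle_free:
  assumes "balanced id q" "idle_free N q"
  shows "cost q = (\<Sum>j<N. ennreal (pmf (eavesdropper_marginal q) j) * c j)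
    + ennreal (pmf (eavesdropper_marginal q) N) * tail_cost N"
proof -
  have "cost q = (\<Sum>j<N. ennreal (pmf (eavesdropper_marginal q) j) * c j)
      + (\<Sum>m. ennreal (pmf (eavesdropper_marginal q) (m + N)) * c (m + N))"
    unfolding cost_eavesdropper by (subst suminf_offset[where i = N]) (auto simp: summableI add.commute)
  also have "(\<Sum>m. ennreal (pmf (eavesdropper_marginal q) (m + N)) * c (m + N))
      = ennreal (pmf (eavesdropper_marginal q) N) * tail_cost N"
    unfolding tail_cost_def ennreal_suminf_cmult[symmetric] eavesdropper_geometric[OF assms]
    by (simp add: ac_simps)
  finally show ?thesis .
qed

lemma cost_idle_free_fin:
  assumes "balanced id q" "idle_free N q"
  shows "cost q < \<infinity>"
  using tail_cost_fin[of N] c_fin unfolding cost_idle_free[OF assms]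
  by (auto simp: ennreal_mult_less_top)

text \<open>The boundary cells of the capped law hold the whole tail, whose mass is
  \<open>1 / le\<close> times that at holding time \<open>N\<close>. The weight \<open>le\<close> in
  the objective undoes this factor, so the objective is exact.\<close>

lemma trunc_lp_cost_eq:
  assumes bal: "balanced id q" "idle_free N q"
    and \<rho>: "\<And>i j a. i \<le> N \<Longrightarrow> j \<le> N \<Longrightarrow> \<rho> i j a = pmf (map_pmf (cap_occ N) q) (i, j, a)"
  shows "trunc_lp_cost c le N \<rho> = cost q"
proof -
  define B where "B = eavesdropper_marginal q"
  let ?q = "map_pmf (cap_occ N) q"
  have B_cap: "eavesdropper_marginal ?q = map_pmf (cap_at N) B"
    by (simp add: B_def pmf.map_comp o_def eavesdropper_of_def cap_occ_def case_prod_beta')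
  note box = boxed_map_cap_occ[of N q]
  have idle: "pmf ?q (i, N, False) = 0" for i
    using idle_free_map_cap_occ[OF bal(2)] by (simp add: idle_free_def)
  have "(\<Sum>i\<le>N. \<Sum>j<N. \<Sum>a\<in>UNIV. ennreal (\<rho> i j a) * c j) = (\<Sum>j<N. (\<Sum>i\<le>N. \<Sum>a\<in>UNIV. ennreal (pmf ?q (i, j, a))) * c j)"
    unfolding sum_distrib_right by (subst sum.swap) (intro sum.cong refl, simp add: \<rho>)
  also have "\<dots> = (\<Sum>j<N. ennreal (pmf B j) * c j)"
    using sum_boxed_eavesdropper[OF box] by (intro sum.cong refl) (simp add: B_cap pmf_map_cap_at(1) del: sum_ennreal)
  finally have interior: "(\<Sum>i\<le>N. \<Sum>j<N. \<Sum>a\<in>UNIV. ennreal (\<rho> i j a) * c j) = (\<Sum>j<N. ennreal (pmf B j) * c j)" .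
  have "(\<Sum>i\<le>N. ennreal (\<rho> i N True)) = (\<Sum>i\<le>N. \<Sum>a\<in>UNIV. ennreal (pmf ?q (i, N, a)))"
    by (intro sum.cong refl) (simp add: UNIV_bool idle \<rho> del: sum_ennreal)
  also have "\<dots> = (\<Sum>m. ennreal (pmf B (m + N)))"
    using sum_boxed_eavesdropper[OF box, of N] by (simp only: B_cap pmf_map_cap_at(2) order_refl simp_thms)
  also have "\<dots> = ennreal (1 / le) * ennreal (pmf B N)"
  proof -
    have "(\<Sum>m. ennreal (pmf B (m + N))) = (\<Sum>m. ennreal ((1 - le) ^ m)) * ennreal (pmf B N)"
      unfolding B_def eavesdropper_geometric[OF bal] by (rule ennreal_suminf_multc)
    also have "(\<Sum>m. ennreal ((1 - le) ^ m)) = ennreal (\<Sum>m. (1 - le) ^ m)"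
      using le0 le1 by (intro suminf_ennreal2 summable_geometric) auto
    also have "(\<Sum>m. (1 - le) ^ m) = 1 / le" using le0 le1 by (subst suminf_geometric) auto
    finally show ?thesis .
  qed
  finally have boundary: "(\<Sum>i\<le>N. ennreal (\<rho> i N True)) = ennreal (1 / le) * ennreal (pmf B N)" .
  have "(\<Sum>\<^sub>\<infinity>j\<in>{N..}. ennreal (le * (1 - le) ^ (j - N)) * c j) = ennreal le * tail_cost N"
  proof -
    have "(\<lambda>m. m + N) ` UNIV = {N..}" by (auto simp: image_iff) (metis le_add_diff_inverse2)
    then have "(\<Sum>\<^sub>\<infinity>j\<in>{N..}. ennreal (le * (1 - le) ^ (j - N)) * c j)
        = (\<Sum>\<^sub>\<infinity>m\<in>UNIV. ennreal (le * (1 - le) ^ m) * c (m + N))"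
      using infsum_reindex[of "\<lambda>m. m + N" UNIV "\<lambda>j. ennreal (le * (1 - le) ^ (j - N)) * c j"] by (simp add: o_def)
    also have "\<dots> = (\<Sum>m. ennreal le * (ennreal ((1 - le) ^ m) * c (m + N)))"
      unfolding infsum_ennreal_eq_mass nn_integral_count_space_nat
      using le0 le1 by (simp add: ennreal_mult mult.assoc)
    finally show ?thesis by (simp add: tail_cost_def)
  qed
  then have "trunc_lp_cost c le N \<rho> = (\<Sum>j<N. ennreal (pmf B j) * c j) + ennreal (1 / le) * ennreal (pmf B N) * (ennreal le * tail_cost N)"
    unfolding trunc_lp_cost_def interior by (simp only: sum_distrib_right[symmetric] boundary)
  also have "ennreal (1 / le) * ennreal (pmf B N) * (ennreal le * tail_cost N) = (ennreal (1 / le) * ennreal le) * (ennreal (pmf B N) * tail_cost N)"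
    by (simp only: ac_simps)
  also have "ennreal (1 / le) * ennreal le = 1" using le0 by (simp add: ennreal_mult[symmetric])
  finally show ?thesis unfolding cost_idle_free[OF bal] by (simp add: B_def)
qed

lemma average_cost_tendsto:
  assumes \<tau>: "\<And>i j. \<tau> i j \<in> {0..1}" and st: "stationary (step \<tau>) \<pi>"
    and fin: "cost (occ_of \<pi> \<tau>) < \<infinity>"
  shows "average_cost c l le la \<tau> \<longlonglongrightarrow> cost (occ_of \<pi> \<tau>)"
proof -
  have "(\<lambda>T. (\<Sum>k=1..T. \<integral>\<^sup>+x. c (snd x) \<partial>law (step \<tau>) z k) / of_nat T) \<longlonglongrightarrow> (\<integral>\<^sup>+x. c (snd x) \<partial>\<pi>)"
    using fin by (intro average_law_tendsto[OF st rigid_step[of \<tau>, OF \<tau>]]) (simp add: cost_occ_of)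
  then show ?thesis
    by (simp add: average_cost_def[abs_def] state_law_def cost_occ_of case_prod_beta')
qed

end

subsection \<open>Slater point and value convergence\<close>

definition mix :: "real \<Rightarrow> 's pmf \<Rightarrow> 's pmf \<Rightarrow> 's pmf" where
  "mix \<theta> q r = bernoulli_pmf \<theta> \<bind> (\<lambda>b. if b then q else r)"

lemma pmf_mix: "\<theta> \<in> {0..1} \<Longrightarrow> pmf (mix \<theta> q r) x = \<theta> * pmf q x + (1 - \<theta>) * pmf r x"
  unfolding mix_def by (subst pmf_bind_bernoulli) auto

lemma map_mix: "map_pmf f (mix \<theta> q r) = mix \<theta> (map_pmf f q) (map_pmf f r)"
  unfolding mix_def map_bind_pmf by (intro bind_pmf_cong refl) auto

lemma l1_mix_le:
  assumes \<theta>: "\<theta> \<in> {0..1}"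
  shows "l1 (mix \<theta> q r) w \<le> ennreal \<theta> * l1 q w + ennreal (1 - \<theta>) * l1 r w"
proof -
  have "l1 (mix \<theta> q r) w \<le> mass (\<lambda>x. ennreal \<theta> * ennreal \<bar>pmf q x - pmf w x\<bar> + ennreal (1 - \<theta>) * ennreal \<bar>pmf r x - pmf w x\<bar>)"
    unfolding l1_def
  proof (intro nn_integral_mono)
    fix x
    have "pmf (mix \<theta> q r) x - pmf w x = \<theta> * (pmf q x - pmf w x) + (1 - \<theta>) * (pmf r x - pmf w x)"
      by (simp add: pmf_mix[OF \<theta>] algebra_simps)
    also have "\<bar>\<dots>\<bar> \<le> \<theta> * \<bar>pmf q x - pmf w x\<bar> + (1 - \<theta>) * \<bar>pmf r x - pmf w x\<bar>"
      using \<theta> by (intro order_trans[OF abs_triangle_ineq]) (simp add: abs_mult)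
    finally have "ennreal \<bar>pmf (mix \<theta> q r) x - pmf w x\<bar> \<le> ennreal (\<theta> * \<bar>pmf q x - pmf w x\<bar> + (1 - \<theta>) * \<bar>pmf r x - pmf w x\<bar>)"
      by (rule ennreal_leI)
    then show "ennreal \<bar>pmf (mix \<theta> q r) x - pmf w x\<bar>
      \<le> ennreal \<theta> * ennreal \<bar>pmf q x - pmf w x\<bar> + ennreal (1 - \<theta>) * ennreal \<bar>pmf r x - pmf w x\<bar>"
      using \<theta> by (simp add: ennreal_mult)
  qed
  also have "\<dots> = ennreal \<theta> * l1 q w + ennreal (1 - \<theta>) * l1 r w"
    unfolding l1_def by (simp add: nn_integral_add nn_integral_cmult)
  finally show ?thesis .
qed

lemma infsum_pmf_sensor: "(\<Sum>\<^sub>\<infinity>j\<in>UNIV. pmf q (i, j, a)) = pmf (sensor_marginal q) (i, a)"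
proof (rule infsumI, subst has_sum_iff_mass)
  have "ennreal (pmf (sensor_marginal q) (i, a))
      = mass (\<lambda>k. mass (\<lambda>j. mass (\<lambda>b. ennreal (pmf q (k, j, b)) * of_bool (sensor_of (k, j, b) = (i, a)))))"
    unfolding pmf_map_mass by (subst mass_prod, subst mass_prod) (rule refl)
  also have "\<dots> = mass (\<lambda>j. mass (\<lambda>k. mass (\<lambda>b. ennreal (pmf q (k, j, b)) * of_bool (sensor_of (k, j, b) = (i, a)))))"
    by (rule mass_swap)
  also have "\<dots> = mass (\<lambda>j. mass (\<lambda>k. ennreal (pmf q (k, j, a)) * of_bool (k = i)))"
    by (intro nn_integral_cong) (cases a; simp add: mass_bool sensor_of_def)
  also have "\<dots> = mass (\<lambda>j. ennreal (pmf q (i, j, a)))"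
  proof (intro nn_integral_cong)
    fix j
    show "mass (\<lambda>k. ennreal (pmf q (k, j, a)) * of_bool (k = i)) = ennreal (pmf q (i, j, a))"
      by (subst nn_integral_count_space'[where A = "{i}"]) auto
  qed
  finally show "0 \<le> pmf (sensor_marginal q) (i, a) \<and>
      mass (\<lambda>j. ennreal (pmf q (i, j, a))) = ennreal (pmf (sensor_marginal q) (i, a))"
    by (simp add: pmf_nonneg)
qed (simp add: pmf_nonneg)

section \<open>The full program and the reference chain\<close>

context channel
begin

lemma lp_feasible_iff:
  assumes "0 \<le> \<epsilon>s"
  shows "lp_feasible l le la \<omega> \<epsilon>s \<rho> \<longleftrightarrow>
    (\<exists>q. balanced id q \<and> \<rho> = (\<lambda>i j a. pmf q (i, j, a)) \<and> l1 (sensor_marginal q) \<omega> \<le> ennreal \<epsilon>s)"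
proof -
  have "(\<Sum>\<^sub>\<infinity>(i, a)\<in>UNIV. \<bar>(\<Sum>\<^sub>\<infinity>j\<in>UNIV. pmf q (i, j, a)) - pmf \<omega> (i, a)\<bar>) \<le> \<epsilon>s
      \<longleftrightarrow> l1 (sensor_marginal q) \<omega> \<le> ennreal \<epsilon>s" for q
  proof -
    have "(\<Sum>\<^sub>\<infinity>(i, a)\<in>UNIV. \<bar>(\<Sum>\<^sub>\<infinity>j\<in>UNIV. pmf q (i, j, a)) - pmf \<omega> (i, a)\<bar>) = l1_dist (sensor_marginal q) \<omega>"
      unfolding l1_dist_def infsum_pmf_sensor by (intro infsum_cong) auto
    then show ?thesis unfolding l1_dist_eq[symmetric] using assms by (simp add: ennreal_le_iff)
  qed
  then show ?thesis unfolding lp_feasible_def Omega_iff by auto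
qed

lemma balanced_mix:
  assumes "balanced cap q" "balanced cap r"
  shows "balanced cap (mix \<theta> q r)"
  using assms unfolding balanced_def map_mix
  by (simp add: mix_def bind_assoc_pmf) (intro bind_pmf_cong refl, auto)

lemma pmf_sensor_step:
  assumes "\<tau>r i \<in> {0..1}"
  shows "pmf (sensor_step l la \<tau>r i) y = \<tau>r i * (l * la) * of_bool (y = 0) + (1 - \<tau>r i * (l * la)) * of_bool (y = Suc i)"
  unfolding sensor_step_def using l la assms
  by (simp add: pmf_bind_bernoulli indicator_def of_bool_def) (simp add: algebra_simps)

text \<open>A policy that ignores the eavesdropper leaves the sensor coordinate Markov on its own,
  which ties the reference chain to the joint one.\<close>

lemma map_fst_step: "map_pmf fst (step (\<lambda>i j. \<tau>r i) (i, j)) = sensor_step l la \<tau>r i"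
  unfolding joint_step_def sensor_step_def by (simp add: map_bind_pmf bind_pmf_const)

lemma push_sensor_Suc:
  assumes "\<And>i. \<tau>r i \<in> {0..1}"
  shows "push (sensor_step l la \<tau>r) d (Suc n) = d n * ennreal (1 - \<tau>r n * (l * la))"
  unfolding push_def
  by (subst nn_integral_count_space'[where A = "{n}"]) (auto simp: pmf_sensor_step[of \<tau>r, OF assms])

text \<open>The state \<open>Suc n\<close> is entered only from \<open>n\<close>, so a zero at 0
  propagates upwards.\<close>

lemma rigid_sensor:
  assumes "\<And>i. \<tau>r i \<in> {0..1}"
  shows "rigid (sensor_step l la \<tau>r) 0"
  unfolding rigid_def
proof (intro allI impI, elim conjE)
  fix d :: "nat \<Rightarrow> ennreal" assume d: "\<forall>y. push (sensor_step l la \<tau>r) d y = d y" "d 0 = 0"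
  have "d n = 0" for n
  proof (induction n)
    case (Suc n)
    then show ?case using d(1)[rule_format, of "Suc n"] push_sensor_Suc[of \<tau>r d n, OF assms] by simp
  qed (use d in simp)
  then show "d = (\<lambda>_. 0)" by auto
qed

end

context lossy_channel
begin

text \<open>An acknowledgement empties both holding times with conditional probability \<open>le\<close>, whatever the
  eavesdropper's holding time is, so the expected length of a joint cycle is that of a sensor
  cycle divided by \<open>le\<close>.\<close>

lemma reference_occupation:
  assumes \<tau>r: "\<And>i. \<tau>r i \<in> {0..1}" and st: "stationary (sensor_step l la \<tau>r) \<pi>r"
  shows "\<exists>\<pi>. stationary (step (\<lambda>i j. \<tau>r i)) \<pi> \<and> sensor_marginal (occ_of \<pi> (\<lambda>i j. \<tau>r i)) = reference_law \<tau>r \<pi>r"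
proof -
  let ?\<tau> = "\<lambda>i j :: nat. \<tau>r i"
  define S where "S i = 1 - \<tau>r i * p" for i
  have S0: "0 \<le> S i" for i
    using mult_mono[of "\<tau>r i" 1 p 1] \<tau>r[of i] p0 p1 unfolding S_def by auto
  \<comment> \<open>Expected time to the next acknowledgement from holding time \<open>i\<close>, as
    a sum of survival probabilities; \<open>E 0\<close> is the mean sensor cycle.\<close>
  define E where "E i = (\<Sum>n. \<Prod>k<n. ennreal (S (i + k)))" for i
  have E_unfold: "E i = 1 + ennreal (S i) * E (Suc i)" for i
  proof -
    have shift: "(\<Prod>k<n + 1. ennreal (S (i + k))) = ennreal (S i) * (\<Prod>k<n. ennreal (S (Suc i + k)))" for n
      unfolding Suc_eq_plus1[symmetric] prod.lessThan_Suc_shift by (simp only: add_0_right add_Suc_right add_Suc)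
    have "E i = (\<Sum>n<1. \<Prod>k<n. ennreal (S (i + k))) + (\<Sum>n. \<Prod>k<n + 1. ennreal (S (i + k)))"
      unfolding E_def by (subst add.commute, rule suminf_offset, rule summableI)
    then show ?thesis unfolding shift E_def ennreal_suminf_cmult by simp
  qed
  note cyc = stationary_eq_cycle[OF st rigid_sensor[of \<tau>r, OF \<tau>r]]
  define e where "e = 1 / pmf \<pi>r 0"
  have e0: "0 \<le> e" using cyc(1) by (simp add: e_def)
  have E0: "E 0 = ennreal e"
  proof -
    have form: "ennreal (pmf \<pi>r n) = ennreal (pmf \<pi>r 0) * (\<Prod>k<n. ennreal (S k))" for n
    proof (induction n)
      case (Suc n)
      have "ennreal (pmf \<pi>r (Suc n)) = push (sensor_step l la \<tau>r) (\<lambda>x. ennreal (pmf \<pi>r x)) (Suc n)"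
        using st by (simp add: stationary_push)
      also have "\<dots> = ennreal (pmf \<pi>r n) * ennreal (S n)"
        by (simp add: push_sensor_Suc[of \<tau>r, OF \<tau>r] S_def)
      finally show ?case unfolding Suc prod.lessThan_Suc mult.assoc .
    qed simp
    have "ennreal (pmf \<pi>r 0) * E 0 = (\<Sum>n. ennreal (pmf \<pi>r 0) * (\<Prod>k<n. ennreal (S k)))"
      unfolding E_def ennreal_suminf_cmult by (simp only: add_0_left)
    also have "\<dots> = (\<Sum>n. ennreal (pmf \<pi>r n))" by (intro suminf_cong form[symmetric])
    also have "\<dots> = 1" using mass_pmf[of \<pi>r] by (simp add: nn_integral_count_space_nat)
    finally have "inverse (ennreal (pmf \<pi>r 0)) * ennreal (pmf \<pi>r 0) * E 0 = inverse (ennreal (pmf \<pi>r 0))"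
      by (simp add: mult.assoc)
    then have "E 0 = inverse (ennreal (pmf \<pi>r 0))"
      using ennreal_mult_inverse[OF cyc(1)] by (simp only: mult.commute[of "inverse _"] mult_1_left)
    also have "\<dots> = ennreal e" using cyc(1) by (simp only: e_def inverse_ennreal inverse_eq_divide)
    finally show ?thesis .
  qed
  \<comment> \<open>Solves \<open>(1 - le) * (e + B) = B\<close>: an acknowledged packet misses the
    eavesdropper with probability \<open>1 - le\<close>, and then another sensor cycle of mean
    length \<open>e\<close> must be run.\<close>
  define B where "B = (1 - le) / le * e"
  have B0: "0 \<le> B" using e0 le0 le1 by (simp add: B_def)
  have B: "(1 - le) * (e + B) = B" using le0 by (simp add: B_def field_simps)
  define V where "V x = E (fst x) + ennreal B" for x :: "nat \<times> nat"
  have "1 + (\<integral>\<^sup>+y. (if y = z then 0 else V y) \<partial>step ?\<tau> x) \<le> V x" for x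
  proof -
    obtain i j where x: "x = (i, j)" by (cases x)
    have t: "0 \<le> \<tau>r i" "\<tau>r i \<le> 1" using \<tau>r[of i] by auto
    have nn: "0 \<le> \<tau>r i * ((1 - p) * (1 - le)) + (1 - \<tau>r i)" "0 \<le> \<tau>r i * ((1 - p) * le)" "0 \<le> \<tau>r i * (p * (1 - le))"
      using t p0 p1 le0 le1 by (auto intro!: add_nonneg_nonneg mult_nonneg_nonneg[of "\<tau>r i"] mult_nonneg_nonneg[of "1 - p"] mult_nonneg_nonneg[of p])
    have "1 + (\<integral>\<^sup>+y. (if y = z then 0 else V y) \<partial>step ?\<tau> x)
        = 1 + (ennreal (\<tau>r i * ((1 - p) * (1 - le)) + (1 - \<tau>r i)) + ennreal (\<tau>r i * ((1 - p) * le))) * (E (Suc i) + ennreal B)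
          + ennreal (\<tau>r i * (p * (1 - le))) * (E 0 + ennreal B)"
    proof -
      have "(\<integral>\<^sup>+y. (if y = z then 0 else V y) \<partial>step ?\<tau> x) =
          ennreal (\<tau>r i * ((1 - p) * (1 - le)) + (1 - \<tau>r i)) * (E (Suc i) + ennreal B) +
          ennreal (\<tau>r i * (p * (1 - le))) * (E 0 + ennreal B) +
          ennreal (\<tau>r i * ((1 - p) * le)) * (E (Suc i) + ennreal B)"
        unfolding x nn_integral_step[of ?\<tau>, OF \<tau>r] by (simp add: V_def)
      then show ?thesis by (simp only: distrib_right add.assoc add.left_commute add.commute)
    qed
    also have "ennreal (\<tau>r i * ((1 - p) * (1 - le)) + (1 - \<tau>r i)) + ennreal (\<tau>r i * ((1 - p) * le)) = ennreal (S i)"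
      unfolding ennreal_plus[OF nn(1,2), symmetric] by (simp add: S_def algebra_simps)
    also have "1 + ennreal (S i) * (E (Suc i) + ennreal B) + ennreal (\<tau>r i * (p * (1 - le))) * (E 0 + ennreal B)
        = E i + (ennreal (S i) * ennreal B + ennreal (\<tau>r i * (p * (1 - le))) * (E 0 + ennreal B))"
      unfolding E_unfold[of i] by (simp only: distrib_left add.assoc)
    also have "ennreal (S i) * ennreal B + ennreal (\<tau>r i * (p * (1 - le))) * (E 0 + ennreal B)
        = ennreal (S i * B + \<tau>r i * (p * (1 - le)) * (e + B))"
    proof -
      have "ennreal (S i) * ennreal B = ennreal (S i * B)" using S0 B0 by (simp add: ennreal_mult)
      moreover have "ennreal (\<tau>r i * (p * (1 - le))) * (E 0 + ennreal B) = ennreal (\<tau>r i * (p * (1 - le)) * (e + B))"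
        unfolding E0 ennreal_plus[OF e0 B0, symmetric] using nn(3) e0 B0 by (intro ennreal_mult[symmetric]) auto
      ultimately show ?thesis
        using ennreal_plus[of "S i * B" "\<tau>r i * (p * (1 - le)) * (e + B)"] S0[of i] B0 e0 nn(3)
          mult_nonneg_nonneg[OF S0[of i] B0] mult_nonneg_nonneg[OF nn(3) add_nonneg_nonneg[OF e0 B0]] by simp
    qed
    also have "S i * B + \<tau>r i * (p * (1 - le)) * (e + B) = B"
    proof -
      have "\<tau>r i * (p * (1 - le)) * (e + B) = \<tau>r i * p * ((1 - le) * (e + B))" by (simp only: ac_simps)
      then show ?thesis unfolding B by (simp add: S_def algebra_simps)
    qed
    finally show ?thesis by (simp add: V_def x)
  qed
  then have "mass (\<lambda>x. cycle_visits (step ?\<tau>) z x * 1) \<le> mass (\<lambda>x. indicator {z} x * V x)"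
    by (rule visits_lyapunov)
  also have "\<dots> = ennreal (e + B)" using e0 B0 by (simp add: mass_indicator_mult V_def E0)
  also have "\<dots> < \<infinity>" by simp
  finally have "mass (cycle_visits (step ?\<tau>) z) < \<infinity>" by (simp only: mult_1_right)
  from ex_stationary[OF this] obtain \<pi> where \<pi>: "stationary (step ?\<tau>) \<pi>" ..
  have "bind_pmf (map_pmf fst \<pi>) (sensor_step l la \<tau>r) = map_pmf fst (bind_pmf \<pi> (step ?\<tau>))"
    unfolding bind_map_pmf map_bind_pmf
    by (intro bind_pmf_cong refl) (auto simp: map_fst_step)
  also have "\<dots> = map_pmf fst \<pi>" using \<pi> by (simp add: stationary_def)
  \<comment> \<open>Uniqueness for the sensor chain identifies the marginal with the given reference
    law.\<close>
  finally have "stationary (sensor_step l la \<tau>r) (map_pmf fst \<pi>)" by (simp add: stationary_def)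
  then have fst: "map_pmf fst \<pi> = \<pi>r"
    by (rule stationary_unique[OF _ st rigid_sensor[of \<tau>r, OF \<tau>r]])
  have "sensor_marginal (occ_of \<pi> ?\<tau>) = reference_law \<tau>r \<pi>r"
    unfolding sensor_law_eq[symmetric] sensor_law_def reference_law_def fst[symmetric] bind_map_pmf
    by (simp add: case_prod_beta')
  then show ?thesis using \<pi> by blast
qed

end

context priced_channel
begin

text \<open>The reference occupation has distance 0, but long idle stretches may make its cost
  infinite. Its truncations have finite cost and come as close as desired.\<close>

lemma slater_point:
  assumes \<tau>r: "\<And>i. \<tau>r i \<in> {0..1}" and st: "stationary (sensor_step l la \<tau>r) \<pi>r" and \<epsilon>s: "0 < \<epsilon>s"
  shows "\<exists>q. balanced id q \<and> cost q < \<infinity> \<and> l1 (sensor_marginal q) (reference_law \<tau>r \<pi>r) < ennreal \<epsilon>s"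
proof -
  obtain \<pi> where \<pi>: "stationary (step (\<lambda>i j. \<tau>r i)) \<pi>"
      "sensor_marginal (occ_of \<pi> (\<lambda>i j. \<tau>r i)) = reference_law \<tau>r \<pi>r"
    using reference_occupation[OF \<tau>r st] by blast
  from truncated_occupation[OF \<tau>r \<pi>(1)] obtain q where
    q: "\<And>N. balanced id (q N)" "\<And>N. cost (q N) < \<infinity>" and lim: "(\<lambda>N. l1 (q N) (occ_of \<pi> (\<lambda>i j. \<tau>r i))) \<longlonglongrightarrow> 0"
    by blast
  from order_tendstoD(2)[OF lim, of "ennreal \<epsilon>s"] obtain N where "l1 (q N) (occ_of \<pi> (\<lambda>i j. \<tau>r i)) < ennreal \<epsilon>s"
    using \<epsilon>s by (auto simp: eventually_sequentially)
  then have "l1 (sensor_marginal (q N)) (reference_law \<tau>r \<pi>r) < ennreal \<epsilon>s"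
    unfolding \<pi>(2)[symmetric] by (rule le_less_trans[OF l1_map_le])
  then show ?thesis using q by blast
qed

text \<open>Mixing the optimum with a strictly feasible point leaves room for the error made by truncating.\<close>

lemma truncated_value:
  assumes q: "balanced id q" "cost q < \<infinity>" "l1 (sensor_marginal q) \<omega> \<le> ennreal \<epsilon>s"
    and r: "balanced id r" "cost r < \<infinity>" "l1 (sensor_marginal r) \<omega> < ennreal \<epsilon>s"
    and \<eta>: "0 < \<eta>"
  shows "\<forall>\<^sub>F N in sequentially. \<exists>q'. balanced id q' \<and> idle_free N q' \<and>
    l1 (sensor_marginal q') \<omega> \<le> ennreal \<epsilon>s \<and> cost q' \<le> cost q + ennreal \<eta>"
proof -
  define S where "S = enn2real (cost r)"
  define C where "C = enn2real (cost q)"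
  have S: "cost r = ennreal S" "0 \<le> S" and C: "cost q = ennreal C" "0 \<le> C"
    using q(2) r(2) by (simp_all add: S_def C_def)
  \<comment> \<open>Small enough that the strictly feasible point adds at most
    \<open>\<eta> / 2\<close> to the cost; \<open>S + 1\<close> avoids a zero denominator.\<close>
  define \<theta> where "\<theta> = min 1 (\<eta> / (2 * (S + 1)))"
  have \<theta>: "0 < \<theta>" "\<theta> \<le> 1" using \<eta> S(2) by (auto simp: \<theta>_def)
  then have \<theta>01: "\<theta> \<in> {0..1}" by simp
  have "\<theta> * S \<le> \<eta> / (2 * (S + 1)) * S" using S(2) by (intro mult_right_mono) (auto simp: \<theta>_def)
  also have "\<dots> \<le> \<eta> / 2" using S(2) \<eta> by (simp add: field_simps)
  finally have \<theta>S: "\<theta> * S \<le> \<eta> / 2" .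
  define m where "m = mix \<theta> r q"
  have "balanced id m" unfolding m_def by (intro balanced_mix r q)
  \<comment> \<open>Occupation laws are mixed, not policies; the policy of the mixture is read off
    afterwards.\<close>
  obtain \<tau> where \<tau>: "\<And>i j. \<tau> i j \<in> {0..1}" and m_eq: "m = occ_of (map_pmf state_of m) \<tau>"
    using ex_occ_disintegrate[of m] by blast
  have st: "stationary (step \<tau>) (map_pmf state_of m)"
    using \<open>balanced id m\<close> by (subst (asm) m_eq) (simp add: balanced_occ_of kern_id)
  have cost_m: "cost m = ennreal (\<theta> * S + (1 - \<theta>) * C)"
  proof -
    have "cost m = cost r * ennreal \<theta> + cost q * ennreal (1 - \<theta>)"
      unfolding m_def mix_def cost_def using \<theta> by simp
    then show ?thesis using S C \<theta> by (simp add: ennreal_mult mult.commute)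
  qed
  define \<delta> where "\<delta> = enn2real (l1 (sensor_marginal r) \<omega>)"
  have \<delta>: "l1 (sensor_marginal r) \<omega> = ennreal \<delta>" "0 \<le> \<delta>"
    using le_less_trans[OF l1_le_2[of "sensor_marginal r" \<omega>]] unfolding \<delta>_def by auto
  then have "\<delta> < \<epsilon>s" using r(3) by (simp add: ennreal_less_iff)
  note \<delta> = \<delta> this
  \<comment> \<open>Convexity turns the strict inequality for \<open>r\<close> into a slack
    \<open>\<theta> * (\<epsilon>s - \<delta>)\<close>, which truncation may use up.\<close>
  have dev_m: "l1 (sensor_marginal m) \<omega> \<le> ennreal (\<epsilon>s - \<theta> * (\<epsilon>s - \<delta>))"
  proof -
    have "l1 (sensor_marginal m) \<omega> \<le> ennreal \<theta> * ennreal \<delta> + ennreal (1 - \<theta>) * l1 (sensor_marginal q) \<omega>"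
      unfolding m_def map_mix \<delta>(1)[symmetric] by (rule l1_mix_le[OF \<theta>01])
    also have "\<dots> \<le> ennreal \<theta> * ennreal \<delta> + ennreal (1 - \<theta>) * ennreal \<epsilon>s"
      by (intro add_left_mono mult_left_mono q(3)) auto
    also have "\<dots> = ennreal (\<theta> * \<delta> + (1 - \<theta>) * \<epsilon>s)" using \<theta> \<delta> by (simp add: ennreal_mult)
    also have "\<theta> * \<delta> + (1 - \<theta>) * \<epsilon>s = \<epsilon>s - \<theta> * (\<epsilon>s - \<delta>)" by (simp add: algebra_simps)
    finally show ?thesis .
  qed
  from truncated_occupation[OF \<tau> st, folded m_eq] obtain f B where
    f: "\<And>N. balanced id (f N)" "\<And>N. idle_free N (f N)" "\<And>N. cost (f N) < \<infinity>"
    and lim: "(\<lambda>N. l1 (f N) m) \<longlonglongrightarrow> 0"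
    and B: "B \<longlonglongrightarrow> enn2real (cost m)" "\<And>N. N \<ge> 1 \<Longrightarrow> enn2real (cost (f N)) \<le> B N"
    using cost_m by auto
  have gap: "0 < \<theta> * (\<epsilon>s - \<delta>)" using \<theta> \<delta> by simp
  have "\<forall>\<^sub>F N in sequentially. l1 (f N) m < ennreal (\<theta> * (\<epsilon>s - \<delta>))"
    using gap by (intro order_tendstoD(2)[OF lim]) simp
  moreover have "\<forall>\<^sub>F N in sequentially. B N < enn2real (cost m) + \<eta> / 2"
    using \<eta> by (intro order_tendstoD(2)[OF B(1)]) simp
  ultimately show ?thesis
    using eventually_ge_at_top[of 1]
  proof eventually_elim
    case (elim N)
    have "l1 (sensor_marginal (f N)) \<omega> \<le> l1 (sensor_marginal (f N)) (sensor_marginal m) + l1 (sensor_marginal m) \<omega>"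
      by (rule l1_triangle)
    also have "\<dots> \<le> ennreal (\<theta> * (\<epsilon>s - \<delta>)) + ennreal (\<epsilon>s - \<theta> * (\<epsilon>s - \<delta>))"
      using elim(1) by (intro add_mono dev_m order_trans[OF l1_map_le]) simp
    also have "\<dots> = ennreal \<epsilon>s"
    proof -
      have "\<theta> * (\<epsilon>s - \<delta>) \<le> \<epsilon>s - \<delta>" using \<theta> \<delta>(3) by (simp add: mult_left_le_one_le)
      also have "\<dots> \<le> \<epsilon>s" using \<delta>(2) by simp
      finally have "0 \<le> \<epsilon>s - \<theta> * (\<epsilon>s - \<delta>)" by simp
      then show ?thesis using gap by (subst ennreal_plus[symmetric]) auto
    qed
    finally have dev: "l1 (sensor_marginal (f N)) \<omega> \<le> ennreal \<epsilon>s" .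
    have "enn2real (cost m) = \<theta> * S + (1 - \<theta>) * C"
      unfolding cost_m using S C \<theta> by (intro enn2real_ennreal) simp
    then have "enn2real (cost (f N)) \<le> C + \<eta>"
      using B(2)[OF elim(3)] elim(2) \<theta>S \<theta> C mult_right_mono[of "1 - \<theta>" 1 C] by simp
    then have "cost (f N) \<le> ennreal (C + \<eta>)"
      using f(3)[of N] by (metis ennreal_enn2real ennreal_leI infinity_ennreal_def)
    then have "cost (f N) \<le> cost q + ennreal \<eta>" using C \<eta> by simp
    then show ?case using f dev by blast
  qed
qed

end

subsection \<open>Truncation error\<close>

text \<open>Excludes degenerate channels: if its resetting event never occurred, a holding time
  would only ever increase.\<close>

lemma no_shift_invariant_pmf:
  fixes q :: "nat pmf"
  assumes "q = map_pmf Suc q"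
  shows False
proof -
  have "pmf q n = 0" for n
  proof (induction n)
    case 0
    have "0 \<notin> set_pmf (map_pmf Suc q)" by auto
    then show ?case using assms by (metis set_pmf_iff)
  next
    case (Suc n)
    have "pmf (map_pmf Suc q) (Suc n) = pmf q n" by (rule pmf_map_inj') simp
    then show ?case using assms Suc by simp
  qed
  then have "set_pmf q = {}" by (auto simp: set_pmf_iff)
  then show False using set_pmf_not_empty by blast
qed

lemma stationary_sensor_step_imp_pos:
  fixes l la :: real
  assumes ch: "l \<in> {0..1}" "la \<in> {0..1}" and st: "stationary (sensor_step l la \<tau>r) \<pi>"
  shows "0 < l * la"
proof (rule ccontr)
  assume "\<not> 0 < l * la"
  then have "l = 0 \<or> la = 0" using ch by (auto simp: zero_less_mult_iff less_le)
  then have "sensor_step l la \<tau>r = (\<lambda>i. return_pmf (Suc i))"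
    unfolding sensor_step_def using bernoulli_of_bool[of False] by (auto simp: bind_return_pmf bind_pmf_const)
  then have "\<pi> = map_pmf Suc \<pi>"
    using st by (simp add: stationary_def map_pmf_def comp_def)
  then show False by (rule no_shift_invariant_pmf)
qed

lemma stationary_joint_step_imp_pos:
  fixes l le la :: real
  assumes ch: "l \<in> {0..1}" "le \<in> {0..1}" "la \<in> {0..1}"
    and st: "stationary (joint_step l le la \<tau>) \<pi>"
  shows "0 < le"
proof (rule ccontr)
  assume "\<not> 0 < le"
  then have le: "le = 0" using ch by simp
  have step: "map_pmf snd (joint_step l le la \<tau> x) = return_pmf (Suc (snd x))" for x
    using bernoulli_of_bool[of False]
    unfolding joint_step_def le by (cases x) (simp add: map_bind_pmf bind_return_pmf bind_pmf_const)
  have "map_pmf snd \<pi> = map_pmf snd (bind_pmf \<pi> (joint_step l le la \<tau>))"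
    using st by (simp add: stationary_def)
  also have "\<dots> = map_pmf Suc (map_pmf snd \<pi>)"
    unfolding map_bind_pmf step by (simp add: map_pmf_def bind_assoc_pmf bind_return_pmf)
  finally show False by (rule no_shift_invariant_pmf)
qed

context priced_channel
begin

text \<open>The optimal law is the occupation law of any policy derived from it. Finiteness of its
  cost, which the convergence of averages requires, comes from comparison with the strictly feasible
  \<open>r\<close>.\<close>

lemma optimal_policy_cost:
  assumes \<epsilon>s: "0 < \<epsilon>s"
    and opt: "lp_optimal c l le la \<omega> \<epsilon>s \<rho>" and pol: "policy_of \<rho> \<tau>"
    and r: "balanced id r" "cost r < \<infinity>" "l1 (sensor_marginal r) \<omega> < ennreal \<epsilon>s"
  shows "\<exists>q. balanced id q \<and> cost q < \<infinity> \<and> l1 (sensor_marginal q) \<omega> \<le> ennreal \<epsilon>s \<and>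
    average_cost c l le la \<tau> \<longlonglongrightarrow> cost q"
proof -
  obtain q where q: "balanced id q" "\<rho> = (\<lambda>i j a. pmf q (i, j, a))" "l1 (sensor_marginal q) \<omega> \<le> ennreal \<epsilon>s"
    using opt lp_feasible_iff[of \<epsilon>s \<omega> \<rho>] \<epsilon>s by (auto simp: lp_optimal_def)
  have "lp_feasible l le la \<omega> \<epsilon>s (\<lambda>i j a. pmf r (i, j, a))"
    using r \<epsilon>s by (subst lp_feasible_iff) (auto intro!: exI[of _ r])
  then have "cost q \<le> cost r"
    using opt unfolding lp_optimal_def q(2) lp_cost_eq[symmetric] by blast
  then have fin: "cost q < \<infinity>" using r(2) by (rule le_less_trans)
  have \<tau>: "\<And>i j. \<tau> i j \<in> {0..1}" using pol by (auto simp: policy_of_def)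
  have q_eq: "q = occ_of (map_pmf state_of q) \<tau>"
  proof (rule occ_disintegrate[of \<tau>, OF \<tau>])
    fix i j assume "pmf q (i, j, True) + pmf q (i, j, False) \<noteq> 0"
    then show "\<tau> i j = pmf q (i, j, True) / (pmf q (i, j, True) + pmf q (i, j, False))"
      using pol unfolding policy_of_def q(2) by (simp add: UNIV_bool add.commute)
  qed
  have "stationary (step \<tau>) (map_pmf state_of q)"
    using q(1) by (subst (asm) q_eq) (simp add: balanced_occ_of kern_id)
  from average_cost_tendsto[of \<tau>, OF \<tau> this] have "average_cost c l le la \<tau> \<longlonglongrightarrow> cost q"
    using fin q_eq by simp
  then show ?thesis using q fin by blast
qed

text \<open>Capping the occupation law of the implemented policy returns the feasible point itself,
  so the cost can be read off exactly and the distance up to what capping hides.\<close>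

lemma truncated_policy_cost:
  assumes \<epsilon>s: "0 < \<epsilon>s"
    and feas: "trunc_lp_feasible l le la \<omega> \<epsilon>s N \<rho> \<epsilon>" and pol: "trunc_policy_of N \<rho> \<tau>"
  shows "trunc_lp_cost c le N \<rho> < \<infinity>" "average_cost c l le la \<tau> \<longlonglongrightarrow> trunc_lp_cost c le N \<rho>"
    "\<exists>!\<pi>. stationary (step \<tau>) \<pi>"
    "stationary (step \<tau>) \<pi> \<Longrightarrow> l1_dist \<omega> (sensor_law \<tau> \<pi>) \<le> \<epsilon>s + 2 * measure (measure_pmf \<omega>) {x. N \<le> fst x}"
proof -
  obtain q where q: "balanced (cap_at N) q" "idle_free N q"
      "\<And>i j a. i \<le> N \<Longrightarrow> j \<le> N \<Longrightarrow> \<rho> i j a = pmf q (i, j, a)"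
      "l1 (sensor_marginal q) (cap_law N \<omega>) \<le> ennreal \<epsilon>s"
    using feas trunc_lp_feasible_iff[of \<epsilon>s \<omega> N \<rho>] \<epsilon>s by (meson less_imp_le)
  have \<tau>: "\<And>i j. \<tau> i j \<in> {0..1}" and sat: "saturated N \<tau>"
    using pol by (auto simp: trunc_policy_of_def saturated_def)
  show ex1: "\<exists>!\<pi>. stationary (step \<tau>) \<pi>" by (rule saturated_ex1_stationary[OF \<tau> sat])
  have ratio: "\<tau> i j = pmf q (i, j, True) / (pmf q (i, j, True) + pmf q (i, j, False))"
    if "i < N" "j < N" "pmf q (i, j, True) + pmf q (i, j, False) \<noteq> 0" for i j
    using pol that q(3) unfolding trunc_policy_of_def by (simp add: UNIV_bool add.commute)
  have cap: "map_pmf (cap_occ N) (occ_of \<pi> \<tau>) = q" if "stationary (step \<tau>) \<pi>" for \<pi>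
    by (rule truncated_policy_occupation[OF \<tau> sat q(1,2) ratio that])
  obtain \<pi>0 where \<pi>0: "stationary (step \<tau>) \<pi>0" using ex1 by blast
  have bal: "balanced id (occ_of \<pi>0 \<tau>)" using \<pi>0 by (simp add: balanced_occ_of kern_id)
  note idle = saturated_idle_free[of \<tau> N \<pi>0, OF \<tau> sat]
  have eq: "trunc_lp_cost c le N \<rho> = cost (occ_of \<pi>0 \<tau>)"
    by (rule trunc_lp_cost_eq[OF bal idle]) (simp add: cap[OF \<pi>0] q(3))
  note fin = cost_idle_free_fin[OF bal idle]
  then show "trunc_lp_cost c le N \<rho> < \<infinity>" by (simp add: eq)
  show "average_cost c l le la \<tau> \<longlonglongrightarrow> trunc_lp_cost c le N \<rho>"
    unfolding eq by (rule average_cost_tendsto[of \<tau>, OF \<tau> \<pi>0 fin])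
  assume \<pi>: "stationary (step \<tau>) \<pi>"
  have "l1 \<omega> (sensor_law \<tau> \<pi>) = l1 (sensor_marginal (occ_of \<pi> \<tau>)) \<omega>"
    by (simp add: sensor_law_eq l1_commute)
  also have "\<dots> \<le> l1 (sensor_marginal q) (cap_law N \<omega>) + 2 * ennreal (measure (measure_pmf \<omega>) {x. N \<le> fst x})"
    using l1_le_cap_sensor[of "sensor_marginal (occ_of \<pi> \<tau>)" \<omega> N]
    unfolding sensor_of_cap_occ[symmetric] cap[OF \<pi>] tail_cap_sensor .
  also have "\<dots> \<le> ennreal \<epsilon>s + 2 * ennreal (measure (measure_pmf \<omega>) {x. N \<le> fst x})"
    by (intro add_right_mono q(4))
  also have "\<dots> = ennreal (\<epsilon>s + 2 * measure (measure_pmf \<omega>) {x. N \<le> fst x})"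
    using \<epsilon>s by (simp add: ennreal_mult)
  finally show "l1_dist \<omega> (sensor_law \<tau> \<pi>) \<le> \<epsilon>s + 2 * measure (measure_pmf \<omega>) {x. N \<le> fst x}"
    unfolding l1_dist_eq[symmetric] using \<epsilon>s by (subst (asm) ennreal_le_iff) auto
qed

text \<open>Capping shrinks the distance and preserves the cost of a law that never idles beyond the
  horizon, so such laws compete in the truncated program.\<close>

lemma trunc_lp_optimal_le:
  assumes \<epsilon>s: "0 < \<epsilon>s"
    and opt: "trunc_lp_optimal c l le la \<omega> \<epsilon>s N \<rho> \<epsilon>"
    and q: "balanced id q" "idle_free N q" "l1 (sensor_marginal q) \<omega> \<le> ennreal \<epsilon>s"
  shows "trunc_lp_cost c le N \<rho> \<le> cost q"
proof -
  let ?q = "map_pmf (cap_occ N) q"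
  have "l1 (sensor_marginal ?q) (cap_law N \<omega>) \<le> ennreal \<epsilon>s"
    unfolding sensor_of_cap_occ by (rule order_trans[OF l1_map_le q(3)])
  then have "\<exists>\<epsilon>'. trunc_lp_feasible l le la \<omega> \<epsilon>s N (\<lambda>i j a. pmf ?q (i, j, a)) \<epsilon>'"
    using balanced_map_cap_occ[OF q(1)] boxed_map_cap_occ idle_free_map_cap_occ[OF q(2)] \<epsilon>s
    by (subst trunc_lp_feasible_iff) auto
  then have "trunc_lp_cost c le N \<rho> \<le> trunc_lp_cost c le N (\<lambda>i j a. pmf ?q (i, j, a))"
    using opt by (auto simp: trunc_lp_optimal_def)
  also have "\<dots> = cost q" by (rule trunc_lp_cost_eq[OF q(1,2)]) simp
  finally show ?thesis .
qed

theorem truncation_error: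
  assumes \<tau>r: "\<And>i. \<tau>r i \<in> {0..1}" and st: "stationary (sensor_step l la \<tau>r) \<pi>r"
    and \<omega>: "\<omega> = reference_law \<tau>r \<pi>r" and \<epsilon>s: "0 < \<epsilon>s"
    and opt: "lp_optimal c l le la \<omega> \<epsilon>s \<rho>_opt" and pol: "policy_of \<rho>_opt \<tau>_opt"
  shows "convergent (average_cost c l le la \<tau>_opt) \<and>
    (\<exists>\<epsilon>g \<epsilon>\<omega> :: nat \<Rightarrow> real.
       \<epsilon>g \<longlonglongrightarrow> 0 \<and> \<epsilon>\<omega> \<longlonglongrightarrow> 0 \<and>
       (\<forall>N \<rho>c \<epsilon> \<tau>c.
          trunc_lp_optimal c l le la \<omega> \<epsilon>s N \<rho>c \<epsilon> \<and> trunc_policy_of N \<rho>c \<tau>c \<longrightarrow>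
            convergent (average_cost c l le la \<tau>c) \<and>
            J_e c l le la \<tau>c \<le> J_e c l le la \<tau>_opt + ennreal (\<epsilon>g N) \<and>
            (\<exists>!\<pi>. stationary (joint_step l le la \<tau>c) \<pi>) \<and>
            (\<forall>\<pi>. stationary (joint_step l le la \<tau>c) \<pi> \<longrightarrow>
               l1_dist \<omega> (sensor_law \<tau>c \<pi>) \<le> \<epsilon>s + \<epsilon>\<omega> N)))"
proof -
  obtain r where r: "balanced id r" "cost r < \<infinity>" "l1 (sensor_marginal r) \<omega> < ennreal \<epsilon>s"
    using slater_point[OF \<tau>r st \<epsilon>s] unfolding \<omega> by blast
  obtain q where q: "balanced id q" "cost q < \<infinity>" "l1 (sensor_marginal q) \<omega> \<le> ennreal \<epsilon>s"
    and lim: "average_cost c l le la \<tau>_opt \<longlonglongrightarrow> cost q"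
    using optimal_policy_cost[OF \<epsilon>s opt pol r] by blast
  have J_opt: "J_e c l le la \<tau>_opt = cost q" unfolding J_e_def by (rule limI[OF lim])
  \<comment> \<open>The error sequence must be fixed before an optimal point and its policy are
    chosen, so it is built from the optimal value, which all optimisers of one horizon
    share.\<close>
  define optval where "optval N v \<longleftrightarrow>
    (\<exists>\<rho> \<epsilon>. trunc_lp_optimal c l le la \<omega> \<epsilon>s N \<rho> \<epsilon> \<and> v = trunc_lp_cost c le N \<rho> \<and> v < \<infinity>)" for N v
  \<comment> \<open>A horizon without an optimiser gets the default 0; there is then no policy to
    bound.\<close>
  define v where "v N = (if \<exists>w. optval N w then (SOME w. optval N w) else 0)" for N
  have v_unique: "v N = w" if w: "optval N w" for N w
  proof -
    have "optval N (v N)" unfolding v_def using w by (auto intro: someI)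
    then obtain \<rho> \<epsilon> where 1: "trunc_lp_optimal c l le la \<omega> \<epsilon>s N \<rho> \<epsilon>" "v N = trunc_lp_cost c le N \<rho>"
      unfolding optval_def by blast
    obtain \<rho>' \<epsilon>' where 2: "trunc_lp_optimal c l le la \<omega> \<epsilon>s N \<rho>' \<epsilon>'" "w = trunc_lp_cost c le N \<rho>'"
      using w unfolding optval_def by blast
    have "v N \<le> w" unfolding 1(2) 2(2) using 1(1) 2(1) unfolding trunc_lp_optimal_def by blast
    moreover have "w \<le> v N" unfolding 1(2) 2(2) using 1(1) 2(1) unfolding trunc_lp_optimal_def by blast
    ultimately show ?thesis by (rule antisym)
  qed
  define \<epsilon>g where "\<epsilon>g N = max 0 (enn2real (v N) - enn2real (cost q))" for N
  have "\<epsilon>g \<longlonglongrightarrow> 0"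
  proof (rule LIMSEQ_I)
    fix \<eta> :: real assume \<eta>: "0 < \<eta>"
    from truncated_value[OF q r, of "\<eta> / 2"] \<eta> have
      "\<forall>\<^sub>F N in sequentially. \<exists>q'. balanced id q' \<and> idle_free N q' \<and>
        l1 (sensor_marginal q') \<omega> \<le> ennreal \<epsilon>s \<and> cost q' \<le> cost q + ennreal (\<eta> / 2)" by simp
    then have "\<forall>\<^sub>F N in sequentially. norm (\<epsilon>g N - 0) < \<eta>"
    proof eventually_elim
      case (elim N)
      then obtain q' where q': "balanced id q'" "idle_free N q'" "l1 (sensor_marginal q') \<omega> \<le> ennreal \<epsilon>s"
        "cost q' \<le> cost q + ennreal (\<eta> / 2)" by blast
      have "v N \<le> cost q + ennreal (\<eta> / 2)"
      proof (cases "\<exists>w. optval N w")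
        case True
        then obtain \<rho> \<epsilon> where "trunc_lp_optimal c l le la \<omega> \<epsilon>s N \<rho> \<epsilon>" "v N = trunc_lp_cost c le N \<rho>"
          using v_unique unfolding optval_def by blast
        then show ?thesis using trunc_lp_optimal_le[OF \<epsilon>s _ q'(1-3)] q'(4) by (metis order_trans)
      qed (simp add: v_def)
      also have "\<dots> = ennreal (enn2real (cost q) + \<eta> / 2)" using q(2) \<eta> by simp
      finally have "enn2real (v N) \<le> enn2real (cost q) + \<eta> / 2"
        using \<eta> by (intro enn2real_leI) auto
      then show ?case using \<eta> by (simp add: \<epsilon>g_def)
    qed
    then show "\<exists>n0. \<forall>n\<ge>n0. norm (\<epsilon>g n - 0) < \<eta>" by (simp add: eventually_sequentially)
  qed
  moreover have "(\<lambda>N. 2 * measure (measure_pmf \<omega>) {x. N \<le> fst x}) \<longlonglongrightarrow> 0"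
    using tendsto_mult_left[OF tail_tendsto_0[of \<omega>], of 2] by simp
  moreover have "convergent (average_cost c l le la \<tau>c) \<and>
      J_e c l le la \<tau>c \<le> J_e c l le la \<tau>_opt + ennreal (\<epsilon>g N) \<and>
      (\<exists>!\<pi>. stationary (step \<tau>c) \<pi>) \<and>
      (\<forall>\<pi>. stationary (step \<tau>c) \<pi> \<longrightarrow>
        l1_dist \<omega> (sensor_law \<tau>c \<pi>) \<le> \<epsilon>s + 2 * measure (measure_pmf \<omega>) {x. N \<le> fst x})"
    if tr: "trunc_lp_optimal c l le la \<omega> \<epsilon>s N \<rho>c \<epsilon>" "trunc_policy_of N \<rho>c \<tau>c" for N \<rho>c \<epsilon> \<tau>c
  proof -
    have "trunc_lp_feasible l le la \<omega> \<epsilon>s N \<rho>c \<epsilon>" using tr(1) by (simp add: trunc_lp_optimal_def)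
    note tp = truncated_policy_cost[OF \<epsilon>s this tr(2)]
    have J: "J_e c l le la \<tau>c = trunc_lp_cost c le N \<rho>c" unfolding J_e_def by (rule limI[OF tp(2)])
    have "optval N (trunc_lp_cost c le N \<rho>c)" unfolding optval_def using tr(1) tp(1) by blast
    then have v: "v N = trunc_lp_cost c le N \<rho>c" by (rule v_unique)
    have "trunc_lp_cost c le N \<rho>c = ennreal (enn2real (v N))" using tp(1) by (simp add: v)
    also have "\<dots> \<le> ennreal (enn2real (cost q) + \<epsilon>g N)" by (intro ennreal_leI) (simp add: \<epsilon>g_def)
    also have "\<dots> = cost q + ennreal (\<epsilon>g N)" using q(2) by (simp add: \<epsilon>g_def)
    finally show ?thesis using tp(2-4) unfolding J J_opt by (auto intro: convergentI)
  qed
  ultimately show ?thesis using convergentI[OF lim] by blast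
qed

end

theorem proposition9:
  fixes A Q Pbar :: "real ^ 'n ^ 'n"
    and C :: "real ^ 'n ^ 'm"
    and R :: "real ^ 'm ^ 'm"
    and l le la \<epsilon>s :: real
    and \<tau>r :: "nat \<Rightarrow> real"
    and \<pi>r :: "nat pmf"
    and \<omega> :: "(nat \<times> bool) pmf"
    and c :: "nat \<Rightarrow> ennreal"
    and \<rho>_opt :: occupation
    and \<tau>_opt :: "nat \<Rightarrow> nat \<Rightarrow> real"
  assumes "psd Q" and "psd R"
    and "observable C A" and "controllable A (psd_sqrt Q)"
    and "steady_state_posterior_cov A C Q R Pbar"
    and "l \<in> {0..1}" and "le \<in> {0..1}" and "la \<in> {0..1}"
    and "la < 1"
    and "max_eigenvalue_modulus A = 0 \<or> 1 - 1 / (max_eigenvalue_modulus A)\<^sup>2 < le"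
    and "le < 1"
    and "\<And>i. \<tau>r i \<in> {0..1}"
    and "stationary (sensor_step l la \<tau>r) \<pi>r"
    and "\<omega> = reference_law \<tau>r \<pi>r"
    and "\<epsilon>s > 0"
    and "c = error_trace A Q Pbar"
    and "lp_optimal c l le la \<omega> \<epsilon>s \<rho>_opt"
    and "policy_of \<rho>_opt \<tau>_opt"
  shows "convergent (average_cost c l le la \<tau>_opt) \<and>
    (\<exists>\<epsilon>g \<epsilon>\<omega> :: nat \<Rightarrow> real.
       \<epsilon>g \<longlonglongrightarrow> 0 \<and> \<epsilon>\<omega> \<longlonglongrightarrow> 0 \<and>
       (\<forall>N \<rho>c \<epsilon> \<tau>c.
          trunc_lp_optimal c l le la \<omega> \<epsilon>s N \<rho>c \<epsilon> \<and> trunc_policy_of N \<rho>c \<tau>c \<longrightarrow>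
            convergent (average_cost c l le la \<tau>c) \<and>
            J_e c l le la \<tau>c \<le> J_e c l le la \<tau>_opt + ennreal (\<epsilon>g N) \<and>
            (\<exists>!\<pi>. stationary (joint_step l le la \<tau>c) \<pi>) \<and>
            (\<forall>\<pi>. stationary (joint_step l le la \<tau>c) \<pi> \<longrightarrow>
               l1_dist \<omega> (sensor_law \<tau>c \<pi>) \<le> \<epsilon>s + \<epsilon>\<omega> N)))"
proof -
  have psd_P: "psd Pbar" using assms(5) by (simp add: steady_state_posterior_cov_def)
  interpret channel l le la by standard (use assms in auto)
  have p0: "0 < l * la"
    using assms(6,8,13) by (rule stationary_sensor_step_imp_pos)
  have "l * la \<le> 1 * la" using assms(6,8) by (intro mult_right_mono) auto
  then have p1: "l * la < 1" using assms(9) by simp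
  have "lp_feasible l le la \<omega> \<epsilon>s \<rho>_opt" using assms(17) by (simp add: lp_optimal_def)
  then obtain q where q: "balanced id q" using lp_feasible_iff[of \<epsilon>s] assms(15) by auto
  \<comment> \<open>A feasible point of the full program yields a stationary law of some policy,
    impossible if the eavesdropper never received a packet.\<close>
  obtain \<tau> where "q = occ_of (map_pmf state_of q) \<tau>" using ex_occ_disintegrate[of q] by blast
  then have "stationary (joint_step l le la \<tau>) (map_pmf state_of q)"
    using q by (metis balanced_occ_of kern_id)
  then have le0: "0 < le" using assms(6-8) by (intro stationary_joint_step_imp_pos)
  obtain s G where "1 < s" "s * (1 - le) < 1" "0 < G"
    and growth: "\<And>j m. error_trace A Q Pbar (j + m) \<le> ennreal (G * s ^ m) * (1 + error_trace A Q Pbar j)"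
    using error_trace_growth[OF assms(1) psd_P assms(10) le0 assms(11)] by blast
  then interpret priced_channel l le la c s G
    by unfold_locales (use p0 p1 le0 assms(11,16) in \<open>auto simp: error_trace_def\<close>)
  show ?thesis by (rule truncation_error[OF assms(12-15,17,18)])
qed

end
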